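(* Let $\Omega$ be a bounded domain with smooth boundary in the Heisenberg group $\mathbb{H}^n$ (of dimension $2n+1$), and let $0<\lambda_1\le\lambda_2\le\cdots\to+\infty$ be the eigenvalues of the Dirichlet problem for the real Kohn Laplacian, $$-\Delta_{\mathbb{H}^{n}} u = \lambda u \ \text{ in } \Omega,\qquad u=0 \ \text{ on } \partial\Omega.$$ Then for every integer $k \geq 1$: (I) $\displaystyle n\sum_{i=1}^{k}(\lambda_{k+1}-\lambda_{i})^{2} \le 2\sum_{i=1}^{k}(\lambda_{k+1}-\lambda_{i})\lambda_{i}$; (II) $\displaystyle \left( \frac{n+1}{nk}\right)\sum_{i=1}^{k} \lambda_{i}- \sqrt{\tilde D_{nk}} \;\le\; \lambda_{k+1} \;\le\; \left( \frac{n+1}{nk}\right)\sum_{i=1}^{k} \lambda_{i}+ \sqrt{\tilde D_{nk}}$, where $$\tilde D_{nk}= \left(\left(1 + \frac{1}{n}\right) \frac{1}{k} \sum_{i=1}^{k}\lambda_{i}\right)^2 -\left(1 + \frac{2}{n}\right) \frac{1}{k} \sum_{i=1}^{k}\lambda_{i}^2 \;\ge\; 0.$$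
   Context: $\mathbb{H}^n$ is $\mathbb{R}^{2n+1}$ with coordinates $(x,y,t)$, $x,y\in\mathbb{R}^n$, $t\in\mathbb{R}$, equipped with the Heisenberg group structure whose Lie algebra has basis $T=\frac{\partial}{\partial t}$, $X_{i}=\frac{\partial}{\partial x_{i}}+\frac{y_{i}}{2}\frac{\partial}{\partial t}$, $Y_{i}=\frac{\partial}{\partial y_{i}}-\frac{x_{i}}{2}\frac{\partial}{\partial t}$ ($1\le i\le n$). The real Kohn Laplacian is $\Delta_{\mathbb{H}^{n}}=\sum_{i=1}^{n}(X_{i}^{2}+Y_{i}^{2})$. Let $\nabla_{\mathbb{H}^{n}}u=(X_1(u),\dots,X_n(u),Y_1(u),\dots,Y_n(u))$. $S^{1,2}(\Omega)$ is the Hilbert space of functions $u\in L^2(\Omega)$ with $X_i(u),Y_i(u)\in L^2(\Omega)$ for all $i$, with norm $\|u\|^2_{S^{1,2}}=\int_\Omega(|\nabla_{\mathbb{H}^{n}}u|^{2}+|u|^2)\,dx\,dy\,dt$, and $S^{1,2}_0(\Omega)$ is the closure of $C_0^\infty(\Omega)$ in it. The Dirichlet problem is understood with eigenfunctions in $S^{1,2}_0(\Omega)$; its spectrum is discrete, and eigenvalues are repeated according to multiplicity. *)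

theory Defs
  imports "HOL-Analysis.Analysis"
begin

type_synonym 'n heisenberg = "(real, 'n) vec \<times> (real, 'n) vec \<times> real"

text \<open>\<open>smooth_on\<close> is meant for open sets only: the derivatives are taken at points, not within the set.\<close>

primrec Ck_on :: "nat \<Rightarrow> ('a::euclidean_space \<Rightarrow> real) \<Rightarrow> 'a set \<Rightarrow> bool" where
  "Ck_on 0 f S \<longleftrightarrow> continuous_on S f"
| "Ck_on (Suc k) f S \<longleftrightarrow>
     (\<forall>x\<in>S. f differentiable (at x)) \<and> (\<forall>v. Ck_on k (\<lambda>x. frechet_derivative f (at x) v) S)"

definition smooth_on :: "('a::euclidean_space \<Rightarrow> real) \<Rightarrow> 'a set \<Rightarrow> bool" where
  "smooth_on f S \<longleftrightarrow> (\<forall>k. Ck_on k f S)"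

text \<open>Near each of its boundary points, the set is the strict sublevel set of a smooth
  function without critical points.\<close>

definition smooth_boundary :: "'a::euclidean_space set \<Rightarrow> bool" where
  "smooth_boundary \<Omega> \<longleftrightarrow>
     (\<forall>p\<in>frontier \<Omega>. \<exists>U \<psi>. open U \<and> p \<in> U \<and> smooth_on \<psi> U \<and>
        (\<forall>q\<in>U. frechet_derivative \<psi> (at q) \<noteq> (\<lambda>v. 0)) \<and>
        \<Omega> \<inter> U = {q \<in> U. \<psi> q < 0})"

definition test_functions :: "'a::euclidean_space set \<Rightarrow> ('a \<Rightarrow> real) set" where
  "test_functions \<Omega> =
     {\<phi>. smooth_on \<phi> UNIV \<and> compact (closure {p. \<phi> p \<noteq> 0}) \<and> closure {p. \<phi> p \<noteq> 0} \<subseteq> \<Omega>}"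

text \<open>Elements of \<open>L2 \<Omega>\<close> are functions, not classes modulo null sets, and their values
  outside \<open>\<Omega>\<close> are irrelevant.\<close>

definition L2 :: "'a::euclidean_space set \<Rightarrow> ('a \<Rightarrow> real) set" where
  "L2 \<Omega> = {u. u \<in> borel_measurable (lebesgue_on \<Omega>) \<and> integrable (lebesgue_on \<Omega>) (\<lambda>p. (u p)\<^sup>2)}"


text \<open>The vector fields \<open>\<partial>/\<partial>x\<^sub>i + (y\<^sub>i/2) \<partial>/\<partial>t\<close> and \<open>\<partial>/\<partial>y\<^sub>i - (x\<^sub>i/2) \<partial>/\<partial>t\<close>, as maps assigning
  to each point a direction, and their action on functions.\<close>

definition X_field :: "'n::finite \<Rightarrow> 'n heisenberg \<Rightarrow> 'n heisenberg" where
  "X_field i = (\<lambda>(x, y, t). (axis i 1, 0, y $ i / 2))"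

definition Y_field :: "'n::finite \<Rightarrow> 'n heisenberg \<Rightarrow> 'n heisenberg" where
  "Y_field i = (\<lambda>(x, y, t). (0, axis i 1, - (x $ i / 2)))"

definition along :: "('a::euclidean_space \<Rightarrow> 'a) \<Rightarrow> ('a \<Rightarrow> real) \<Rightarrow> 'a \<Rightarrow> real" where
  "along V f = (\<lambda>p. frechet_derivative f (at p) (V p))"

definition kohn_laplacian :: "('n::finite heisenberg \<Rightarrow> real) \<Rightarrow> 'n heisenberg \<Rightarrow> real" where
  "kohn_laplacian f = (\<lambda>p. \<Sum>i\<in>UNIV.
     along (X_field i) (along (X_field i) f) p + along (Y_field i) (along (Y_field i) f) p)"

text \<open>Distributional derivatives. The fields \<open>X_field i\<close> and \<open>Y_field i\<close> are divergence free,
  so the formal adjoint of \<open>along V\<close> is its negative; for other fields the following would need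
  a divergence term. The choice in \<open>weak_along\<close> is unique up to a null subset of \<open>\<Omega>\<close>.\<close>

definition is_weak_along ::
  "'a::euclidean_space set \<Rightarrow> ('a \<Rightarrow> 'a) \<Rightarrow> ('a \<Rightarrow> real) \<Rightarrow> ('a \<Rightarrow> real) \<Rightarrow> bool" where
  "is_weak_along \<Omega> V u g \<longleftrightarrow>
     (\<forall>\<phi>\<in>test_functions \<Omega>.
        (\<integral>p. u p * along V \<phi> p \<partial>lebesgue_on \<Omega>) = - (\<integral>p. g p * \<phi> p \<partial>lebesgue_on \<Omega>))"

definition weak_along ::
  "'a::euclidean_space set \<Rightarrow> ('a \<Rightarrow> 'a) \<Rightarrow> ('a \<Rightarrow> real) \<Rightarrow> 'a \<Rightarrow> real" where
  "weak_along \<Omega> V u = (SOME g. g \<in> L2 \<Omega> \<and> is_weak_along \<Omega> V u g)"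

definition S12 :: "'n::finite heisenberg set \<Rightarrow> ('n heisenberg \<Rightarrow> real) set" where
  "S12 \<Omega> = {u \<in> L2 \<Omega>. \<forall>i.
     (\<exists>g\<in>L2 \<Omega>. is_weak_along \<Omega> (X_field i) u g) \<and> (\<exists>g\<in>L2 \<Omega>. is_weak_along \<Omega> (Y_field i) u g)}"

definition S12_norm :: "'n::finite heisenberg set \<Rightarrow> ('n heisenberg \<Rightarrow> real) \<Rightarrow> real" where
  "S12_norm \<Omega> u = sqrt (\<integral>p.
     (\<Sum>i\<in>UNIV. (weak_along \<Omega> (X_field i) u p)\<^sup>2 + (weak_along \<Omega> (Y_field i) u p)\<^sup>2) + (u p)\<^sup>2
     \<partial>lebesgue_on \<Omega>)"

definition S12_0 :: "'n::finite heisenberg set \<Rightarrow> ('n heisenberg \<Rightarrow> real) set" where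
  "S12_0 \<Omega> = {u \<in> S12 \<Omega>. \<forall>\<epsilon>>0. \<exists>\<phi>\<in>test_functions \<Omega>. S12_norm \<Omega> (\<lambda>p. u p - \<phi> p) < \<epsilon>}"

text \<open>The equation \<open>- \<Delta> u = \<mu> u\<close> holds in \<open>\<Omega>\<close> in the sense of distributions; \<open>kohn_laplacian\<close> is
  formally self-adjoint.\<close>

definition dirichlet_eigenspace ::
  "'n::finite heisenberg set \<Rightarrow> real \<Rightarrow> ('n heisenberg \<Rightarrow> real) set" where
  "dirichlet_eigenspace \<Omega> \<mu> = {u \<in> S12_0 \<Omega>. \<forall>\<phi>\<in>test_functions \<Omega>.
     (\<integral>p. u p * (- kohn_laplacian \<phi> p) \<partial>lebesgue_on \<Omega>) = \<mu> * (\<integral>p. u p * \<phi> p \<partial>lebesgue_on \<Omega>)}"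

text \<open>The eigenspace modulo null functions has dimension \<open>m\<close>; \<open>m = 0\<close> means that \<open>\<mu>\<close> is not an
  eigenvalue.\<close>

definition has_multiplicity :: "'n::finite heisenberg set \<Rightarrow> real \<Rightarrow> nat \<Rightarrow> bool" where
  "has_multiplicity \<Omega> \<mu> m \<longleftrightarrow>
     (\<exists>b. (\<forall>j<m. b j \<in> dirichlet_eigenspace \<Omega> \<mu>) \<and>
        (\<forall>c :: nat \<Rightarrow> real. (AE p in lebesgue_on \<Omega>. (\<Sum>j<m. c j * b j p) = 0) \<longrightarrow> (\<forall>j<m. c j = 0)) \<and>
        (\<forall>u\<in>dirichlet_eigenspace \<Omega> \<mu>. \<exists>c :: nat \<Rightarrow> real.
           AE p in lebesgue_on \<Omega>. u p = (\<Sum>j<m. c j * b j p)))"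

text \<open>The sequence \<open>0 < \<lambda>\<^sub>1 \<le> \<lambda>\<^sub>2 \<le> \<dots> \<rightarrow> \<infinity>\<close> of all eigenvalues, repeated according to multiplicity.
  It starts at index 1; \<open>lam 0\<close> is not constrained.\<close>

definition dirichlet_eigenvalues :: "'n::finite heisenberg set \<Rightarrow> (nat \<Rightarrow> real) \<Rightarrow> bool" where
  "dirichlet_eigenvalues \<Omega> lam \<longleftrightarrow>
     0 < lam 1 \<and> (\<forall>i\<ge>1. lam i \<le> lam (i + 1)) \<and> filterlim lam at_top sequentially \<and>
     (\<forall>\<mu>. finite {i. 1 \<le> i \<and> lam i = \<mu>} \<and> has_multiplicity \<Omega> \<mu> (card {i. 1 \<le> i \<and> lam i = \<mu>}))"

definition D_tilde :: "nat \<Rightarrow> nat \<Rightarrow> (nat \<Rightarrow> real) \<Rightarrow> real" where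
  "D_tilde n k lam = ((1 + 1 / real n) * (1 / real k) * (\<Sum>i=1..k. lam i))\<^sup>2
     - (1 + 2 / real n) * (1 / real k) * (\<Sum>i=1..k. (lam i)\<^sup>2)"

end

theory Submission
  imports Defs "HOL-Computational_Algebra.Polynomial"
begin

text \<open>The Dirichlet problem is first reduced to a statement about an abstract Hilbert space, and the
inequality is then proved there by the commutator method of Yang.

The abstract setting is a closed subspace \<open>W\<close> of \<open>H \<times> H\<^sup>m\<close>, thought of as the graph of a gradient:
\<open>(v, g) \<in> W\<close> means that \<open>v\<close> lies in the form domain and that \<open>g\<close> is its gradient, with energy
\<open>(norm g)\<^sup>2\<close>. If bounded subsets of \<open>W\<close> have relatively compact first components, then the energy of
every vector orthogonal to the first \<open>k\<close> eigenvectors \<open>u i\<close> is at least \<open>lam (k + 1)\<close> times its squared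
norm (\<open>spectral_gap\<close>): otherwise the minimiser of the quotient would be one more eigenvector with an
eigenvalue below \<open>lam (k + 1)\<close>. This gap is applied to the trial vectors
\<open>\<Phi> i = G (u i) - (\<Sum>j. inner (G (u i)) (u j) *\<^sub>R u j)\<close>, where \<open>G\<close> is a symmetric operator whose commutator
with the \<open>p\<close>-th component of the gradient is the identity and which commutes with the other components.
Then \<open>norm (\<Phi> i)\<close> and the energy of \<open>\<Phi> i\<close> are controlled by the component \<open>p\<close> of the gradient of \<open>u i\<close>,
and summation over \<open>i\<close> makes all mixed terms cancel by antisymmetry (\<open>yang_sum_inequality\<close>).
Summation over \<open>p\<close> gives the inequality (I) with \<open>m\<close> and \<open>4\<close> in place of \<open>n\<close> and \<open>2\<close>. For the Heisenberg
group \<open>m = 2 * n\<close>, the components of the gradient are the derivatives along \<open>X\<^sub>i\<close> and \<open>Y\<^sub>i\<close>, and \<open>G\<close> is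
multiplication by \<open>x\<^sub>i\<close> or \<open>y\<^sub>i\<close>: indeed \<open>X\<^sub>i x\<^sub>j = Y\<^sub>i y\<^sub>j = \<delta>\<^sub>i\<^sub>j\<close> and \<open>X\<^sub>i y\<^sub>j = Y\<^sub>i x\<^sub>j = 0\<close>.
Statement (II) is (I) read as a quadratic inequality for \<open>lam (k + 1)\<close>.

Two analytic facts are needed to fit the Dirichlet problem into this setting. The first is that weak
derivatives are unique, so that the space \<open>S12_0 \<Omega>\<close> is the closure \<open>form_domain \<Omega>\<close> of the graph of the
horizontal gradient on test functions (\<open>S12_0_iff\<close>). This rests on the density of test functions, which
is shown with products of functions of the type \<open>exp (- 1 / s)\<close>. The second is the compact embedding
into the square integrable functions (\<open>horizontal_Rellich\<close>). The flows of \<open>X\<^sub>i\<close> and \<open>Y\<^sub>i\<close> are shears, hence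
preserve volume, and moving a function along such a flow for time \<open>s\<close> changes it by at most \<open>\<bar>s\<bar>\<close> times
the norm of its derivative. A commutator of two flows is a vertical translation by \<open>s\<^sup>2\<close>, so
right translations by small group elements change a function with bounded horizontal gradient only
a little, although no derivative in the direction \<open>t\<close> is controlled. Two points of one cell of a fine
grid differ by such a small right translation, whence step functions on the grid, a finite
dimensional space, approximate all these functions uniformly well.\<close>

section \<open>Yang's inequality for a quadratic form with compact embedding\<close>

text \<open>The Gram--Schmidt process, in an inner product space of any dimension.\<close>

lemma orthonormal_basis_of_span:
  fixes B :: "'h::real_inner set"
  assumes "finite B" "independent B"
  shows "\<exists>C. finite C \<and> card C = card B \<and> span C = span B \<and>
     (\<forall>c\<in>C. norm c = 1) \<and> (\<forall>c\<in>C. \<forall>d\<in>C. c \<noteq> d \<longrightarrow> inner c d = 0)"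
  using assms
proof (induction B rule: finite_induct)
  case empty
  show ?case by (rule exI[of _ "{}"]) simp
next
  case (insert b B)
  have "independent B" "b \<notin> span B"
    using insert by (auto simp: independent_insert)
  then obtain C where C: "finite C" "card C = card B" "span C = span B"
    "\<forall>c\<in>C. norm c = 1" "\<forall>c\<in>C. \<forall>d\<in>C. c \<noteq> d \<longrightarrow> inner c d = 0"
    using insert by auto
  define b' where "b' = b - (\<Sum>c\<in>C. inner b c *\<^sub>R c)"
  have sumC: "(\<Sum>c\<in>C. inner b c *\<^sub>R c) \<in> span C"
    by (intro span_sum span_scale span_base)
  have "b' \<noteq> 0"
    using sumC \<open>b \<notin> span B\<close> C(3) by (auto simp: b'_def)
  have orth: "inner b' d = 0" if "d \<in> C" for d
  proof -
    have "(\<Sum>c\<in>C. inner b c * inner c d) = (\<Sum>c\<in>C. if c = d then inner b d else 0)"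
      using C(4,5) that by (intro sum.cong) (auto simp: norm_eq_1)
    also have "\<dots> = inner b d" using that C(1) by simp
    finally show ?thesis by (simp add: b'_def inner_diff_left inner_sum_left)
  qed
  define e where "e = (1 / norm b') *\<^sub>R b'"
  have ne: "norm e = 1" using \<open>b' \<noteq> 0\<close> by (simp add: e_def)
  have oe: "inner e d = 0" "inner d e = 0" if "d \<in> C" for d
    using orth[OF that] by (auto simp: e_def inner_commute)
  have eC: "e \<notin> C" using oe ne by (force simp: norm_eq_1)
  have "e \<in> span (insert b C)"
    unfolding e_def b'_def using sumC
    by (intro span_scale span_diff) (auto intro: span_base span_mono[THEN subsetD, rotated])
  moreover have "b \<in> span (insert e C)"
  proof -
    have "b = norm b' *\<^sub>R e + (\<Sum>c\<in>C. inner b c *\<^sub>R c)"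
      using \<open>b' \<noteq> 0\<close> by (simp add: e_def b'_def)
    moreover have "(\<Sum>c\<in>C. inner b c *\<^sub>R c) \<in> span (insert e C)"
      using sumC span_mono[of C "insert e C"] by auto
    ultimately show ?thesis
      by (metis span_add span_scale span_base insertI1)
  qed
  ultimately have "insert e C \<subseteq> span (insert b C)" "insert b C \<subseteq> span (insert e C)"
    by (auto intro: span_base)
  then have "span (insert e C) = span (insert b C)"
    by (meson antisym span_minimal subspace_span)
  also have "\<dots> = span (insert b B)"
    using C(3) by (simp add: span_insert)
  finally show ?case
    using C oe ne eC insert.hyps by (intro exI[of _ "insert e C"]) auto
qed

text \<open>The arithmetic of Yang's inequality. After multiplication by \<open>\<Lambda> - l i\<close>, which is where the
assumption \<open>l i \<le> \<Lambda>\<close> enters, and summation over \<open>i\<close>, the double sums contributed by \<open>P\<close> and by \<open>b\<close> add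
up to the sum \<open>S\<close> of a function that is antisymmetric in \<open>i\<close> and \<open>j\<close>, so that they vanish together.\<close>

lemma yang_sum_inequality:
  fixes l c P :: "nat \<Rightarrow> real" and a b :: "nat \<Rightarrow> nat \<Rightarrow> real"
  assumes sym: "\<And>i j. i \<in> I \<Longrightarrow> j \<in> I \<Longrightarrow> a i j = a j i"
    and comm: "\<And>i j. i \<in> I \<Longrightarrow> j \<in> I \<Longrightarrow> 2 * b i j = (l i - l j) * a i j"
    and P: "\<And>i. i \<in> I \<Longrightarrow> P i = 1 + 2 * (\<Sum>j\<in>I. a i j * b i j)"
    and le: "\<And>i. i \<in> I \<Longrightarrow> (\<Lambda> - l i) * P i \<le> 4 * (c i - (\<Sum>j\<in>I. (b i j)\<^sup>2))"
    and top: "\<And>i. i \<in> I \<Longrightarrow> l i \<le> \<Lambda>"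
  shows "(\<Sum>i\<in>I. (\<Lambda> - l i)\<^sup>2) \<le> 4 * (\<Sum>i\<in>I. (\<Lambda> - l i) * c i)"
proof -
  define S where "S = (\<Sum>i\<in>I. \<Sum>j\<in>I. (\<Lambda> - l i) * (\<Lambda> - l j) * (l i - l j) * (a i j)\<^sup>2)"
  have "S = (\<Sum>j\<in>I. \<Sum>i\<in>I. (\<Lambda> - l i) * (\<Lambda> - l j) * (l i - l j) * (a i j)\<^sup>2)"
    unfolding S_def by (rule sum.swap)
  also have "\<dots> = - S"
    unfolding S_def sum_negf[symmetric]
    by (intro sum.cong refl) (simp add: sym algebra_simps)
  finally have "S = 0" by simp
  moreover have "S = (\<Sum>i\<in>I. (\<Lambda> - l i)\<^sup>2 * (2 * (\<Sum>j\<in>I. a i j * b i j)))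
      + (\<Sum>i\<in>I. (\<Lambda> - l i) * (4 * (\<Sum>j\<in>I. (b i j)\<^sup>2)))"
    unfolding S_def sum_distrib_left sum.distrib[symmetric]
  proof (intro sum.cong refl)
    fix i j assume ij: "i \<in> I" "j \<in> I"
    have "(\<Lambda> - l i)\<^sup>2 * (2 * (a i j * b i j)) + (\<Lambda> - l i) * (4 * (b i j)\<^sup>2)
        = (\<Lambda> - l i)\<^sup>2 * (a i j * (2 * b i j)) + (\<Lambda> - l i) * (2 * b i j)\<^sup>2"
      by (simp add: power2_eq_square)
    also have "\<dots> = (\<Lambda> - l i) * (\<Lambda> - l j) * (l i - l j) * (a i j)\<^sup>2"
      unfolding comm[OF ij] by (simp add: power2_eq_square algebra_simps)
    finally show "(\<Lambda> - l i) * (\<Lambda> - l j) * (l i - l j) * (a i j)\<^sup>2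
        = (\<Lambda> - l i)\<^sup>2 * (2 * (a i j * b i j)) + (\<Lambda> - l i) * (4 * (b i j)\<^sup>2)" ..
  qed
  moreover have "(\<Sum>i\<in>I. (\<Lambda> - l i)\<^sup>2 * P i) \<le> (\<Sum>i\<in>I. (\<Lambda> - l i) * (4 * (c i - (\<Sum>j\<in>I. (b i j)\<^sup>2))))"
  proof (rule sum_mono)
    fix i assume i: "i \<in> I"
    have "(\<Lambda> - l i)\<^sup>2 * P i = (\<Lambda> - l i) * ((\<Lambda> - l i) * P i)"
      by (simp add: power2_eq_square)
    also have "\<dots> \<le> (\<Lambda> - l i) * (4 * (c i - (\<Sum>j\<in>I. (b i j)\<^sup>2)))"
      using le[OF i] top[OF i] by (intro mult_left_mono) auto
    finally show "(\<Lambda> - l i)\<^sup>2 * P i \<le> (\<Lambda> - l i) * (4 * (c i - (\<Sum>j\<in>I. (b i j)\<^sup>2)))" .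
  qed
  moreover have "(\<Sum>i\<in>I. (\<Lambda> - l i)\<^sup>2 * P i)
      = (\<Sum>i\<in>I. (\<Lambda> - l i)\<^sup>2) + (\<Sum>i\<in>I. (\<Lambda> - l i)\<^sup>2 * (2 * (\<Sum>j\<in>I. a i j * b i j)))"
    unfolding sum.distrib[symmetric] by (intro sum.cong refl) (simp add: P algebra_simps)
  moreover have "(\<Sum>i\<in>I. (\<Lambda> - l i) * (4 * (c i - (\<Sum>j\<in>I. (b i j)\<^sup>2))))
      = 4 * (\<Sum>i\<in>I. (\<Lambda> - l i) * c i) - (\<Sum>i\<in>I. (\<Lambda> - l i) * (4 * (\<Sum>j\<in>I. (b i j)\<^sup>2)))"
    unfolding sum_subtractf[symmetric] sum_distrib_left[of 4 "\<lambda>i. _ i * _ i"]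
    by (intro sum.cong refl) (simp add: algebra_simps)
  ultimately show ?thesis by linarith
qed

text \<open>Completing the square in \<open>\<Lambda>\<close> turns the hypothesis into this form. It implies both bounds on \<open>\<Lambda>\<close> and also
that \<open>D_tilde\<close> is nonnegative.\<close>

lemma yang_quadratic_consequence:
  fixes l :: "nat \<Rightarrow> real" and \<Lambda> :: real and n k :: nat
  assumes "n > 0" "k > 0"
    and "real n * (\<Sum>i=1..k. (\<Lambda> - l i)\<^sup>2) \<le> 2 * (\<Sum>i=1..k. (\<Lambda> - l i) * l i)"
  shows "(\<Lambda> - (real n + 1) / (real n * real k) * (\<Sum>i=1..k. l i))\<^sup>2 \<le> D_tilde n k l"
proof -
  define S T where "S = (\<Sum>i=1..k. l i)" and "T = (\<Sum>i=1..k. (l i)\<^sup>2)"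
  have e1: "(\<Sum>i=1..k. (\<Lambda> - l i)\<^sup>2) = real k * \<Lambda>\<^sup>2 - 2 * \<Lambda> * S + T"
    by (simp add: S_def T_def power2_diff sum.distrib sum_subtractf sum_distrib_left mult.assoc)
  have e2: "(\<Sum>i=1..k. (\<Lambda> - l i) * l i) = \<Lambda> * S - T"
    by (simp add: S_def T_def left_diff_distrib sum_subtractf sum_distrib_left power2_eq_square)
  have *: "real n * real k * \<Lambda>\<^sup>2 - 2 * (real n + 1) * \<Lambda> * S + (real n + 2) * T \<le> 0"
    using assms(3) unfolding e1 e2 by (simp add: algebra_simps)
  have nk: "real n * real k > 0" using assms by simp
  have "(real n * real k * \<Lambda>\<^sup>2 - 2 * (real n + 1) * \<Lambda> * S + (real n + 2) * T) / (real n * real k) \<le> 0"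
    using * nk by (simp add: divide_le_0_iff)
  moreover have "(real n * real k * \<Lambda>\<^sup>2 - 2 * (real n + 1) * \<Lambda> * S + (real n + 2) * T) / (real n * real k)
     = (\<Lambda> - (real n + 1) / (real n * real k) * S)\<^sup>2 - D_tilde n k l"
    unfolding D_tilde_def S_def[symmetric] T_def[symmetric] using assms
    by (simp add: field_simps power2_eq_square)
  ultimately show ?thesis by (simp add: S_def)
qed

lemma parallelogram_law:
  fixes x y :: "'a::real_inner"
  shows "(norm (x + y))\<^sup>2 + (norm (x - y))\<^sup>2 = 2 * (norm x)\<^sup>2 + 2 * (norm y)\<^sup>2"
  by (simp add: power2_norm_eq_inner inner_add_left inner_add_right inner_diff_left inner_diff_right)

lemma norm_add_scaled:
  fixes x w :: "'a::real_inner"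
  shows "(norm (x + t *\<^sub>R w))\<^sup>2 = (norm x)\<^sup>2 + 2 * t * inner x w + t\<^sup>2 * (norm w)\<^sup>2"
  unfolding power2_norm_eq_inner
  by (simp add: inner_add_left inner_add_right inner_commute[of w x] power2_eq_square distrib_left)

text \<open>\<open>W\<close> is the graph of a gradient with components indexed by \<open>'m\<close>, possibly only on a part of the space \<open>'h\<close>;
the energy of \<open>v\<close> is \<open>(norm g)\<^sup>2\<close> for \<open>(v, g) \<in> W\<close>. That the graph is closed makes the energy a closed
quadratic form, and \<open>compact_W\<close> says that the form domain is compactly embedded in \<open>'h\<close>.\<close>

locale form_graph =
  fixes W :: "('h::{real_inner,complete_space} \<times> ('h ^ 'm::finite)) set"
  assumes subspace_W: "subspace W"
    and closed_W: "closed W"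
    and compact_W: "\<And>f C. (\<And>j::nat. f j \<in> W) \<Longrightarrow> (\<And>j. norm (f j) \<le> C) \<Longrightarrow>
       \<exists>r v. strict_mono r \<and> (\<lambda>j. fst (f (r j))) \<longlonglongrightarrow> v"
begin

definition eigenspace :: "real \<Rightarrow> 'h set" where
  "eigenspace \<mu> = {v. \<exists>g. (v, g) \<in> W \<and> (\<forall>w h. (w, h) \<in> W \<longrightarrow> inner g h = \<mu> * inner v w)}"

lemma W_add: "(v, g) \<in> W \<Longrightarrow> (w, h) \<in> W \<Longrightarrow> (v + w, g + h) \<in> W"
  using subspace_add[OF subspace_W] by fastforce

lemma W_diff: "(v, g) \<in> W \<Longrightarrow> (w, h) \<in> W \<Longrightarrow> (v - w, g - h) \<in> W"
  using subspace_diff[OF subspace_W] by fastforce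

lemma W_scale: "(v, g) \<in> W \<Longrightarrow> (c *\<^sub>R v, c *\<^sub>R g) \<in> W"
  using subspace_scale[OF subspace_W] by fastforce

lemma W_lincomb:
  assumes "finite I" "\<And>i. i \<in> I \<Longrightarrow> (v i, g i) \<in> W"
  shows "((\<Sum>i\<in>I. c i *\<^sub>R v i), (\<Sum>i\<in>I. c i *\<^sub>R g i)) \<in> W"
  using assms
proof (induction I rule: finite_induct)
  case empty
  then show ?case using subspace_0[OF subspace_W] by (simp add: zero_prod_def)
next
  case (insert i I)
  then show ?case by (simp add: W_add W_scale)
qed

lemma subspace_eigenspace: "subspace (eigenspace \<mu>)"
proof (rule subspaceI)
  show "0 \<in> eigenspace \<mu>"
    using subspace_0[OF subspace_W] by (auto simp: eigenspace_def zero_prod_def intro!: exI[of _ 0])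
next
  fix v w assume "v \<in> eigenspace \<mu>" "w \<in> eigenspace \<mu>"
  then obtain g h where "(v, g) \<in> W" "(w, h) \<in> W"
    "\<And>x y. (x, y) \<in> W \<Longrightarrow> inner g y = \<mu> * inner v x"
    "\<And>x y. (x, y) \<in> W \<Longrightarrow> inner h y = \<mu> * inner w x"
    unfolding eigenspace_def by blast
  then show "v + w \<in> eigenspace \<mu>"
    unfolding eigenspace_def
    by (auto intro!: exI[of _ "g + h"] W_add simp: inner_add_left distrib_left)
next
  fix c v assume "v \<in> eigenspace \<mu>"
  then obtain g where "(v, g) \<in> W" "\<And>x y. (x, y) \<in> W \<Longrightarrow> inner g y = \<mu> * inner v x"
    unfolding eigenspace_def by blast
  then show "c *\<^sub>R v \<in> eigenspace \<mu>"
    unfolding eigenspace_def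
    by (auto intro!: exI[of _ "c *\<^sub>R g"] W_scale)
qed

lemma eigenspaces_orthogonal:
  assumes "v \<in> eigenspace \<mu>" "w \<in> eigenspace \<nu>" "\<mu> \<noteq> \<nu>"
  shows "inner v w = 0"
proof -
  obtain g h where "(v, g) \<in> W" "(w, h) \<in> W"
    "\<And>x y. (x, y) \<in> W \<Longrightarrow> inner g y = \<mu> * inner v x"
    "\<And>x y. (x, y) \<in> W \<Longrightarrow> inner h y = \<nu> * inner w x"
    using assms(1,2) unfolding eigenspace_def by blast
  then have "inner g h = \<mu> * inner v w" "inner h g = \<nu> * inner w v" by blast+
  then have "(\<mu> - \<nu>) * inner v w = 0"
    by (simp add: inner_commute algebra_simps)
  then show ?thesis using assms(3) by simp
qed

text \<open>The direct method. Compactness makes the vectors of a minimising sequence converge, and the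
parallelogram law then forces their gradients to form a Cauchy sequence: the midpoint of two almost
minimal vectors cannot have an energy below the minimum.\<close>

lemma minimiser_exists:
  assumes nontriv: "(v0, g0) \<in> W" "v0 \<noteq> 0" "\<And>u. u \<in> U \<Longrightarrow> inner v0 u = 0"
    and small: "(norm g0)\<^sup>2 < \<Lambda> * (norm v0)\<^sup>2"
  shows "\<exists>m v g. m < \<Lambda> \<and> (v, g) \<in> W \<and> (\<forall>u\<in>U. inner v u = 0) \<and> norm v = 1 \<and> (norm g)\<^sup>2 = m \<and>
     (\<forall>w h. (w, h) \<in> W \<longrightarrow> (\<forall>u\<in>U. inner w u = 0) \<longrightarrow> m * (norm w)\<^sup>2 \<le> (norm h)\<^sup>2)"
proof -
  define A where "A = {(v, g)\<in>W. \<forall>u\<in>U. inner v u = 0}"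
  define R where "R = {(norm g)\<^sup>2 | v g. (v, g) \<in> A \<and> norm v = 1}"
  define m where "m = Inf R"
  have bdd: "bdd_below R" by (rule bdd_belowI[of _ 0]) (auto simp: R_def)
  have scaled: "((1 / norm v) *\<^sub>R v, (1 / norm v) *\<^sub>R g) \<in> A \<and> norm ((1 / norm v) *\<^sub>R v) = 1"
    if "(v, g) \<in> A" "v \<noteq> 0" for v g
    using that W_scale unfolding A_def by auto
  have inR: "(norm g)\<^sup>2 / (norm v)\<^sup>2 \<in> R" if "(v, g) \<in> A" "v \<noteq> 0" for v g
  proof -
    have "(norm ((1 / norm v) *\<^sub>R g))\<^sup>2 \<in> R"
      using scaled[OF that] unfolding R_def by blast
    then show ?thesis by (simp add: power_divide)
  qed
  have m_le: "m * (norm v)\<^sup>2 \<le> (norm g)\<^sup>2" if "(v, g) \<in> A" for v g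
  proof (cases "v = 0")
    case False
    have "m \<le> (norm g)\<^sup>2 / (norm v)\<^sup>2"
      unfolding m_def by (rule cInf_lower[OF inR[OF that False] bdd])
    then show ?thesis using False by (simp add: field_simps)
  qed auto
  have A0: "(v0, g0) \<in> A" using nontriv by (auto simp: A_def)
  have "m \<le> (norm g0)\<^sup>2 / (norm v0)\<^sup>2"
    unfolding m_def by (rule cInf_lower[OF inR[OF A0 nontriv(2)] bdd])
  also have "\<dots> < \<Lambda>" using small nontriv(2) by (simp add: field_simps)
  finally have mL: "m < \<Lambda>" .
  have Rne: "R \<noteq> {}" using inR[OF A0 nontriv(2)] by auto
  have "\<exists>v g. (v, g) \<in> A \<and> norm v = 1 \<and> (norm g)\<^sup>2 < m + 1 / real (Suc j)" for j
  proof -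
    have "Inf R < m + 1 / real (Suc j)" by (simp add: m_def)
    then obtain x where "x \<in> R" "x < m + 1 / real (Suc j)"
      using cInf_lessD[OF Rne] by blast
    then show ?thesis by (auto simp: R_def)
  qed
  then obtain v g where vg: "\<And>j. (v j, g j) \<in> A" "\<And>j. norm (v j) = 1"
      "\<And>j. (norm (g j))\<^sup>2 < m + 1 / real (Suc j)"
    by metis
  have mge: "0 \<le> m" unfolding m_def by (rule cInf_greatest[OF Rne]) (auto simp: R_def)
  have gb: "norm (g j) \<le> m + 2" for j
  proof -
    have "(norm (g j))\<^sup>2 \<le> m + 1" using vg(3)[of j]
      by (rule order.strict_implies_order[OF order.strict_trans2]) simp
    also have "\<dots> \<le> (m + 2)\<^sup>2" using mge by (simp add: power2_eq_square algebra_simps)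
    finally show ?thesis by (rule power2_le_imp_le) (use mge in simp)
  qed
  have "norm (v j, g j) \<le> m + 3" for j
    using norm_Pair_le[of "v j" "g j"] gb[of j] vg(2)[of j] by simp
  moreover have "\<And>j. (v j, g j) \<in> W" using vg(1) by (auto simp: A_def)
  ultimately obtain r v' where r: "strict_mono r" "(\<lambda>j. v (r j)) \<longlonglongrightarrow> v'"
    using compact_W[of "\<lambda>j. (v j, g j)" "m + 3"] by auto
  \<comment> \<open>the parallelogram law, with the minimality of \<open>m\<close> applied to \<open>v i + v j\<close>\<close>
  have par: "(norm (g i - g j))\<^sup>2 \<le> 2 / real (Suc i) + 2 / real (Suc j) + m * (norm (v i - v j))\<^sup>2" for i j
  proof -
    have "(v i + v j, g i + g j) \<in> A"
      using vg(1)[of i] vg(1)[of j] W_add by (auto simp: A_def inner_add_left)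
    from m_le[OF this] have "m * (norm (v i + v j))\<^sup>2 \<le> (norm (g i + g j))\<^sup>2" .
    moreover have "(norm (v i + v j))\<^sup>2 = 4 - (norm (v i - v j))\<^sup>2"
      using parallelogram_law[of "v i" "v j"] vg(2) by simp
    moreover have "(norm (g i + g j))\<^sup>2 + (norm (g i - g j))\<^sup>2 = 2 * (norm (g i))\<^sup>2 + 2 * (norm (g j))\<^sup>2"
      using parallelogram_law[of "g i" "g j"] by simp
    ultimately show ?thesis
      using vg(3)[of i] vg(3)[of j] by (simp add: algebra_simps)
  qed
  have "Cauchy (\<lambda>j. g (r j))"
  proof (rule metric_CauchyI)
    fix e :: real assume e: "e > 0"
    define d where "d = e\<^sup>2 / (5 + m)"
    have d: "d > 0" using e mge by (simp add: d_def)
    have "Cauchy (\<lambda>j. v (r j))" using r(2) LIMSEQ_imp_Cauchy by blast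
    moreover have "sqrt d > 0" using d by simp
    ultimately obtain M1 where M1: "\<And>i j. i \<ge> M1 \<Longrightarrow> j \<ge> M1 \<Longrightarrow> norm (v (r i) - v (r j)) < sqrt d"
      unfolding Cauchy_iff by blast
    obtain M2 where M2: "1 / real (Suc M2) < d" using d nat_approx_posE by blast
    show "\<exists>M. \<forall>i\<ge>M. \<forall>j\<ge>M. dist (g (r i)) (g (r j)) < e"
    proof (intro exI allI impI)
      fix i j assume ij: "i \<ge> max M1 M2" "j \<ge> max M1 M2"
      have small: "1 / real (Suc (r i)) < d" if "i \<ge> M2" for i
      proof -
        have "M2 \<le> r i" using that seq_suble[OF r(1), of i] by simp
        then have "1 / real (Suc (r i)) \<le> 1 / real (Suc M2)" by (simp add: field_simps)
        then show ?thesis using M2 by simp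
      qed
      have "(norm (v (r i) - v (r j)))\<^sup>2 < d"
        using power_strict_mono[OF M1[of i j], of 2] ij d by simp
      then have "m * (norm (v (r i) - v (r j)))\<^sup>2 \<le> m * d" using mge by (simp add: mult_left_mono)
      then have "(norm (g (r i) - g (r j)))\<^sup>2 < 2 * d + 2 * d + m * d + d"
        using par[of "r i" "r j"] small[of i] small[of j] ij d by simp
      also have "\<dots> = (5 + m) * d" by (simp add: algebra_simps)
      also have "\<dots> = e\<^sup>2" using mge by (simp add: d_def)
      finally show "dist (g (r i)) (g (r j)) < e"
        using e by (simp add: dist_norm power2_less_imp_less)
    qed
  qed
  then obtain g' where g': "(\<lambda>j. g (r j)) \<longlonglongrightarrow> g'"
    using Cauchy_convergent_iff convergent_def by blast
  have "(\<lambda>j. (v (r j), g (r j))) \<longlonglongrightarrow> (v', g')" by (intro tendsto_Pair r g')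
  moreover have "\<And>j. (v (r j), g (r j)) \<in> W" using vg(1) by (auto simp: A_def)
  ultimately have W': "(v', g') \<in> W"
    by (rule closed_sequentially[OF closed_W, rotated])
  have orth: "inner v' u = 0" if "u \<in> U" for u
  proof -
    have "(\<lambda>j. inner (v (r j)) u) \<longlonglongrightarrow> inner v' u" by (intro tendsto_intros r)
    moreover have "\<And>j. inner (v (r j)) u = 0" using vg(1) that by (auto simp: A_def)
    ultimately show ?thesis by (simp add: LIMSEQ_const_iff)
  qed
  have "(\<lambda>j. norm (v (r j))) \<longlonglongrightarrow> norm v'" by (intro tendsto_intros r)
  then have n1: "norm v' = 1" using vg(2) by (simp add: LIMSEQ_const_iff)
  have "(norm g')\<^sup>2 \<le> m"
  proof (rule LIMSEQ_le[where Y = "\<lambda>j. m + 1 / real (Suc (r j))"])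
    show "(\<lambda>j. (norm (g (r j)))\<^sup>2) \<longlonglongrightarrow> (norm g')\<^sup>2" by (intro tendsto_intros g')
    have "(\<lambda>j. m + 1 / real (Suc j)) \<longlonglongrightarrow> m + 0"
      by (intro tendsto_add tendsto_const LIMSEQ_Suc lim_1_over_n)
    then show "(\<lambda>j. m + 1 / real (Suc (r j))) \<longlonglongrightarrow> m"
      using LIMSEQ_subseq_LIMSEQ[OF _ r(1)] by (fastforce simp: o_def)
  qed (use vg(3) less_imp_le in blast)
  moreover have "m \<le> (norm g')\<^sup>2" using m_le[of v' g'] W' orth n1 by (simp add: A_def)
  ultimately show ?thesis
    using mL W' orth n1 m_le by (intro exI[of _ m] exI[of _ v'] exI[of _ g']) (auto simp: A_def)
qed

lemma orthonormal_coefficients: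
  fixes u :: "nat \<Rightarrow> 'h"
  assumes "finite I" "\<And>i j. i \<in> I \<Longrightarrow> j \<in> I \<Longrightarrow> inner (u i) (u j) = (if i = j then 1 else 0)" "j \<in> I"
  shows "inner (\<Sum>i\<in>I. c i *\<^sub>R u i) (u j) = c j"
proof -
  have "inner (\<Sum>i\<in>I. c i *\<^sub>R u i) (u j) = (\<Sum>i\<in>I. if i = j then c j else 0)"
    unfolding inner_sum_left using assms by (intro sum.cong) auto
  then show ?thesis using assms by simp
qed

text \<open>If the conclusion failed, the minimum \<open>m\<close> of the energy quotient over the vectors orthogonal to all \<open>u i\<close>
would be smaller than \<open>\<Lambda>\<close>. A minimiser satisfies the eigenvalue equation for \<open>m\<close> against
vectors orthogonal to all \<open>u i\<close>, and, since the \<open>u i\<close> are eigenvectors themselves, also against the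
\<open>u i\<close>. So it would be an eigenvector, which \<open>gap\<close> excludes.\<close>

lemma spectral_gap:
  fixes u :: "nat \<Rightarrow> 'h"
  assumes I: "finite I"
    and orthonormal: "\<And>i j. i \<in> I \<Longrightarrow> j \<in> I \<Longrightarrow> inner (u i) (u j) = (if i = j then 1 else 0)"
    and eig: "\<And>i. i \<in> I \<Longrightarrow> u i \<in> eigenspace (l i)"
    and gap: "\<And>\<mu> v. \<mu> < \<Lambda> \<Longrightarrow> v \<in> eigenspace \<mu> \<Longrightarrow> (\<And>i. i \<in> I \<Longrightarrow> inner v (u i) = 0) \<Longrightarrow> v = 0"
    and v: "(v, g) \<in> W" "\<And>i. i \<in> I \<Longrightarrow> inner v (u i) = 0"
  shows "\<Lambda> * (norm v)\<^sup>2 \<le> (norm g)\<^sup>2"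
proof (rule ccontr)
  assume neg: "\<not> ?thesis"
  then have "v \<noteq> 0" by auto
  obtain m x y where m: "m < \<Lambda>" "(x, y) \<in> W" "\<forall>i\<in>I. inner x (u i) = 0" "norm x = 1" "(norm y)\<^sup>2 = m"
    "\<And>w h. (w, h) \<in> W \<Longrightarrow> \<forall>i\<in>I. inner w (u i) = 0 \<Longrightarrow> m * (norm w)\<^sup>2 \<le> (norm h)\<^sup>2"
  proof -
    have "inner v x = 0" if "x \<in> u ` I" for x using that v(2) by auto
    moreover have "(norm g)\<^sup>2 < \<Lambda> * (norm v)\<^sup>2" using neg by simp
    ultimately show thesis using minimiser_exists[OF v(1) \<open>v \<noteq> 0\<close>, of "u ` I" \<Lambda>] that by (simp add: ball_simps) metis
  qed
  from eig obtain d where d: "\<And>i. i \<in> I \<Longrightarrow> (u i, d i) \<in> W"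
     "\<And>i w h. i \<in> I \<Longrightarrow> (w, h) \<in> W \<Longrightarrow> inner (d i) h = l i * inner (u i) w"
    unfolding eigenspace_def by simp metis
  have EL: "inner y h = m * inner x w" if w: "(w, h) \<in> W" "\<forall>i\<in>I. inner w (u i) = 0" for w h
  proof -
    define s where "s = inner y h - m * inner x w"
    define q where "q = (norm h)\<^sup>2 - m * (norm w)\<^sup>2"
    have q: "q \<ge> 0" using m(6)[OF w] by (simp add: q_def)
    have ge: "0 \<le> 2 * t * s + t\<^sup>2 * q" for t
    proof -
      have "(x + t *\<^sub>R w, y + t *\<^sub>R h) \<in> W" by (intro W_add W_scale m(2) w(1))
      moreover have "\<forall>i\<in>I. inner (x + t *\<^sub>R w) (u i) = 0" using m(3) w by (simp add: inner_add_left)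
      ultimately have "m * (norm (x + t *\<^sub>R w))\<^sup>2 \<le> (norm (y + t *\<^sub>R h))\<^sup>2" using m(6) by blast
      moreover have "(norm (x + t *\<^sub>R w))\<^sup>2 = 1 + 2 * t * inner x w + t\<^sup>2 * (norm w)\<^sup>2"
        unfolding norm_add_scaled m(4) by simp
      moreover have "(norm (y + t *\<^sub>R h))\<^sup>2 = m + 2 * t * inner y h + t\<^sup>2 * (norm h)\<^sup>2"
        unfolding norm_add_scaled m(5) by simp
      ultimately show ?thesis by (simp add: s_def q_def algebra_simps)
    qed
    \<comment> \<open>a parameter for which the bound \<open>ge\<close> is negative unless \<open>s = 0\<close>\<close>
    define t where "t = - s / (q + 1)"
    have s: "s = - t * (q + 1)" using q by (simp add: t_def)
    have "2 * t * s + t\<^sup>2 * q = - (t\<^sup>2 * (q + 2))"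
      by (simp add: s power2_eq_square algebra_simps)
    then have "t\<^sup>2 * (q + 2) \<le> 0" using ge[of t] by simp
    then have "t = 0" using q by (simp add: mult_le_0_iff)
    then have "s = 0" using s by simp
    then show ?thesis by (simp add: s_def)
  qed
  have "inner y h = m * inner x w" if w: "(w, h) \<in> W" for w h
  proof -
    \<comment> \<open>split off the components along the \<open>u i\<close>, which contribute nothing to either side\<close>
    let ?c = "\<lambda>i. inner w (u i)"
    let ?w = "w - (\<Sum>i\<in>I. ?c i *\<^sub>R u i)" and ?h = "h - (\<Sum>i\<in>I. ?c i *\<^sub>R d i)"
    have "(?w, ?h) \<in> W" by (intro W_diff W_lincomb w I d(1))
    moreover have "\<forall>i\<in>I. inner ?w (u i) = 0"
      using orthonormal_coefficients[OF I orthonormal, where c = ?c] by (simp add: inner_diff_left)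
    ultimately have "inner y ?h = m * inner x ?w" by (rule EL)
    moreover have "inner y (d i) = 0" if "i \<in> I" for i
      using d(2)[OF that m(2)] m(3) that by (simp add: inner_commute)
    ultimately show ?thesis using m(3) by (simp add: inner_diff_right inner_sum_right)
  qed
  then have "x \<in> eigenspace m" unfolding eigenspace_def using m(2) by blast
  then have "x = 0" using gap m by blast
  then show False using m(4) by simp
qed

text \<open>The contribution of one direction \<open>p\<close>. The operator \<open>G\<close> plays the role of multiplication by a
coordinate whose gradient is the \<open>p\<close>-th unit vector: this is what \<open>G_W\<close> expresses. The gap is
applied to the component \<open>\<Phi> i\<close> of \<open>G (u i)\<close> orthogonal to the eigenvectors. The eigenvalue equation
shows that the energy of \<open>\<Phi> i\<close> exceeds \<open>l i * (norm (\<Phi> i))\<^sup>2\<close> by \<open>P i\<close>, which is computed in two ways: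
in terms of the matrices \<open>a\<close> and \<open>b\<close>, and as a product of \<open>\<Phi> i\<close> with the orthogonal component \<open>Z i\<close> of
the derivative of \<open>u i\<close>. The second form and the Cauchy--Schwarz inequality give the estimate that
\<open>yang_sum_inequality\<close> asks for.\<close>

lemma commutator_inequality:
  fixes u :: "nat \<Rightarrow> 'h" and G :: "'h \<Rightarrow> 'h" and p :: 'm
  assumes I: "finite I"
    and orthonormal: "\<And>i j. i \<in> I \<Longrightarrow> j \<in> I \<Longrightarrow> inner (u i) (u j) = (if i = j then 1 else 0)"
    and W: "\<And>i. i \<in> I \<Longrightarrow> (u i, d i) \<in> W"
    and eig: "\<And>i w h. i \<in> I \<Longrightarrow> (w, h) \<in> W \<Longrightarrow> inner (d i) h = l i * inner (u i) w"
    and gap: "\<And>v g. (v, g) \<in> W \<Longrightarrow> (\<And>i. i \<in> I \<Longrightarrow> inner v (u i) = 0) \<Longrightarrow> \<Lambda> * (norm v)\<^sup>2 \<le> (norm g)\<^sup>2"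
    and top: "\<And>i. i \<in> I \<Longrightarrow> l i \<le> \<Lambda>"
    and antisym: "\<And>v g w h. (v, g) \<in> W \<Longrightarrow> (w, h) \<in> W \<Longrightarrow> inner (g $ p) w = - inner v (h $ p)"
    and G_sym: "\<And>v w. inner (G v) w = inner v (G w)"
    and G_W: "\<And>v g. (v, g) \<in> W \<Longrightarrow> (G v, \<chi> q. G (g $ q) + (if q = p then v else 0)) \<in> W"
  shows "(\<Sum>i\<in>I. (\<Lambda> - l i)\<^sup>2) \<le> 4 * (\<Sum>i\<in>I. (\<Lambda> - l i) * (norm (d i $ p))\<^sup>2)"
proof -
  define a where "a = (\<lambda>i j. inner (G (u i)) (u j))"
  define b where "b = (\<lambda>i j. inner (d i $ p) (u j))"
  define D where "D = (\<lambda>v (g :: 'h ^ 'm). \<chi> q. G (g $ q) + (if q = p then v else 0))"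
  have inner_D: "inner h (D v g) = (\<Sum>q\<in>UNIV. inner (h $ q) (G (g $ q))) + inner (h $ p) v" for h v g
  proof -
    have "inner h (D v g) = (\<Sum>q\<in>UNIV. inner (h $ q) (G (g $ q)) + (if q = p then inner (h $ p) v else 0))"
      by (auto simp: inner_vec_def D_def inner_add_right intro!: sum.cong)
    then show ?thesis by (simp add: sum.distrib)
  qed
  have DW: "(G v, D v g) \<in> W" if "(v, g) \<in> W" for v g
    using G_W[OF that] by (simp add: D_def)
  have G_comm: "inner v (G w) = inner w (G v)" for v w
    using G_sym[of v w] by (simp add: inner_commute)
  define \<Phi> where "\<Phi> = (\<lambda>i. G (u i) - (\<Sum>j\<in>I. a i j *\<^sub>R u j))"
  define \<Psi> where "\<Psi> = (\<lambda>i. D (u i) (d i) - (\<Sum>j\<in>I. a i j *\<^sub>R d j))"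
  define Z where "Z = (\<lambda>i. d i $ p - (\<Sum>j\<in>I. b i j *\<^sub>R u j))"
  define P where "P = (\<lambda>i. - 2 * inner (d i $ p) (\<Phi> i))"
  have \<Phi>W: "(\<Phi> i, \<Psi> i) \<in> W" if "i \<in> I" for i
    unfolding \<Phi>_def \<Psi>_def by (intro W_diff DW W_lincomb W I that)
  have \<Phi>_orth: "inner (\<Phi> i) (u j) = 0" if "j \<in> I" for i j
    unfolding \<Phi>_def inner_diff_left using orthonormal_coefficients[OF I orthonormal that, where c = "a i"]
    by (simp add: a_def)
  have a_sym: "a i j = a j i" for i j
    unfolding a_def by (subst G_sym) (rule inner_commute)
  have b_anti: "b i j = - b j i" if "i \<in> I" "j \<in> I" for i j
    unfolding b_def using antisym[OF W W, OF that] by (simp add: inner_commute)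
  \<comment> \<open>the matrix of the commutator of the energy with \<open>G\<close>, computed from the two eigenvalue equations\<close>
  have comm: "2 * b i j = (l i - l j) * a i j" if ij: "i \<in> I" "j \<in> I" for i j
  proof -
    have "inner (d j) (D (u i) (d i)) = l j * a i j"
      using eig[OF ij(2) DW[OF W[OF ij(1)]]] by (simp add: a_def inner_commute)
    moreover have "inner (d i) (D (u j) (d j)) = l i * a i j"
      using eig[OF ij(1) DW[OF W[OF ij(2)]]] by (simp only: a_def G_sym)
    moreover have "(\<Sum>q\<in>UNIV. inner (d j $ q) (G (d i $ q))) = (\<Sum>q\<in>UNIV. inner (d i $ q) (G (d j $ q)))"
      by (intro sum.cong refl G_comm)
    ultimately have "b i j - b j i = (l i - l j) * a i j"
      by (simp add: inner_D b_def algebra_simps)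
    then show ?thesis using b_anti[OF ij] by simp
  qed
  have norm_\<Psi>: "(norm (\<Psi> i))\<^sup>2 = l i * (norm (\<Phi> i))\<^sup>2 + P i" if i: "i \<in> I" for i
  proof -
    have "(norm (\<Psi> i))\<^sup>2 = inner (\<Psi> i) (D (u i) (d i)) - (\<Sum>j\<in>I. a i j * inner (\<Psi> i) (d j))"
      by (simp add: power2_norm_eq_inner \<Psi>_def inner_diff_right inner_sum_right)
    also have "(\<Sum>j\<in>I. a i j * inner (\<Psi> i) (d j)) = 0"
      using eig[OF _ \<Phi>W[OF i]] \<Phi>_orth by (intro sum.neutral) (simp add: inner_commute)
    also have "inner (\<Psi> i) (D (u i) (d i)) = inner (d i) (D (\<Phi> i) (\<Psi> i)) - inner (d i $ p) (\<Phi> i) + inner (\<Psi> i $ p) (u i)"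
    proof -
      have "(\<Sum>q\<in>UNIV. inner (\<Psi> i $ q) (G (d i $ q))) = (\<Sum>q\<in>UNIV. inner (d i $ q) (G (\<Psi> i $ q)))"
        by (intro sum.cong refl G_comm)
      then show ?thesis by (simp add: inner_D)
    qed
    also have "inner (d i) (D (\<Phi> i) (\<Psi> i)) = l i * inner (G (u i)) (\<Phi> i)"
      using eig[OF i DW[OF \<Phi>W[OF i]]] by (simp only: G_sym)
    also have "inner (G (u i)) (\<Phi> i) = (norm (\<Phi> i))\<^sup>2"
    proof -
      have "inner (\<Phi> i) (\<Phi> i) = inner (G (u i)) (\<Phi> i) - (\<Sum>j\<in>I. a i j * inner (u j) (\<Phi> i))"
        by (subst (1) \<Phi>_def) (simp add: inner_diff_left inner_sum_left)
      also have "(\<Sum>j\<in>I. a i j * inner (u j) (\<Phi> i)) = 0"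
        using \<Phi>_orth by (intro sum.neutral) (simp add: inner_commute)
      finally show ?thesis by (simp add: power2_norm_eq_inner)
    qed
    also have "inner (\<Psi> i $ p) (u i) = - inner (d i $ p) (\<Phi> i)"
      using antisym[OF \<Phi>W[OF i] W[OF i]] by (simp add: inner_commute)
    finally show ?thesis by (simp add: P_def)
  qed
  have P_eq: "P i = 1 + 2 * (\<Sum>j\<in>I. a i j * b i j)" if i: "i \<in> I" for i
  proof -
    have "inner (d i $ p) (G (u i)) = - inner (u i) (D (u i) (d i) $ p)"
      by (rule antisym[OF W[OF i] DW[OF W[OF i]]])
    also have "\<dots> = - inner (d i $ p) (G (u i)) - 1"
      using orthonormal[OF i i] G_comm[of "u i"] by (simp add: D_def inner_add_right)
    finally have "- 2 * inner (d i $ p) (G (u i)) = 1" by simp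
    then show ?thesis
      by (simp add: P_def \<Phi>_def inner_diff_right inner_sum_right b_def algebra_simps)
  qed
  have P_Z: "P i = - 2 * inner (Z i) (\<Phi> i)" for i
  proof -
    have "(\<Sum>j\<in>I. b i j * inner (u j) (\<Phi> i)) = 0"
      using \<Phi>_orth by (intro sum.neutral) (simp add: inner_commute)
    then show ?thesis by (simp add: P_def Z_def inner_diff_left inner_sum_left)
  qed
  have norm_Z: "(norm (Z i))\<^sup>2 = (norm (d i $ p))\<^sup>2 - (\<Sum>j\<in>I. (b i j)\<^sup>2)" for i
  proof -
    let ?s = "\<Sum>j\<in>I. b i j *\<^sub>R u j"
    have ss: "inner ?s ?s = (\<Sum>j\<in>I. (b i j)\<^sup>2)"
      unfolding inner_sum_right[of _ _ I] inner_scaleR_right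
      by (intro sum.cong refl) (simp add: orthonormal_coefficients[OF I orthonormal] power2_eq_square)
    have ds: "inner (d i $ p) ?s = (\<Sum>j\<in>I. (b i j)\<^sup>2)"
      by (simp add: inner_sum_right b_def power2_eq_square)
    have "(norm (Z i))\<^sup>2 = inner (d i $ p) (d i $ p) - 2 * inner (d i $ p) ?s + inner ?s ?s"
      unfolding power2_norm_eq_inner Z_def by (simp only: inner_diff_left inner_diff_right inner_commute)
    then show ?thesis unfolding ss ds by (simp add: power2_norm_eq_inner)
  qed
  have key: "(\<Lambda> - l i) * P i \<le> 4 * ((norm (d i $ p))\<^sup>2 - (\<Sum>j\<in>I. (b i j)\<^sup>2))" if i: "i \<in> I" for i
  proof -
    have "\<Lambda> * (norm (\<Phi> i))\<^sup>2 \<le> l i * (norm (\<Phi> i))\<^sup>2 + P i"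
      using gap[OF \<Phi>W[OF i]] \<Phi>_orth norm_\<Psi>[OF i] by simp
    then have 1: "(\<Lambda> - l i) * (norm (\<Phi> i))\<^sup>2 \<le> P i" by (simp add: algebra_simps)
    have P0: "0 \<le> P i" using 1 top[OF i] by (smt (verit) mult_nonneg_nonneg zero_le_power2)
    have "\<bar>inner (Z i) (\<Phi> i)\<bar> \<le> norm (Z i) * norm (\<Phi> i)" by (rule Cauchy_Schwarz_ineq2)
    then have "(inner (Z i) (\<Phi> i))\<^sup>2 \<le> (norm (Z i) * norm (\<Phi> i))\<^sup>2"
      by (metis abs_ge_zero power2_abs power_mono)
    then have "(P i)\<^sup>2 \<le> 4 * (norm (Z i))\<^sup>2 * (norm (\<Phi> i))\<^sup>2"
      by (simp add: P_Z power_mult_distrib)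
    \<comment> \<open>divide by \<open>P i\<close> afterwards; it may vanish, and then the right-hand side is nonnegative anyway\<close>
    then have "(\<Lambda> - l i) * (P i)\<^sup>2 \<le> (\<Lambda> - l i) * (4 * (norm (Z i))\<^sup>2 * (norm (\<Phi> i))\<^sup>2)"
      using top[OF i] by (intro mult_left_mono) auto
    also have "\<dots> = 4 * (norm (Z i))\<^sup>2 * ((\<Lambda> - l i) * (norm (\<Phi> i))\<^sup>2)" by simp
    also have "\<dots> \<le> 4 * (norm (Z i))\<^sup>2 * P i" using 1 by (intro mult_left_mono) auto
    finally have 2: "P i * ((\<Lambda> - l i) * P i) \<le> P i * (4 * (norm (Z i))\<^sup>2)"
      by (simp add: power2_eq_square algebra_simps)
    show ?thesis
    proof (cases "P i = 0")
      case True
      then show ?thesis using zero_le_power2[of "norm (Z i)"] norm_Z[of i] by simp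
    next
      case False
      then have "(\<Lambda> - l i) * P i \<le> 4 * (norm (Z i))\<^sup>2" using 2 P0 by simp
      then show ?thesis by (simp add: norm_Z)
    qed
  qed
  show ?thesis
    using yang_sum_inequality[of I a b l P \<Lambda>, OF a_sym comm P_eq key top] .
qed

text \<open>The multiplicities allow one to number an orthonormal family of eigenvectors so that \<open>u i\<close> belongs to
\<open>lam i\<close>, and the first \<open>k\<close> of them exhaust all eigenvalues below \<open>lam (k + 1)\<close>, as \<open>spectral_gap\<close>
requires. Adding up the inequalities for all directions \<open>p\<close>, the squared norms of the components of
the gradient of \<open>u i\<close> sum to \<open>lam i\<close>.\<close>

theorem yang_inequality:
  fixes lam :: "nat \<Rightarrow> real" and G :: "'m \<Rightarrow> 'h \<Rightarrow> 'h" and k :: nat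
  assumes mono: "\<And>i. 1 \<le> i \<Longrightarrow> lam i \<le> lam (i + 1)"
    and fin: "\<And>\<mu>. finite {i. 1 \<le> i \<and> lam i = \<mu>}"
    and mult: "\<And>\<mu>. \<exists>B. finite B \<and> independent B \<and> span B = eigenspace \<mu> \<and> card B = card {i. 1 \<le> i \<and> lam i = \<mu>}"
    and antisym: "\<And>p v g w h. (v, g) \<in> W \<Longrightarrow> (w, h) \<in> W \<Longrightarrow> inner (g $ p) w = - inner v (h $ p)"
    and G_sym: "\<And>p v w. inner (G p v) w = inner v (G p w)"
    and G_W: "\<And>p v g. (v, g) \<in> W \<Longrightarrow> (G p v, \<chi> q. G p (g $ q) + (if q = p then v else 0)) \<in> W"
  shows "real CARD('m) * (\<Sum>i=1..k. (lam (k + 1) - lam i)\<^sup>2) \<le> 4 * (\<Sum>i=1..k. (lam (k + 1) - lam i) * lam i)"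
proof -
  have le: "lam i \<le> lam j" if "1 \<le> i" "i \<le> j" for i j
    using that(2) by (induction j rule: dec_induct) (use that(1) mono in \<open>auto intro: order_trans\<close>)
  have "\<exists>C. finite C \<and> card C = card {i. 1 \<le> i \<and> lam i = \<mu>} \<and> span C = eigenspace \<mu> \<and>
     (\<forall>c\<in>C. norm c = 1) \<and> (\<forall>c\<in>C. \<forall>d\<in>C. c \<noteq> d \<longrightarrow> inner c d = 0)" for \<mu>
    using mult[of \<mu>] orthonormal_basis_of_span by metis
  then obtain C where C: "\<And>\<mu>. finite (C \<mu>)" "\<And>\<mu>. card (C \<mu>) = card {i. 1 \<le> i \<and> lam i = \<mu>}"
    "\<And>\<mu>. span (C \<mu>) = eigenspace \<mu>" "\<And>\<mu> c. c \<in> C \<mu> \<Longrightarrow> norm c = 1"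
    "\<And>\<mu> c d. c \<in> C \<mu> \<Longrightarrow> d \<in> C \<mu> \<Longrightarrow> c \<noteq> d \<Longrightarrow> inner c d = 0"
    by metis
  have "\<exists>f. bij_betw f {i. 1 \<le> i \<and> lam i = \<mu>} (C \<mu>)" for \<mu>
    using finite_same_card_bij[OF fin C(1)] C(2) by metis
  then obtain f where f: "\<And>\<mu>. bij_betw (f \<mu>) {i. 1 \<le> i \<and> lam i = \<mu>} (C \<mu>)" by metis
  define u where "u = (\<lambda>i. f (lam i) i)"
  have uC: "u i \<in> C (lam i)" if "1 \<le> i" for i
    using bij_betwE[OF f[of "lam i"]] that by (auto simp: u_def)
  have u_eig: "u i \<in> eigenspace (lam i)" if "1 \<le> i" for i
    using uC[OF that] C(3) span_base by blast
  have orthonormal: "inner (u i) (u j) = (if i = j then 1 else 0)" if ij: "1 \<le> i" "1 \<le> j" for i j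
  proof (cases "lam i = lam j")
    case True
    show ?thesis
    proof (cases "i = j")
      case False
      then have "u i \<noteq> u j"
        using f[of "lam i"] ij True unfolding bij_betw_def inj_on_def u_def by auto
      then show ?thesis using C(5) uC ij True False by metis
    qed (use C(4)[OF uC[OF ij(1)]] in \<open>auto simp: norm_eq_1\<close>)
  next
    case False
    then show ?thesis using eigenspaces_orthogonal[OF u_eig u_eig] ij by auto
  qed
  define \<Lambda> where "\<Lambda> = lam (k + 1)"
  have gap0: "v = 0" if v: "\<mu> < \<Lambda>" "v \<in> eigenspace \<mu>" "\<And>i. i \<in> {1..k} \<Longrightarrow> inner v (u i) = 0" for \<mu> v
  proof -
    have "inner v c = 0" if "c \<in> C \<mu>" for c
    proof -
      have "c \<in> f \<mu> ` {i. 1 \<le> i \<and> lam i = \<mu>}"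
        using bij_betw_imp_surj_on[OF f[of \<mu>]] that by (rule ssubst)
      then obtain i where i: "1 \<le> i" "lam i = \<mu>" "c = f \<mu> i" by blast
      have "i \<le> k"
      proof (rule ccontr)
        assume "\<not> i \<le> k"
        then have "\<Lambda> \<le> lam i" unfolding \<Lambda>_def by (intro le) auto
        then show False using v(1) i by simp
      qed
      then show ?thesis using v(3)[of i] i by (simp add: u_def)
    qed
    moreover have "v \<in> span (C \<mu>)" using v(2) C(3) by simp
    ultimately have "orthogonal v v" using orthogonal_to_span[of v "C \<mu>" v] by (simp add: orthogonal_def)
    then show "v = 0" by (simp add: orthogonal_def)
  qed
  have "\<exists>d. (u i, d) \<in> W \<and> (\<forall>w h. (w, h) \<in> W \<longrightarrow> inner d h = lam i * inner (u i) w)" if "1 \<le> i" for i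
    using u_eig[OF that] by (auto simp: eigenspace_def)
  then obtain d where d: "\<And>i. 1 \<le> i \<Longrightarrow> (u i, d i) \<in> W"
    "\<And>i w h. 1 \<le> i \<Longrightarrow> (w, h) \<in> W \<Longrightarrow> inner (d i) h = lam i * inner (u i) w"
    by metis
  have gap: "\<Lambda> * (norm v)\<^sup>2 \<le> (norm g)\<^sup>2"
    if "(v, g) \<in> W" "\<And>i. i \<in> {1..k} \<Longrightarrow> inner v (u i) = 0" for v g
    by (rule spectral_gap[of "{1..k}" u lam \<Lambda>]) (use that gap0 orthonormal u_eig in auto)
  have each: "(\<Sum>i=1..k. (\<Lambda> - lam i)\<^sup>2) \<le> 4 * (\<Sum>i=1..k. (\<Lambda> - lam i) * (norm (d i $ p))\<^sup>2)" for p
  proof (rule commutator_inequality[of "{1..k}" u d lam \<Lambda> p "G p"])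
    show "lam i \<le> \<Lambda>" if "i \<in> {1..k}" for i unfolding \<Lambda>_def using that by (intro le) auto
  qed (use orthonormal d gap antisym G_sym G_W in auto)
  have normd: "(\<Sum>p\<in>UNIV. (norm (d i $ p))\<^sup>2) = lam i" if "1 \<le> i" for i
  proof -
    have "inner (d i) (d i) = lam i * inner (u i) (u i)" by (rule d(2)[OF that d(1)[OF that]])
    then show ?thesis using orthonormal[OF that that] by (simp add: inner_vec_def power2_norm_eq_inner)
  qed
  have "real CARD('m) * (\<Sum>i=1..k. (\<Lambda> - lam i)\<^sup>2) = (\<Sum>p\<in>(UNIV::'m set). \<Sum>i=1..k. (\<Lambda> - lam i)\<^sup>2)"
    by simp
  also have "\<dots> \<le> (\<Sum>p\<in>(UNIV::'m set). 4 * (\<Sum>i=1..k. (\<Lambda> - lam i) * (norm (d i $ p))\<^sup>2))"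
    by (rule sum_mono) (rule each)
  also have "\<dots> = 4 * (\<Sum>i=1..k. (\<Lambda> - lam i) * (\<Sum>p\<in>(UNIV::'m set). (norm (d i $ p))\<^sup>2))"
    unfolding sum_distrib_left by (rule sum.swap)
  also have "\<dots> = 4 * (\<Sum>i=1..k. (\<Lambda> - lam i) * lam i)"
    by (intro arg_cong[where f = "\<lambda>x. 4 * x"] sum.cong refl) (simp add: normd)
  finally show ?thesis by (simp add: \<Lambda>_def)
qed

end

section \<open>The Hilbert space of square integrable functions\<close>

definition sq_integrable :: "('a::euclidean_space \<Rightarrow> real) \<Rightarrow> bool" where
  "sq_integrable u \<longleftrightarrow> u \<in> borel_measurable lebesgue \<and> integrable lebesgue (\<lambda>p. (u p)\<^sup>2)"

lemma sq_integrable_mult: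
  assumes "sq_integrable u" "sq_integrable v"
  shows "integrable lebesgue (\<lambda>p. u p * v p)"
proof (rule Bochner_Integration.integrable_bound)
  show "integrable lebesgue (\<lambda>p. (u p)\<^sup>2 + (v p)\<^sup>2)"
    using assms by (auto simp: sq_integrable_def)
  show "(\<lambda>p. u p * v p) \<in> borel_measurable lebesgue"
    using assms by (auto simp: sq_integrable_def)
  show "AE p in lebesgue. norm (u p * v p) \<le> norm ((u p)\<^sup>2 + (v p)\<^sup>2)"
  proof (rule AE_I2)
    fix p
    have "2 * \<bar>u p\<bar> * \<bar>v p\<bar> \<le> \<bar>u p\<bar>\<^sup>2 + \<bar>v p\<bar>\<^sup>2" by (rule sum_squares_bound)
    moreover have "0 \<le> \<bar>u p\<bar> * \<bar>v p\<bar>" by simp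
    ultimately have "\<bar>u p\<bar> * \<bar>v p\<bar> \<le> (u p)\<^sup>2 + (v p)\<^sup>2" unfolding power2_abs by linarith
    then show "norm (u p * v p) \<le> norm ((u p)\<^sup>2 + (v p)\<^sup>2)" by (simp add: abs_mult)
  qed
qed

lemma sq_integrable_zero: "sq_integrable (\<lambda>p. 0)"
  by (simp add: sq_integrable_def)

lemma sq_integrable_add:
  assumes "sq_integrable u" "sq_integrable v"
  shows "sq_integrable (\<lambda>p. u p + v p)"
proof -
  have "(\<lambda>p. (u p + v p)\<^sup>2) = (\<lambda>p. (u p)\<^sup>2 + (v p)\<^sup>2 + 2 * (u p * v p))"
    by (auto simp: power2_sum)
  then show ?thesis
    using assms sq_integrable_mult[OF assms] by (auto simp: sq_integrable_def)
qed

lemma sq_integrable_bounded_mult: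
  fixes m :: "'a::euclidean_space \<Rightarrow> real"
  assumes "m \<in> borel_measurable lebesgue" "\<And>p. \<bar>m p\<bar> \<le> C" "sq_integrable u"
  shows "sq_integrable (\<lambda>p. m p * u p)"
  unfolding sq_integrable_def
proof
  show "(\<lambda>p. m p * u p) \<in> borel_measurable lebesgue"
    using assms by (auto simp: sq_integrable_def)
  show "integrable lebesgue (\<lambda>p. (m p * u p)\<^sup>2)"
  proof (rule Bochner_Integration.integrable_bound)
    show "integrable lebesgue (\<lambda>p. C\<^sup>2 * (u p)\<^sup>2)"
      using assms(3) by (simp add: sq_integrable_def)
    show "(\<lambda>p. (m p * u p)\<^sup>2) \<in> borel_measurable lebesgue"
      using assms by (auto simp: sq_integrable_def)
    have "(m p)\<^sup>2 \<le> C\<^sup>2" for p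
      using power_mono[OF assms(2)[of p], of 2] by simp
    then show "AE p in lebesgue. norm ((m p * u p)\<^sup>2) \<le> norm (C\<^sup>2 * (u p)\<^sup>2)"
      by (auto simp: power_mult_distrib intro!: AE_I2 mult_right_mono)
  qed
qed

lemma sq_integrable_scale: "sq_integrable u \<Longrightarrow> sq_integrable (\<lambda>p. c * u p)"
  by (rule sq_integrable_bounded_mult[where C = "\<bar>c\<bar>"]) auto

lemma sq_integrable_minus: "sq_integrable u \<Longrightarrow> sq_integrable (\<lambda>p. - u p)"
  using sq_integrable_scale[of u "-1"] by simp

lemma sq_integrable_diff: "sq_integrable u \<Longrightarrow> sq_integrable v \<Longrightarrow> sq_integrable (\<lambda>p. u p - v p)"
  using sq_integrable_add[OF _ sq_integrable_minus[of v]] by simp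

lemma sq_integrable_measurable [measurable_dest]: "sq_integrable u \<Longrightarrow> u \<in> borel_measurable lebesgue"
  by (simp add: sq_integrable_def)

definition l2_eq :: "('a::euclidean_space \<Rightarrow> real) \<Rightarrow> ('a \<Rightarrow> real) \<Rightarrow> bool" where
  "l2_eq u v \<longleftrightarrow> sq_integrable u \<and> sq_integrable v \<and> (AE p in lebesgue. u p = v p)"

text \<open>The quotient is partial because functions that are not square integrable represent nothing.
Identifying functions that agree almost everywhere makes the norm definite, so that the general
theory of inner product spaces applies.\<close>

quotient_type (overloaded) 'a l2 = "'a::euclidean_space \<Rightarrow> real" / partial: l2_eq
proof (rule part_equivpI)
  show "\<exists>x. l2_eq x x" by (rule exI[of _ "\<lambda>p. 0"]) (simp add: l2_eq_def sq_integrable_zero)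
  show "symp l2_eq" by (auto simp: symp_def l2_eq_def)
  show "transp l2_eq"
    unfolding transp_def l2_eq_def by (auto elim: AE_mp)
qed

lemma l2_cases: obtains u where "sq_integrable u" "x = abs_l2 u"
  using Quotient3_abs_rep[OF Quotient3_l2, of x] Quotient3_rep_reflp[OF Quotient3_l2, of x]
  unfolding l2_eq_def by metis

lemma abs_l2_eq_iff:
  "sq_integrable u \<Longrightarrow> sq_integrable v \<Longrightarrow> abs_l2 u = abs_l2 v \<longleftrightarrow> (AE p in lebesgue. u p = v p)"
  using Quotient3_rel[OF Quotient3_l2, of u v] by (auto simp: l2_eq_def)

lemma integral_square_eq_0_iff:
  assumes "sq_integrable u"
  shows "(\<integral>p. u p * u p \<partial>lebesgue) = 0 \<longleftrightarrow> (AE p in lebesgue. u p = 0)"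
  using integral_nonneg_eq_0_iff_AE[OF sq_integrable_mult[OF assms assms]] by simp

instantiation l2 :: (euclidean_space) real_inner
begin

lift_definition zero_l2 :: "'a l2" is "\<lambda>p. 0"
  by (simp add: l2_eq_def sq_integrable_zero)

lift_definition plus_l2 :: "'a l2 \<Rightarrow> 'a l2 \<Rightarrow> 'a l2" is "\<lambda>u v p. u p + v p"
  unfolding l2_eq_def by (auto intro: sq_integrable_add)

lift_definition minus_l2 :: "'a l2 \<Rightarrow> 'a l2 \<Rightarrow> 'a l2" is "\<lambda>u v p. u p - v p"
  unfolding l2_eq_def by (auto intro: sq_integrable_diff)

lift_definition uminus_l2 :: "'a l2 \<Rightarrow> 'a l2" is "\<lambda>u p. - u p"
  unfolding l2_eq_def by (auto intro: sq_integrable_minus)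

lift_definition scaleR_l2 :: "real \<Rightarrow> 'a l2 \<Rightarrow> 'a l2" is "\<lambda>c u p. c * u p"
  unfolding l2_eq_def by (auto intro: sq_integrable_scale)

lift_definition inner_l2 :: "'a l2 \<Rightarrow> 'a l2 \<Rightarrow> real" is "\<lambda>u v. \<integral>p. u p * v p \<partial>lebesgue"
  unfolding l2_eq_def by (intro integral_cong_AE) (auto intro: borel_measurable_times)

definition norm_l2 :: "'a l2 \<Rightarrow> real" where "norm_l2 x = sqrt (inner x x)"
definition sgn_l2 :: "'a l2 \<Rightarrow> 'a l2" where "sgn_l2 x = inverse (norm x) *\<^sub>R x"
definition dist_l2 :: "'a l2 \<Rightarrow> 'a l2 \<Rightarrow> real" where "dist_l2 x y = norm (x - y)"
definition uniformity_l2 :: "('a l2 \<times> 'a l2) filter" where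
  "uniformity_l2 = (INF e\<in>{0<..}. principal {(x, y). dist x y < e})"
definition open_l2 :: "'a l2 set \<Rightarrow> bool" where
  "open_l2 U = (\<forall>x\<in>U. \<forall>\<^sub>F (x', y) in uniformity. x' = x \<longrightarrow> y \<in> U)"

instance
proof
  fix x y z :: "'a l2" and a b :: real
  show "x + y + z = x + (y + z)" "x + y = y + x" "0 + x = x" "- x + x = 0" "x - y = x + - y"
    "a *\<^sub>R (x + y) = a *\<^sub>R x + a *\<^sub>R y" "(a + b) *\<^sub>R x = a *\<^sub>R x + b *\<^sub>R x"
    "a *\<^sub>R b *\<^sub>R x = (a * b) *\<^sub>R x" "1 *\<^sub>R x = x"
    by (transfer; auto simp: l2_eq_def algebra_simps sq_integrable_zero
        intro: sq_integrable_add sq_integrable_scale sq_integrable_minus sq_integrable_diff)+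
  show "dist x y = norm (x - y)" by (rule dist_l2_def)
  show "sgn x = inverse (norm x) *\<^sub>R x" by (rule sgn_l2_def)
  show "uniformity = (INF e\<in>{0<..}. principal {(x::'a l2, y). dist x y < e})" by (rule uniformity_l2_def)
  show "open U = (\<forall>x\<in>U. \<forall>\<^sub>F (x', y) in uniformity. x' = x \<longrightarrow> y \<in> U)" for U :: "'a l2 set"
    by (rule open_l2_def)
  show "norm x = sqrt (inner x x)" by (rule norm_l2_def)
  show "inner x y = inner y x" by transfer (simp add: mult.commute)
  show "inner (x + y) z = inner x z + inner y z"
    by transfer (simp add: l2_eq_def distrib_right sq_integrable_mult)
  show "inner (a *\<^sub>R x) y = a * inner x y"
    by transfer (simp add: mult.assoc)
  show "0 \<le> inner x x" by transfer simp
  show "inner x x = 0 \<longleftrightarrow> x = 0"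
    by transfer (auto simp: l2_eq_def integral_square_eq_0_iff sq_integrable_zero)
qed

end

lemma abs_l2_zero: "abs_l2 (\<lambda>p. 0) = 0"
  by (simp add: zero_l2_def)

lemma abs_l2_add: "sq_integrable u \<Longrightarrow> sq_integrable v \<Longrightarrow> abs_l2 u + abs_l2 v = abs_l2 (\<lambda>p. u p + v p)"
  by (rule plus_l2.abs_eq) (auto simp: l2_eq_def)

lemma abs_l2_diff: "sq_integrable u \<Longrightarrow> sq_integrable v \<Longrightarrow> abs_l2 u - abs_l2 v = abs_l2 (\<lambda>p. u p - v p)"
  by (rule minus_l2.abs_eq) (auto simp: l2_eq_def)

lemma abs_l2_scale: "sq_integrable u \<Longrightarrow> c *\<^sub>R abs_l2 u = abs_l2 (\<lambda>p. c * u p)"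
  by (rule scaleR_l2.abs_eq) (auto simp: l2_eq_def)

lemma inner_abs_l2: "sq_integrable u \<Longrightarrow> sq_integrable v \<Longrightarrow> inner (abs_l2 u) (abs_l2 v) = (\<integral>p. u p * v p \<partial>lebesgue)"
  by (rule inner_l2.abs_eq) (auto simp: l2_eq_def)

lemma norm_abs_l2: "sq_integrable u \<Longrightarrow> (norm (abs_l2 u))\<^sup>2 = (\<integral>p. (u p)\<^sup>2 \<partial>lebesgue)"
  unfolding power2_norm_eq_inner by (simp add: inner_abs_l2 power2_eq_square)

lemma nn_norm_abs_l2: "sq_integrable u \<Longrightarrow> (\<integral>\<^sup>+p. ennreal ((u p)\<^sup>2) \<partial>lebesgue) = ennreal ((norm (abs_l2 u))\<^sup>2)"
  by (simp add: norm_abs_l2 nn_integral_eq_integral sq_integrable_def)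

text \<open>The squared increments decay fast enough to be summed with the weights \<open>4 ^ n\<close>. The weighted sum has
a finite integral, hence is finite almost everywhere, and there the increments are bounded by a
multiple of \<open>(1/2) ^ n\<close>.\<close>

lemma fast_Cauchy_converges_AE:
  fixes g :: "nat \<Rightarrow> 'a::euclidean_space \<Rightarrow> real"
  assumes sq: "\<And>n. sq_integrable (g n)"
    and fast: "\<And>n. (norm (abs_l2 (g (Suc n)) - abs_l2 (g n)))\<^sup>2 \<le> (1/8) ^ n"
  shows "AE p in lebesgue. convergent (\<lambda>n. g n p)"
proof -
  let ?\<Delta> = "\<lambda>n p. g (Suc n) p - g n p"
  have [measurable]: "g n \<in> borel_measurable lebesgue" for n using sq by (simp add: sq_integrable_def)
  have int: "(\<integral>\<^sup>+p. ennreal (4 ^ n * (?\<Delta> n p)\<^sup>2) \<partial>lebesgue) \<le> ennreal ((1/2) ^ n)" for n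
  proof -
    have "(\<integral>\<^sup>+p. ennreal (4 ^ n * (?\<Delta> n p)\<^sup>2) \<partial>lebesgue) = ennreal (4 ^ n) * (\<integral>\<^sup>+p. ennreal ((?\<Delta> n p)\<^sup>2) \<partial>lebesgue)"
      by (simp add: ennreal_mult nn_integral_cmult)
    also have "\<dots> = ennreal (4 ^ n * (norm (abs_l2 (g (Suc n)) - abs_l2 (g n)))\<^sup>2)"
      by (simp add: abs_l2_diff sq nn_norm_abs_l2 sq_integrable_diff ennreal_mult)
    also have "\<dots> \<le> ennreal (4 ^ n * (1/8) ^ n)"
      by (intro ennreal_leI mult_left_mono fast) auto
    also have "4 ^ n * (1/8) ^ n = ((1/2) ^ n :: real)"
      by (simp flip: power_mult_distrib)
    finally show ?thesis .
  qed
  have "(\<integral>\<^sup>+p. (\<Sum>n. ennreal (4 ^ n * (?\<Delta> n p)\<^sup>2)) \<partial>lebesgue) = (\<Sum>n. \<integral>\<^sup>+p. ennreal (4 ^ n * (?\<Delta> n p)\<^sup>2) \<partial>lebesgue)"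
    by (rule nn_integral_suminf) measurable
  also have "\<dots> \<le> (\<Sum>n. ennreal ((1/2) ^ n))"
    by (intro suminf_le int summableI)
  also have "\<dots> = ennreal (\<Sum>n. (1/2) ^ n)"
    by (intro suminf_ennreal2) (auto simp: summable_geometric)
  finally have "(\<integral>\<^sup>+p. (\<Sum>n. ennreal (4 ^ n * (?\<Delta> n p)\<^sup>2)) \<partial>lebesgue) \<noteq> \<infinity>"
    using neq_top_trans[OF ennreal_neq_top] by (metis infinity_ennreal_def)
  then have "AE p in lebesgue. (\<Sum>n. ennreal (4 ^ n * (?\<Delta> n p)\<^sup>2)) \<noteq> \<infinity>"
    by (intro nn_integral_noteq_infinite) measurable
  then show ?thesis
  proof (rule AE_mp, intro AE_I2 impI)
    fix p assume fin: "(\<Sum>n. ennreal (4 ^ n * (?\<Delta> n p)\<^sup>2)) \<noteq> \<infinity>"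
    have "summable (\<lambda>n. 4 ^ n * (?\<Delta> n p)\<^sup>2)"
      by (rule summable_suminf_not_top) (use fin in auto)
    then have "(\<lambda>n. 4 ^ n * (?\<Delta> n p)\<^sup>2) \<longlonglongrightarrow> 0" by (rule summable_LIMSEQ_zero)
    then have "Bseq (\<lambda>n. 4 ^ n * (?\<Delta> n p)\<^sup>2)" by (intro convergent_imp_Bseq) (auto simp: convergent_def)
    then obtain K where K: "K > 0" "\<And>n. norm (4 ^ n * (?\<Delta> n p)\<^sup>2) \<le> K" by (auto elim: BseqE)
    have "norm (?\<Delta> n p) \<le> sqrt K * (1/2) ^ n" for n
    proof -
      have "(2 ^ n * ?\<Delta> n p)\<^sup>2 = 4 ^ n * (?\<Delta> n p)\<^sup>2"
        by (simp add: power_mult_distrib power2_eq_square flip: power_mult_distrib[of 2 2 n])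
      then have "(2 ^ n * ?\<Delta> n p)\<^sup>2 \<le> K" using K(2)[of n] by (simp add: abs_mult)
      then have "\<bar>2 ^ n * ?\<Delta> n p\<bar> \<le> sqrt K" by (metis real_sqrt_abs real_sqrt_le_iff)
      then have "2 ^ n * \<bar>?\<Delta> n p\<bar> \<le> sqrt K" unfolding abs_mult by simp
      then show ?thesis by (simp add: field_simps power_one_over)
    qed
    moreover have "summable (\<lambda>n. sqrt K * (1/2) ^ n)" by (intro summable_mult summable_geometric) simp
    ultimately have "summable (\<lambda>n. ?\<Delta> n p)"
      by (rule summable_comparison_test'[rotated])
    then have "convergent (\<lambda>n. \<Sum>i<n. ?\<Delta> i p)" by (simp add: summable_iff_convergent)
    then have "convergent (\<lambda>n. g n p - g 0 p)" by (simp add: sum_lessThan_telescope[of "\<lambda>n. g n p"])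
    then have "convergent (\<lambda>n. (g n p - g 0 p) + g 0 p)" by (intro convergent_add convergent_const)
    then show "convergent (\<lambda>n. g n p)" by simp
  qed
qed

text \<open>The Riesz--Fischer theorem: a rapidly converging subsequence converges almost everywhere, and Fatou's
lemma shows that its limit is also the limit in the norm.\<close>

instance l2 :: (euclidean_space) complete_space
proof
  fix X :: "nat \<Rightarrow> 'a l2" assume X: "Cauchy X"
  have "\<exists>M. \<forall>m\<ge>M. \<forall>n\<ge>M. norm (X m - X n) < (1/4) ^ k" for k
    using X unfolding Cauchy_iff by (rule allE[of _ "(1/4)^k"]) auto
  then obtain N where N: "\<And>k m n. m \<ge> N k \<Longrightarrow> n \<ge> N k \<Longrightarrow> norm (X m - X n) < (1/4) ^ k"
    by metis
  \<comment> \<open>a strictly increasing sequence that dominates \<open>N\<close>\<close>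
  define r where "r = rec_nat (N 0) (\<lambda>k y. Suc (y + N (Suc k)))"
  have rS: "r (Suc k) = Suc (r k + N (Suc k))" for k by (simp add: r_def)
  have mono: "strict_mono r" by (rule strict_monoI_Suc) (simp add: rS)
  have rN: "N k \<le> r k" for k by (cases k) (auto simp: r_def)
  have close: "norm (X (r m) - X (r k)) < (1/4) ^ k" if "m \<ge> k" for k m
    using N[of k "r m" "r k"] rN[of k] strict_mono_less_eq[OF mono, of k m] that by simp
  have "\<exists>u. sq_integrable u \<and> X n = abs_l2 u" for n using l2_cases by metis
  then obtain f where f: "\<And>n. sq_integrable (f n)" "\<And>n. X n = abs_l2 (f n)" by metis
  define g where "g = (\<lambda>n. f (r n))"
  have g: "sq_integrable (g n)" "X (r n) = abs_l2 (g n)" for n using f by (auto simp: g_def)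
  have [measurable]: "g n \<in> borel_measurable lebesgue" for n using g by (simp add: sq_integrable_def)
  have "AE p in lebesgue. convergent (\<lambda>n. g n p)"
  proof (rule fast_Cauchy_converges_AE[OF g(1)])
    fix n
    have "(norm (X (r (Suc n)) - X (r n)))\<^sup>2 \<le> ((1/4) ^ n)\<^sup>2"
      using close[of n "Suc n"] by (intro power_mono) auto
    also have "\<dots> = (1/16) ^ n" by (simp add: power2_eq_square flip: power_mult_distrib)
    also have "\<dots> \<le> (1/8) ^ n" by (intro power_mono) auto
    finally show "(norm (abs_l2 (g (Suc n)) - abs_l2 (g n)))\<^sup>2 \<le> (1/8) ^ n" by (simp add: g)
  qed
  then have conv: "AE p in lebesgue. (\<lambda>n. g n p) \<longlonglongrightarrow> lim (\<lambda>n. g n p)"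
    by eventually_elim (simp add: convergent_LIMSEQ_iff)
  define G where "G = (\<lambda>p. lim (\<lambda>n. g n p))"
  have [measurable]: "G \<in> borel_measurable lebesgue"
    unfolding G_def by (rule borel_measurable_lim_metric) measurable
  have fatou: "(\<integral>\<^sup>+p. ennreal ((G p - g k p)\<^sup>2) \<partial>lebesgue) \<le> ennreal (((1/4) ^ k)\<^sup>2)" for k
  proof -
    have "(\<integral>\<^sup>+p. ennreal ((G p - g k p)\<^sup>2) \<partial>lebesgue) = (\<integral>\<^sup>+p. liminf (\<lambda>n. ennreal ((g n p - g k p)\<^sup>2)) \<partial>lebesgue)"
    proof (rule nn_integral_cong_AE, rule AE_mp[OF conv], intro AE_I2 impI)
      fix p assume "(\<lambda>n. g n p) \<longlonglongrightarrow> lim (\<lambda>n. g n p)"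
      then have "(\<lambda>n. ennreal ((g n p - g k p)\<^sup>2)) \<longlonglongrightarrow> ennreal ((G p - g k p)\<^sup>2)"
        unfolding G_def by (intro tendsto_intros) auto
      then show "ennreal ((G p - g k p)\<^sup>2) = liminf (\<lambda>n. ennreal ((g n p - g k p)\<^sup>2))"
        by (intro lim_imp_Liminf[symmetric]) auto
    qed
    also have "\<dots> \<le> liminf (\<lambda>n. \<integral>\<^sup>+p. ennreal ((g n p - g k p)\<^sup>2) \<partial>lebesgue)"
      by (rule nn_integral_liminf) measurable
    also have "\<dots> \<le> liminf (\<lambda>n. ennreal (((1/4) ^ k)\<^sup>2))"
    proof (rule Liminf_mono, rule eventually_sequentiallyI[of k])
      fix n assume "k \<le> n"
      have "(\<integral>\<^sup>+p. ennreal ((g n p - g k p)\<^sup>2) \<partial>lebesgue) = ennreal ((norm (X (r n) - X (r k)))\<^sup>2)"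
        by (simp add: g abs_l2_diff nn_norm_abs_l2 sq_integrable_diff)
      also have "\<dots> \<le> ennreal (((1/4) ^ k)\<^sup>2)"
        using close[OF \<open>k \<le> n\<close>] by (intro ennreal_leI power_mono) auto
      finally show "(\<integral>\<^sup>+p. ennreal ((g n p - g k p)\<^sup>2) \<partial>lebesgue) \<le> ennreal (((1/4) ^ k)\<^sup>2)" .
    qed
    also have "\<dots> = ennreal (((1/4) ^ k)\<^sup>2)" by (simp add: Liminf_const)
    finally show ?thesis .
  qed
  have sqd: "sq_integrable (\<lambda>p. G p - g k p)" for k
    unfolding sq_integrable_def integrable_iff_bounded
    using le_less_trans[OF fatou[of k] ennreal_less_top] by simp
  have sqG: "sq_integrable G" using sq_integrable_add[OF sqd[of 0] g(1)[of 0]] by simp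
  have "norm (abs_l2 G - X (r k)) \<le> (1/4) ^ k" for k
  proof -
    have "ennreal ((norm (abs_l2 G - X (r k)))\<^sup>2) \<le> ennreal (((1/4) ^ k)\<^sup>2)"
      using fatou[of k] by (simp add: g abs_l2_diff sqG nn_norm_abs_l2 sqd)
    then show ?thesis by (simp add: ennreal_le_iff power2_le_iff_abs_le)
  qed
  then have le: "dist (X (r k)) (abs_l2 G) \<le> (1/4) ^ k" for k
    by (simp add: dist_norm norm_minus_commute)
  have "(\<lambda>k. dist (X (r k)) (abs_l2 G)) \<longlonglongrightarrow> 0"
    by (rule real_tendsto_sandwich[of "\<lambda>k. 0" _ _ "\<lambda>k. (1/4) ^ k"])
      (use le in \<open>auto intro!: LIMSEQ_power_zero\<close>)
  then have lim: "(X \<circ> r) \<longlonglongrightarrow> abs_l2 G"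
    unfolding o_def by (rule tendsto_dist_iff[THEN iffD2])
  have "X \<longlonglongrightarrow> abs_l2 G"
    by (rule Cauchy_converges_subseq[OF X mono lim])
  then show "convergent X" by (auto simp: convergent_def)
qed

definition multiplier :: "('a::euclidean_space \<Rightarrow> real) \<Rightarrow> bool" where
  "multiplier m \<longleftrightarrow> m \<in> borel_measurable lebesgue \<and> (\<exists>C. \<forall>p. \<bar>m p\<bar> \<le> C)"

lemma sq_integrable_multiplier: "multiplier m \<Longrightarrow> sq_integrable u \<Longrightarrow> sq_integrable (\<lambda>p. m p * u p)"
  unfolding multiplier_def using sq_integrable_bounded_mult by blast

text \<open>Multiplication by a function that is not a bounded measurable one is set to zero, which makes
\<open>mult_op m\<close> a bounded symmetric operator for every \<open>m\<close>.\<close>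

lift_definition mult_op :: "('a::euclidean_space \<Rightarrow> real) \<Rightarrow> 'a l2 \<Rightarrow> 'a l2" is
  "\<lambda>m u p. if multiplier m then m p * u p else 0"
proof -
  fix m u v :: "'a \<Rightarrow> real" assume "l2_eq u v"
  then show "l2_eq (\<lambda>p. if multiplier m then m p * u p else 0) (\<lambda>p. if multiplier m then m p * v p else 0)"
    by (cases "multiplier m") (auto simp: l2_eq_def sq_integrable_multiplier sq_integrable_zero)
qed

lemma mult_op_abs: "multiplier m \<Longrightarrow> sq_integrable u \<Longrightarrow> mult_op m (abs_l2 u) = abs_l2 (\<lambda>p. m p * u p)"
  by (subst mult_op.abs_eq) (auto simp: l2_eq_def)

lemma inner_mult_op: "inner (mult_op m x) y = inner x (mult_op m y)"
  by transfer (auto simp: ac_simps intro!: Bochner_Integration.integral_cong)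

lemma bounded_linear_mult_op: "bounded_linear (mult_op m)"
proof (cases "multiplier m")
  case False
  then have "mult_op m = (\<lambda>x. 0)" by (intro ext, transfer) (simp add: l2_eq_def sq_integrable_zero)
  then show ?thesis by (simp only: bounded_linear_zero)
next
  case True
  then obtain C where C: "\<And>p. \<bar>m p\<bar> \<le> C" by (auto simp: multiplier_def)
  then have C0: "C \<ge> 0" using abs_ge_zero order_trans by blast
  show ?thesis
  proof (rule bounded_linear_intro[where K = C])
    fix x y :: "'a l2" and c :: real
    obtain u where u: "sq_integrable u" "x = abs_l2 u" by (rule l2_cases)
    obtain v where v: "sq_integrable v" "y = abs_l2 v" by (rule l2_cases)
    note sq = sq_integrable_multiplier[OF True]
    show "mult_op m (x + y) = mult_op m x + mult_op m y"
      by (simp add: u v abs_l2_add mult_op_abs True sq sq_integrable_add distrib_left)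
    show "mult_op m (c *\<^sub>R x) = c *\<^sub>R mult_op m x"
      by (simp add: u abs_l2_scale mult_op_abs True sq sq_integrable_scale mult.left_commute)
    have mu: "sq_integrable (\<lambda>p. m p * u p)" by (rule sq_integrable_multiplier[OF True u(1)])
    have "(m p)\<^sup>2 \<le> C\<^sup>2" for p using power_mono[OF C[of p], of 2] by simp
    then have "(\<integral>p. (m p * u p)\<^sup>2 \<partial>lebesgue) \<le> (\<integral>p. C\<^sup>2 * (u p)\<^sup>2 \<partial>lebesgue)"
      using mu u(1) by (intro integral_mono) (auto simp: sq_integrable_def power_mult_distrib intro!: mult_right_mono)
    also have "\<dots> = C\<^sup>2 * (norm x)\<^sup>2" using u by (simp add: norm_abs_l2)
    finally have "(norm (mult_op m x))\<^sup>2 \<le> (norm x * C)\<^sup>2"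
      by (simp add: u True mult_op_abs mu norm_abs_l2 power_mult_distrib mult.commute)
    then show "norm (mult_op m x) \<le> norm x * C" using C0 by (simp add: power2_le_iff_abs_le)
  qed
qed

section \<open>Smooth functions and test functions\<close>

abbreviation Ck :: "nat \<Rightarrow> ('a::euclidean_space \<Rightarrow> real) \<Rightarrow> bool" where
  "Ck k f \<equiv> Ck_on k f UNIV"

abbreviation smooth :: "('a::euclidean_space \<Rightarrow> real) \<Rightarrow> bool" where
  "smooth f \<equiv> smooth_on f UNIV"

lemma Ck_SucI:
  assumes "\<And>x. (f has_derivative D x) (at x)" "\<And>v. Ck k (\<lambda>x. D x v)"
  shows "Ck (Suc k) f"
proof -
  have "frechet_derivative f (at x) = D x" for x
    using frechet_derivative_at[OF assms(1)] by simp
  then show ?thesis using assms by (auto simp: differentiable_def)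
qed

lemma Ck_Suc_imp_Ck: "Ck (Suc k) f \<Longrightarrow> Ck k f"
proof (induction k arbitrary: f)
  case 0
  then show ?case
    by (auto intro!: differentiable_imp_continuous_on differentiable_at_imp_differentiable_on)
next
  case (Suc k)
  then show ?case by (metis Ck_on.simps(2))
qed

lemma Ck_const: "Ck k (\<lambda>x. c)"
proof (induction k arbitrary: c)
  case (Suc k)
  show ?case by (rule Ck_SucI[where D = "\<lambda>x v. 0"]) (auto simp: Suc)
qed simp

lemma Ck_bounded_linear:
  assumes "bounded_linear L"
  shows "Ck k L"
proof (cases k)
  case 0
  then show ?thesis using assms by (simp add: linear_continuous_on)
next
  case (Suc m)
  show ?thesis unfolding Suc
    by (rule Ck_SucI[where D = "\<lambda>x. L"]) (auto simp: bounded_linear_imp_has_derivative assms Ck_const)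
qed

lemma Ck_has_derivative: "Ck (Suc k) f \<Longrightarrow> (f has_derivative frechet_derivative f (at x)) (at x)"
  by (simp add: frechet_derivative_works)

lemma Ck_directional: "Ck (Suc k) f \<Longrightarrow> Ck k (\<lambda>x. frechet_derivative f (at x) v)"
  by simp

lemma Ck_add: "Ck k f \<Longrightarrow> Ck k g \<Longrightarrow> Ck k (\<lambda>x. f x + g x)"
proof (induction k arbitrary: f g)
  case 0
  then show ?case by (simp add: continuous_on_add)
next
  case (Suc k)
  have der: "((\<lambda>x. f x + g x) has_derivative
      (\<lambda>v. frechet_derivative f (at x) v + frechet_derivative g (at x) v)) (at x)" for x
    by (intro has_derivative_add Ck_has_derivative[OF Suc.prems(1)] Ck_has_derivative[OF Suc.prems(2)])
  show ?case
    by (rule Ck_SucI[OF der]) (intro Suc.IH Ck_directional[OF Suc.prems(1)] Ck_directional[OF Suc.prems(2)])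
qed

lemma Ck_mult: "Ck k f \<Longrightarrow> Ck k g \<Longrightarrow> Ck k (\<lambda>x. f x * g x)"
proof (induction k arbitrary: f g)
  case 0
  then show ?case by (simp add: continuous_on_mult)
next
  case (Suc k)
  have der: "((\<lambda>x. f x * g x) has_derivative
      (\<lambda>v. f x * frechet_derivative g (at x) v + frechet_derivative f (at x) v * g x)) (at x)" for x
    by (intro has_derivative_mult Ck_has_derivative[OF Suc.prems(1)] Ck_has_derivative[OF Suc.prems(2)])
  show ?case
    by (rule Ck_SucI[OF der])
      (intro Ck_add Suc.IH Ck_directional[OF Suc.prems(1)] Ck_directional[OF Suc.prems(2)]
        Suc.prems[THEN Ck_Suc_imp_Ck])
qed

lemma smooth_const: "smooth (\<lambda>x. c)"
  by (simp add: smooth_on_def Ck_const)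

lemma smooth_bounded_linear: "bounded_linear L \<Longrightarrow> smooth L"
  by (simp add: smooth_on_def Ck_bounded_linear)

lemma smooth_add: "smooth f \<Longrightarrow> smooth g \<Longrightarrow> smooth (\<lambda>x. f x + g x)"
  by (simp add: smooth_on_def Ck_add)

lemma smooth_mult: "smooth f \<Longrightarrow> smooth g \<Longrightarrow> smooth (\<lambda>x. f x * g x)"
  by (simp add: smooth_on_def Ck_mult)

lemma smooth_sum: "finite I \<Longrightarrow> (\<And>i. i \<in> I \<Longrightarrow> smooth (f i)) \<Longrightarrow> smooth (\<lambda>x. \<Sum>i\<in>I. f i x)"
  by (induction I rule: finite_induct) (auto simp: smooth_const smooth_add)

lemma smooth_prod: "finite I \<Longrightarrow> (\<And>i. i \<in> I \<Longrightarrow> smooth (f i)) \<Longrightarrow> smooth (\<lambda>x. \<Prod>i\<in>I. f i x)"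
  by (induction I rule: finite_induct) (auto simp: smooth_const smooth_mult)

lemma smooth_has_derivative: "smooth f \<Longrightarrow> (f has_derivative frechet_derivative f (at x)) (at x)"
  unfolding smooth_on_def by (rule Ck_has_derivative) blast

lemma smooth_continuous: "smooth f \<Longrightarrow> continuous_on UNIV f"
  unfolding smooth_on_def by (metis Ck_on.simps(1))

lemma smooth_directional: "smooth f \<Longrightarrow> smooth (\<lambda>x. frechet_derivative f (at x) v)"
  unfolding smooth_on_def by (metis Ck_on.simps(2))

text \<open>The fields \<open>X\<^sub>i\<close> and \<open>Y\<^sub>i\<close> are of this type. The derivative along such a field is a combination of
directional derivatives with smooth coefficients.\<close>

definition affine_field :: "('a::euclidean_space \<Rightarrow> 'a) \<Rightarrow> bool" where
  "affine_field V \<longleftrightarrow> (\<exists>c L. bounded_linear L \<and> V = (\<lambda>p. c + L p))"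

lemma along_has_derivative:
  assumes "(f has_derivative D) (at p)"
  shows "along V f p = D (V p)"
  using frechet_derivative_at[OF assms] by (simp add: along_def)

lemma along_add:
  assumes "smooth f" "smooth g"
  shows "along V (\<lambda>x. f x + g x) = (\<lambda>p. along V f p + along V g p)"
proof
  fix p
  have "((\<lambda>x. f x + g x) has_derivative
      (\<lambda>v. frechet_derivative f (at p) v + frechet_derivative g (at p) v)) (at p)"
    by (intro has_derivative_add smooth_has_derivative assms)
  then show "along V (\<lambda>x. f x + g x) p = along V f p + along V g p"
    by (simp add: along_has_derivative) (simp add: along_def)
qed

lemma along_mult:
  assumes "smooth f" "smooth g"
  shows "along V (\<lambda>x. f x * g x) = (\<lambda>p. f p * along V g p + along V f p * g p)"
proof
  fix p
  have "((\<lambda>x. f x * g x) has_derivative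
      (\<lambda>v. f p * frechet_derivative g (at p) v + frechet_derivative f (at p) v * g p)) (at p)"
    by (intro has_derivative_mult smooth_has_derivative assms)
  then show "along V (\<lambda>x. f x * g x) p = f p * along V g p + along V f p * g p"
    by (simp add: along_has_derivative) (simp add: along_def)
qed

lemma along_const: "along V (\<lambda>x. c) = (\<lambda>p. 0)"
  by (rule ext) (rule along_has_derivative[OF has_derivative_const])

lemma along_scale:
  assumes "smooth f"
  shows "along V (\<lambda>x. c * f x) = (\<lambda>p. c * along V f p)"
  using along_mult[OF smooth_const assms, of V c] by (simp add: along_const)

lemma along_bounded_linear: "bounded_linear L \<Longrightarrow> along V L = (\<lambda>p. L (V p))"
  by (rule ext) (rule along_has_derivative[OF bounded_linear_imp_has_derivative])

lemma smooth_along: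
  assumes "affine_field V" "smooth f"
  shows "smooth (along V f)"
proof -
  obtain c L where L: "bounded_linear L" "V = (\<lambda>p. c + L p)"
    using assms(1) by (auto simp: affine_field_def)
  have "along V f = (\<lambda>p. \<Sum>b\<in>Basis. (c \<bullet> b + L p \<bullet> b) * frechet_derivative f (at p) b)"
  proof
    fix p
    have lin: "linear (frechet_derivative f (at p))"
      using smooth_has_derivative[OF assms(2)] has_derivative_linear by blast
    have "along V f p = frechet_derivative f (at p) (\<Sum>b\<in>Basis. (V p \<bullet> b) *\<^sub>R b)"
      by (simp add: along_def euclidean_representation)
    also have "\<dots> = (\<Sum>b\<in>Basis. (V p \<bullet> b) * frechet_derivative f (at p) b)"
      unfolding linear_sum[OF lin] linear_cmul[OF lin] by simp
    finally show "along V f p = (\<Sum>b\<in>Basis. (c \<bullet> b + L p \<bullet> b) * frechet_derivative f (at p) b)"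
      by (simp add: L inner_add_left)
  qed
  moreover have bl: "bounded_linear (\<lambda>p. L p \<bullet> b)" for b
    using bounded_linear_compose[OF bounded_linear_inner_left L(1)] .
  ultimately show ?thesis
    by (simp only:) (intro smooth_sum finite_Basis smooth_mult smooth_add smooth_const
        smooth_directional[OF assms(2)] smooth_bounded_linear[OF bl])
qed

lemma test_functionsI:
  assumes "smooth \<phi>" "compact K" "K \<subseteq> \<Omega>" "\<And>p. p \<notin> K \<Longrightarrow> \<phi> p = 0"
  shows "\<phi> \<in> test_functions \<Omega>"
proof -
  have "closure {p. \<phi> p \<noteq> 0} \<subseteq> K"
    using assms(2,4) by (intro closure_minimal) (auto intro: compact_imp_closed)
  moreover from this have "compact (closure {p. \<phi> p \<noteq> 0})"
    using compact_Int_closed[OF assms(2) closed_closure, of "{p. \<phi> p \<noteq> 0}"] by (simp add: Int_absorb1)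
  ultimately show ?thesis
    using assms(1,3) unfolding test_functions_def by auto
qed

lemma test_functionsE:
  assumes "\<phi> \<in> test_functions \<Omega>"
  obtains K where "smooth \<phi>" "compact K" "K \<subseteq> \<Omega>" "\<And>p. p \<notin> K \<Longrightarrow> \<phi> p = 0"
  using assms closure_subset[of "{p. \<phi> p \<noteq> 0}"] unfolding test_functions_def by blast

lemma test_function_smooth: "\<phi> \<in> test_functions \<Omega> \<Longrightarrow> smooth \<phi>"
  by (simp add: test_functions_def)

lemma test_function_outside: "\<phi> \<in> test_functions \<Omega> \<Longrightarrow> p \<notin> \<Omega> \<Longrightarrow> \<phi> p = 0"
  by (metis test_functionsE subsetD)

lemma test_function_zero: "(\<lambda>p. 0) \<in> test_functions \<Omega>"
  by (rule test_functionsI[of _ "{}"]) (auto simp: smooth_const)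

lemma test_function_add:
  assumes "\<phi> \<in> test_functions \<Omega>" "\<psi> \<in> test_functions \<Omega>"
  shows "(\<lambda>p. \<phi> p + \<psi> p) \<in> test_functions \<Omega>"
proof -
  obtain K L where "compact K" "K \<subseteq> \<Omega>" "\<And>p. p \<notin> K \<Longrightarrow> \<phi> p = 0"
    "compact L" "L \<subseteq> \<Omega>" "\<And>p. p \<notin> L \<Longrightarrow> \<psi> p = 0"
    using assms by (metis test_functionsE)
  then show ?thesis
    using assms by (intro test_functionsI[of _ "K \<union> L"]) (auto intro: smooth_add test_function_smooth)
qed

lemma test_function_smooth_mult:
  assumes "smooth f" "\<phi> \<in> test_functions \<Omega>"
  shows "(\<lambda>p. f p * \<phi> p) \<in> test_functions \<Omega>"
proof -
  obtain K where "compact K" "K \<subseteq> \<Omega>" "\<And>p. p \<notin> K \<Longrightarrow> \<phi> p = 0"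
    using assms by (metis test_functionsE)
  then show ?thesis
    using assms by (intro test_functionsI[of _ K]) (auto intro: smooth_mult test_function_smooth)
qed

lemma test_function_scale: "\<phi> \<in> test_functions \<Omega> \<Longrightarrow> (\<lambda>p. c * \<phi> p) \<in> test_functions \<Omega>"
  by (rule test_function_smooth_mult[OF smooth_const])

lemma test_function_along:
  assumes "affine_field V" "\<phi> \<in> test_functions \<Omega>"
  shows "along V \<phi> \<in> test_functions \<Omega>"
proof -
  obtain K where K: "smooth \<phi>" "compact K" "K \<subseteq> \<Omega>" "\<And>p. p \<notin> K \<Longrightarrow> \<phi> p = 0"
    using assms by (metis test_functionsE)
  show ?thesis
  proof (rule test_functionsI[OF smooth_along[OF assms(1) K(1)] K(2,3)])
    fix p assume p: "p \<notin> K"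
    have "open (- K)" using K(2) by (simp add: compact_imp_closed open_Compl)
    then have "(\<phi> has_derivative (\<lambda>v. 0)) (at p)"
      by (rule has_derivative_transform_within_open[OF has_derivative_const[of 0]]) (use K(4) p in auto)
    then show "along V \<phi> p = 0" by (rule along_has_derivative)
  qed
qed

lemma test_function_bounded:
  assumes "\<phi> \<in> test_functions \<Omega>"
  obtains C where "\<And>p. \<bar>\<phi> p\<bar> \<le> C"
proof -
  obtain K where K: "smooth \<phi>" "compact K" "\<And>p. p \<notin> K \<Longrightarrow> \<phi> p = 0"
    using assms by (metis test_functionsE)
  have "compact (\<phi> ` K)"
    using K by (intro compact_continuous_image continuous_on_subset[OF smooth_continuous]) auto
  then obtain C where C: "\<And>p. p \<in> K \<Longrightarrow> \<bar>\<phi> p\<bar> \<le> C"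
    using compact_imp_bounded bounded_iff by (metis imageI real_norm_def)
  have "\<bar>\<phi> p\<bar> \<le> max C 0" for p using C[of p] K(3)[of p] by (cases "p \<in> K") auto
  then show thesis by (rule that)
qed

text \<open>This family of functions is closed under differentiation, and it contains \<open>exp (- 1 / s)\<close>. Thus its
members are smooth although they vanish on a half-line.\<close>

definition flat :: "real poly \<Rightarrow> real \<Rightarrow> real" where
  "flat q s = (if s > 0 then poly q (1 / s) * exp (- 1 / s) else 0)"

text \<open>The additional factor \<open>u ^ n\<close> is what makes the induction on the polynomial work.\<close>

lemma tendsto_poly_times_exp_minus: "((\<lambda>u. u ^ n * poly q u * exp (- u)) \<longlongrightarrow> 0) (at_top :: real filter)"
proof (induction q arbitrary: n)
  case (pCons a q)
  have "((\<lambda>u. a * (u ^ n / exp u) + u ^ Suc n * poly q u * exp (- u)) \<longlongrightarrow> a * 0 + 0) at_top"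
    by (intro tendsto_add tendsto_mult tendsto_const tendsto_power_div_exp_0 pCons.IH)
  then show ?case by (simp add: exp_minus field_simps)
qed simp

lemma flat_tendsto_0: "(flat q \<longlongrightarrow> 0) (at 0)"
proof (rule filterlim_split_at)
  show "(flat q \<longlongrightarrow> 0) (at_left 0)"
    by (rule tendsto_eventually) (auto simp: eventually_at_filter flat_def)
  have "((\<lambda>s. poly q (inverse s) * exp (- inverse s)) \<longlongrightarrow> 0) (at_right (0::real))"
    using filterlim_compose[OF tendsto_poly_times_exp_minus[of 0 q] filterlim_inverse_at_top_right] by simp
  then show "(flat q \<longlongrightarrow> 0) (at_right 0)"
    by (rule Lim_transform_eventually) (auto simp: eventually_at_filter flat_def divide_inverse)
qed

lemma flat_has_derivative: "(flat q has_real_derivative flat ([:0, 0, 1:] * (q - pderiv q)) s) (at s)"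
proof -
  consider "s < 0" | "s = 0" | "s > 0" by linarith
  then show ?thesis
  proof cases
    case 1
    have "((\<lambda>s. 0) has_real_derivative 0) (at s)" by simp
    then have "(flat q has_real_derivative 0) (at s)"
      by (rule has_field_derivative_transform_within_open[of _ _ _ "{..<0}"]) (use 1 in \<open>auto simp: flat_def\<close>)
    then show ?thesis using 1 by (simp add: flat_def)
  next
    case 2
    have "((\<lambda>h. (flat q (0 + h) - flat q 0) / h) \<longlongrightarrow> 0) (at 0)"
    proof (rule Lim_transform_eventually[OF flat_tendsto_0[of "pCons 0 q"]])
      show "\<forall>\<^sub>F h in at 0. flat (pCons 0 q) h = (flat q (0 + h) - flat q 0) / h"
        by (auto simp: eventually_at_filter flat_def)
    qed
    then show ?thesis using 2 by (simp add: DERIV_def flat_def)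
  next
    case 3
    have "((\<lambda>s. poly q (1 / s) * exp (- 1 / s)) has_real_derivative
        poly ([:0, 0, 1:] * (q - pderiv q)) (1 / s) * exp (- 1 / s)) (at s)"
      using 3 by (auto intro!: derivative_eq_intros DERIV_chain2[OF poly_DERIV] simp: field_simps power2_eq_square)
    then have "(flat q has_real_derivative poly ([:0, 0, 1:] * (q - pderiv q)) (1 / s) * exp (- 1 / s)) (at s)"
      by (rule has_field_derivative_transform_within_open[of _ _ _ "{0<..}"]) (use 3 in \<open>auto simp: flat_def\<close>)
    then show ?thesis using 3 by (simp add: flat_def)
  qed
qed

lemma smooth_flat_ridge: "smooth (\<lambda>x. flat q (c * (x \<bullet> b) + d))"
proof -
  have der: "((\<lambda>x. flat q (c * (x \<bullet> b) + d)) has_derivative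
     (\<lambda>v. flat ([:0, 0, 1:] * (q - pderiv q)) (c * (x \<bullet> b) + d) * (c * (v \<bullet> b)))) (at x)" for q x
  proof -
    have "((\<lambda>x. c * (x \<bullet> b) + d) has_derivative (\<lambda>v. c * (v \<bullet> b))) (at x)"
      by (auto intro!: derivative_eq_intros)
    from has_derivative_compose[OF this flat_has_derivative[unfolded has_field_derivative_def]]
    show ?thesis by (simp add: mult.commute)
  qed
  have "Ck k (\<lambda>x. flat q (c * (x \<bullet> b) + d))" for k
  proof (induction k arbitrary: q)
    case 0
    have "isCont (\<lambda>x. flat q (c * (x \<bullet> b) + d)) x" for x
      by (rule has_derivative_continuous[OF der])
    then show ?case by (simp add: continuous_at_imp_continuous_on)
  next
    case (Suc k)
    show ?case by (rule Ck_SucI[OF der]) (rule Ck_mult[OF Suc Ck_const])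
  qed
  then show ?thesis by (simp add: smooth_on_def)
qed

text \<open>On the open box the factors are \<open>exp (- 1 / (real (Suc k) * d))\<close>, where \<open>d\<close> is the distance to a face;
they tend to 1 when \<open>k\<close> grows, so these functions tend to the indicator function of the box.\<close>

definition box_bump :: "'a::euclidean_space \<Rightarrow> 'a \<Rightarrow> nat \<Rightarrow> 'a \<Rightarrow> real" where
  "box_bump a b k p = (\<Prod>i\<in>Basis. flat 1 (real (Suc k) * (p \<bullet> i) + - (real (Suc k) * (a \<bullet> i))) *
      flat 1 (- real (Suc k) * (p \<bullet> i) + real (Suc k) * (b \<bullet> i)))"

lemma flat_1_bounds: "0 \<le> flat 1 s" "flat 1 s \<le> 1"
  by (auto simp: flat_def)

lemma flat_1_eq_0_iff: "flat 1 s = 0 \<longleftrightarrow> s \<le> 0"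
  by (auto simp: flat_def)

lemma box_bump_bounds: "0 \<le> box_bump a b k p" "box_bump a b k p \<le> 1"
  unfolding box_bump_def
  by (auto intro!: prod_nonneg prod_le_1 mult_nonneg_nonneg mult_le_one simp: flat_1_bounds)

lemma box_bump_outside: "p \<notin> box a b \<Longrightarrow> box_bump a b k p = 0"
proof -
  assume "p \<notin> box a b"
  then obtain i where i: "i \<in> Basis" "p \<bullet> i \<le> a \<bullet> i \<or> b \<bullet> i \<le> p \<bullet> i"
    by (auto simp: mem_box not_less)
  have "real (Suc k) * (p \<bullet> i) + - (real (Suc k) * (a \<bullet> i)) \<le> 0 \<or> - real (Suc k) * (p \<bullet> i) + real (Suc k) * (b \<bullet> i) \<le> 0"
    using i(2) mult_left_mono[of "p \<bullet> i" "a \<bullet> i" "real (Suc k)"] mult_left_mono[of "b \<bullet> i" "p \<bullet> i" "real (Suc k)"]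
    by (auto simp del: of_nat_Suc)
  then show ?thesis using i(1)
    unfolding box_bump_def by (intro prod_zero bexI[of _ i]) (auto simp only: mult_eq_0_iff flat_1_eq_0_iff finite_Basis)
qed

lemma box_bump_test_function: "cbox a b \<subseteq> \<Omega> \<Longrightarrow> box_bump a b k \<in> test_functions \<Omega>"
proof (rule test_functionsI[of _ "cbox a b"])
  show "smooth (box_bump a b k)"
    unfolding box_bump_def by (intro smooth_prod smooth_mult smooth_flat_ridge finite_Basis)
qed (auto intro!: box_bump_outside simp: box_subset_cbox[THEN subsetD])

lemma box_bump_tendsto: "(\<lambda>k. box_bump a b k p) \<longlonglongrightarrow> indicator (box a b) p"
proof (cases "p \<in> box a b")
  case False
  then show ?thesis by (simp add: box_bump_outside)
next
  case True
  have lim: "(\<lambda>k. flat 1 (real (Suc k) * d)) \<longlonglongrightarrow> 1" if "d > 0" for d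
  proof -
    have "(\<lambda>k. exp (- (1 / real (Suc k)) * (1 / d))) \<longlonglongrightarrow> exp (- 0 * (1 / d))"
      by (intro tendsto_intros LIMSEQ_Suc[OF lim_1_over_n])
    then show ?thesis using that by (simp add: flat_def)
  qed
  have "(\<lambda>k. box_bump a b k p) \<longlonglongrightarrow> (\<Prod>i\<in>(Basis::'a set). 1 * 1)"
    unfolding box_bump_def
  proof (intro tendsto_prod tendsto_mult)
    fix i :: 'a assume i: "i \<in> Basis"
    show "(\<lambda>k. flat 1 (real (Suc k) * (p \<bullet> i) + - (real (Suc k) * (a \<bullet> i)))) \<longlonglongrightarrow> 1"
      using lim[of "p \<bullet> i - a \<bullet> i"] True i by (simp add: mem_box right_diff_distrib del: of_nat_Suc)
    show "(\<lambda>k. flat 1 (- real (Suc k) * (p \<bullet> i) + real (Suc k) * (b \<bullet> i))) \<longlonglongrightarrow> 1"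
      using lim[of "b \<bullet> i - p \<bullet> i"] True i by (simp add: mem_box right_diff_distrib del: of_nat_Suc)
  qed
  then show ?thesis using True by simp
qed

section \<open>Density of the test functions\<close>

lemma smooth_borel_measurable: "smooth f \<Longrightarrow> f \<in> borel_measurable borel"
  by (intro borel_measurable_continuous_onI smooth_continuous)

lemma smooth_measurable: "smooth f \<Longrightarrow> f \<in> borel_measurable lebesgue"
  by (intro measurable_completion) (simp add: smooth_borel_measurable)

lemma sq_integrable_indicator:
  fixes a b :: "'a::euclidean_space"
  assumes "A \<in> sets lebesgue" "A \<subseteq> cbox a b"
  shows "sq_integrable (indicator A :: 'a \<Rightarrow> real)"
proof -
  have "emeasure lebesgue A \<le> emeasure lebesgue (cbox a b)"
    using assms by (intro emeasure_mono) auto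
  also have "\<dots> < \<infinity>" by (simp add: emeasure_lborel_cbox_eq)
  finally have "integrable lebesgue (indicator A :: 'a \<Rightarrow> real)"
    using assms(1) by (intro integrable_real_indicator) auto
  moreover have "(\<lambda>p. (indicator A p)\<^sup>2) = (indicator A :: 'a \<Rightarrow> real)"
    by (auto simp: indicator_def)
  ultimately show ?thesis
    using assms(1) unfolding sq_integrable_def by simp
qed

lemma integral_over_box_eq_0:
  fixes \<Omega> :: "'a::euclidean_space set"
  assumes h: "sq_integrable h" and orth: "\<And>\<phi>. \<phi> \<in> test_functions \<Omega> \<Longrightarrow> (\<integral>p. h p * \<phi> p \<partial>lebesgue) = 0"
    and sub: "cbox a b \<subseteq> \<Omega>"
  shows "(\<integral>p. h p * indicator (box a b) p \<partial>lebesgue) = 0"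
proof -
  have hm: "h \<in> borel_measurable lebesgue" using h by (simp add: sq_integrable_def)
  have bm: "box_bump a b k \<in> borel_measurable lebesgue" for k
    by (intro smooth_measurable test_function_smooth[OF box_bump_test_function[OF sub]])
  have "(\<lambda>k. \<integral>p. h p * box_bump a b k p \<partial>lebesgue) \<longlonglongrightarrow> (\<integral>p. h p * indicator (box a b) p \<partial>lebesgue)"
  proof (rule integral_dominated_convergence)
    show "integrable lebesgue (\<lambda>p. \<bar>h p * indicator (cbox a b) p\<bar>)"
      by (intro integrable_abs sq_integrable_mult h sq_integrable_indicator) auto
    show "AE p in lebesgue. (\<lambda>k. h p * box_bump a b k p) \<longlonglongrightarrow> h p * indicator (box a b) p"
      by (intro AE_I2 tendsto_intros box_bump_tendsto)
    show "AE p in lebesgue. norm (h p * box_bump a b k p) \<le> \<bar>h p * indicator (cbox a b) p\<bar>" for k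
    proof (rule AE_I2)
      fix p
      have "\<bar>box_bump a b k p\<bar> \<le> indicator (cbox a b) p"
        using box_bump_bounds[of a b k p] box_bump_outside[of p a b k] box_subset_cbox[of a b]
        by (auto simp: indicator_def)
      then show "norm (h p * box_bump a b k p) \<le> \<bar>h p * indicator (cbox a b) p\<bar>"
        by (simp add: abs_mult mult_left_mono)
    qed
    show "(\<lambda>p. h p * indicator (box a b) p) \<in> borel_measurable lebesgue"
      by (intro borel_measurable_times hm borel_measurable_indicator) simp
    show "(\<lambda>p. h p * box_bump a b k p) \<in> borel_measurable lebesgue" for k
      by (intro borel_measurable_times hm bm)
  qed
  then show ?thesis
    using orth[OF box_bump_test_function[OF sub]] by (simp add: LIMSEQ_const_iff)
qed

text \<open>Open boxes generate the Borel sets and are closed under intersection. Hence the integral over a box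
being zero carries over to all Borel subsets of the given box. The Borel function \<open>h'\<close> replaces \<open>h\<close>, which is
only Lebesgue measurable.\<close>

lemma AE_zero_on_box:
  fixes \<Omega> :: "'a::euclidean_space set"
  assumes h: "sq_integrable h" and orth: "\<And>\<phi>. \<phi> \<in> test_functions \<Omega> \<Longrightarrow> (\<integral>p. h p * \<phi> p \<partial>lebesgue) = 0"
    and sub: "cbox a b \<subseteq> \<Omega>"
  shows "AE p in lebesgue. p \<in> cbox a b \<longrightarrow> h p = 0"
proof -
  have hm[measurable]: "h \<in> borel_measurable lebesgue" using h by (simp add: sq_integrable_def)
  have hbm: "(\<lambda>p. h p * indicator (box x y) p) \<in> borel_measurable lebesgue" for x y
    by (intro borel_measurable_times hm borel_measurable_indicator) simp
  obtain h' where h'[measurable]: "h' \<in> borel_measurable lborel" and eq: "AE p in lborel. h p = h' p"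
    using completion_ex_borel_measurable_real[OF hm] by blast
  have eq': "AE p in lebesgue. h p = h' p" using eq by (rule AE_completion)
  define f where "f = (\<lambda>p. h' p * indicator (box a b) p)"
  have [measurable]: "f \<in> borel_measurable lborel" unfolding f_def by measurable
  have fh: "AE p in lebesgue. f p = h p * indicator (box a b) p"
    using eq' by eventually_elim (simp add: f_def)
  have "integrable lebesgue (\<lambda>p. h p * indicator (box a b) p)"
    by (intro sq_integrable_mult h sq_integrable_indicator[of _ a b]) (auto simp: box_subset_cbox)
  then have "integrable lebesgue f"
    using fh by (subst integrable_cong_AE[OF _ _ fh]) (auto intro: measurable_completion)
  then have int: "integrable lborel f" by (simp add: integrable_completion)
  \<comment> \<open>Dynkin induction over the generator of open boxes\<close>
  have zero: "(\<integral>p. indicator A p * f p \<partial>lborel) = 0" if "A \<in> sets borel" for A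
  proof -
    have "Int_stable (range (\<lambda>(a, b). box a b :: 'a set))"
      by (auto simp: Int_stable_def box_Int_box)
    moreover have "range (\<lambda>(a, b). box a b :: 'a set) \<subseteq> Pow UNIV" by auto
    moreover have "A \<in> sigma_sets UNIV (range (\<lambda>(a, b). box a b))"
      using that unfolding borel_eq_box by simp
    ultimately show ?thesis
    proof (induction A rule: sigma_sets_induct_disjoint)
      case (basic A)
      then obtain c d where A: "A = box c d" by auto
      define c' d' where "c' = (\<Sum>i\<in>Basis. max (c \<bullet> i) (a \<bullet> i) *\<^sub>R i)"
        and "d' = (\<Sum>i\<in>Basis. min (d \<bullet> i) (b \<bullet> i) *\<^sub>R i)"
      have AB: "A \<inter> box a b = box c' d'" by (simp add: A c'_def d'_def box_Int_box)
      have "cbox c' d' \<subseteq> cbox a b"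
        by (auto simp: subset_iff mem_box c'_def d'_def inner_sum_left_Basis)
      then have 0: "(\<integral>p. h p * indicator (box c' d') p \<partial>lebesgue) = 0"
        using sub by (intro integral_over_box_eq_0[where \<Omega> = \<Omega>, OF h orth]) auto
      have "(\<integral>p. indicator A p * f p \<partial>lborel) = (\<integral>p. h' p * indicator (box c' d') p \<partial>lborel)"
        unfolding AB[symmetric] f_def by (intro Bochner_Integration.integral_cong) (auto simp: indicator_def)
      also have "\<dots> = (\<integral>p. h' p * indicator (box c' d') p \<partial>lebesgue)"
        by (rule integral_completion[symmetric]) measurable
      also have "\<dots> = (\<integral>p. h p * indicator (box c' d') p \<partial>lebesgue)"
      proof (rule integral_cong_AE)
        show "AE p in lebesgue. h' p * indicator (box c' d') p = h p * indicator (box c' d') p"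
          using eq' by eventually_elim simp
        show "(\<lambda>p. h' p * indicator (box c' d') p) \<in> borel_measurable lebesgue"
          by (rule measurable_completion) measurable
        show "(\<lambda>p. h p * indicator (box c' d') p) \<in> borel_measurable lebesgue" by (rule hbm)
      qed
      finally show ?case using 0 by simp
    next
      case empty
      then show ?case by simp
    next
      case (compl A)
      then have [measurable]: "A \<in> sets borel" by (simp add: borel_eq_box)
      have "(\<integral>p. h p * indicator (box a b) p \<partial>lebesgue) = 0"
        by (rule integral_over_box_eq_0[OF h orth sub])
      also have "(\<integral>p. h p * indicator (box a b) p \<partial>lebesgue) = (\<integral>p. f p \<partial>lebesgue)"
        using fh by (intro integral_cong_AE hbm) (auto intro: measurable_completion)
      finally have f0: "(\<integral>p. f p \<partial>lborel) = 0" by (simp add: integral_completion)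
      have "(\<integral>p. indicator (UNIV - A) p * f p \<partial>lborel) = (\<integral>p. f p - indicator A p * f p \<partial>lborel)"
        by (intro Bochner_Integration.integral_cong) (auto simp: indicator_def)
      also have "\<dots> = (\<integral>p. f p \<partial>lborel) - (\<integral>p. indicator A p * f p \<partial>lborel)"
        using int integrable_mult_indicator[OF _ int, of A]
        by (intro Bochner_Integration.integral_diff) auto
      finally show ?case using f0 compl.IH by simp
    next
      case (union A)
      then have [measurable]: "A i \<in> sets borel" for i by (auto simp: borel_eq_box)
      have "(\<integral>p\<in>(\<Union>i. A i). f p \<partial>lborel) = (\<Sum>i. \<integral>p\<in>A i. f p \<partial>lborel)"
        using union(1) integrable_mult_indicator[OF _ int, of "\<Union>i. A i"]
        by (intro lebesgue_integral_countable_add) (auto simp: disjoint_family_on_def set_integrable_def)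
      then show ?case using union.IH by (simp add: set_lebesgue_integral_def)
    qed
  qed
  have "AE p in lborel. f p = 0"
    by (rule density_unique_real[OF int]) (use zero in \<open>auto simp: set_lebesgue_integral_def\<close>)
  then have "AE p in lebesgue. f p = 0" by (rule AE_completion)
  moreover have "AE p in lebesgue. p \<notin> cbox a b - box a b"
    by (rule AE_not_in) (simp add: negligible_frontier_interval negligible_iff_null_sets[symmetric])
  ultimately show ?thesis
    using eq' by eventually_elim (auto simp: f_def)
qed

text \<open>An open set is a countable union of closed boxes.\<close>

lemma test_functions_dense:
  fixes \<Omega> :: "'a::euclidean_space set"
  assumes \<Omega>: "open \<Omega>" and h: "sq_integrable h"
    and orth: "\<And>\<phi>. \<phi> \<in> test_functions \<Omega> \<Longrightarrow> (\<integral>p. h p * \<phi> p \<partial>lebesgue) = 0"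
  shows "AE p in lebesgue. p \<in> \<Omega> \<longrightarrow> h p = 0"
proof -
  obtain \<D> where D: "countable \<D>" "\<D> \<subseteq> Pow \<Omega>" "\<And>X. X \<in> \<D> \<Longrightarrow> \<exists>a b. X = cbox a b" "\<Union>\<D> = \<Omega>"
    using open_countable_Union_open_cbox[OF \<Omega>] by metis
  have "AE p in lebesgue. \<forall>X\<in>\<D>. p \<in> X \<longrightarrow> h p = 0"
  proof (subst AE_ball_countable[OF D(1)], rule ballI)
    fix X assume X: "X \<in> \<D>"
    then obtain a b where "X = cbox a b" using D(3) by blast
    then show "AE p in lebesgue. p \<in> X \<longrightarrow> h p = 0"
      using AE_zero_on_box[OF h orth, of \<Omega> a b] D(2) X by auto
  qed
  then show ?thesis by eventually_elim (use D(4) in blast)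
qed

section \<open>Volume preserving maps and the flows of shear fields\<close>

lemma nn_norm_abs_l2_borel:
  assumes "u \<in> borel_measurable borel" "sq_integrable u"
  shows "(\<integral>\<^sup>+p. ennreal ((u p)\<^sup>2) \<partial>lborel) = ennreal ((norm (abs_l2 u))\<^sup>2)"
  using nn_norm_abs_l2[OF assms(2)] by (simp add: nn_integral_completion)

lemma sq_integrable_bounded_support:
  fixes u :: "'a::euclidean_space \<Rightarrow> real"
  assumes "u \<in> borel_measurable lebesgue" "\<And>p. \<bar>u p\<bar> \<le> C" "bounded S" "\<And>p. p \<notin> S \<Longrightarrow> u p = 0"
  shows "sq_integrable u"
proof -
  obtain a where "S \<subseteq> cbox (-a) a" using bounded_subset_cbox_symmetric[OF assms(3)] by blast
  then have "u = (\<lambda>p. u p * indicator (cbox (-a) a) p)"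
    using assms(4) by (intro ext) (force simp: indicator_def)
  moreover have "sq_integrable (\<lambda>p. u p * indicator (cbox (-a) a) p)"
    by (intro sq_integrable_bounded_mult[OF assms(1,2)] sq_integrable_indicator) auto
  ultimately show ?thesis by simp
qed

lemma test_function_sq_integrable:
  assumes "\<phi> \<in> test_functions \<Omega>"
  shows "sq_integrable \<phi>"
proof -
  obtain K where K: "compact K" "\<And>p. p \<notin> K \<Longrightarrow> \<phi> p = 0" using assms by (metis test_functionsE)
  obtain C where "\<And>p. \<bar>\<phi> p\<bar> \<le> C" using test_function_bounded[OF assms] by blast
  then show ?thesis
    using K by (intro sq_integrable_bounded_support[of \<phi> C K] smooth_measurable test_function_smooth[OF assms])
      (auto intro: compact_imp_bounded)
qed

definition volume_preserving :: "('a::euclidean_space \<Rightarrow> 'a) \<Rightarrow> bool" where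
  "volume_preserving \<tau> \<longleftrightarrow> \<tau> \<in> borel_measurable borel \<and> distr lborel borel \<tau> = lborel"

lemma volume_preserving_measurable: "volume_preserving \<tau> \<Longrightarrow> \<tau> \<in> borel_measurable borel"
  by (simp add: volume_preserving_def)

lemma volume_preserving_nn_integral:
  fixes f :: "'a::euclidean_space \<Rightarrow> ennreal"
  assumes "volume_preserving \<tau>" "f \<in> borel_measurable borel"
  shows "(\<integral>\<^sup>+p. f (\<tau> p) \<partial>lborel) = (\<integral>\<^sup>+p. f p \<partial>lborel)"
proof -
  have "(\<integral>\<^sup>+p. f p \<partial>lborel) = (\<integral>\<^sup>+p. f p \<partial>distr lborel borel \<tau>)"
    using assms(1) by (simp add: volume_preserving_def)
  also have "\<dots> = (\<integral>\<^sup>+p. f (\<tau> p) \<partial>lborel)"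
    using assms by (intro nn_integral_distr) (auto simp: volume_preserving_def)
  finally show ?thesis ..
qed

text \<open>Preservation of integrals is easier to check than preservation of measures, since it can be done one
variable at a time.\<close>

lemma volume_preservingI:
  fixes \<tau> :: "'a::euclidean_space \<Rightarrow> 'a"
  assumes [measurable]: "\<tau> \<in> borel_measurable borel"
    and eq: "\<And>f. f \<in> borel_measurable borel \<Longrightarrow> (\<integral>\<^sup>+p. f (\<tau> p) \<partial>lborel) = (\<integral>\<^sup>+p. f p \<partial>lborel)"
  shows "volume_preserving \<tau>"
  unfolding volume_preserving_def
proof
  show "distr lborel borel \<tau> = lborel"
  proof (rule measure_eqI)
    fix A assume "A \<in> sets (distr lborel borel \<tau>)"
    then have [measurable]: "A \<in> sets borel" by simp
    have "emeasure (distr lborel borel \<tau>) A = (\<integral>\<^sup>+p. indicator A p \<partial>distr lborel borel \<tau>)" by simp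
    also have "\<dots> = (\<integral>\<^sup>+p. indicator A (\<tau> p) \<partial>lborel)" by (intro nn_integral_distr) auto
    also have "\<dots> = (\<integral>\<^sup>+p. indicator A p \<partial>lborel)" by (intro eq) simp
    finally show "emeasure (distr lborel borel \<tau>) A = emeasure lborel A" by simp
  qed simp
qed simp

lemma volume_preserving_compose:
  fixes \<sigma> \<tau> :: "'a::euclidean_space \<Rightarrow> 'a"
  assumes s: "volume_preserving \<sigma>" and t: "volume_preserving \<tau>"
  shows "volume_preserving (\<lambda>p. \<sigma> (\<tau> p))"
proof (rule volume_preservingI)
  have [measurable]: "\<sigma> \<in> borel_measurable borel" "\<tau> \<in> borel_measurable borel"
    using assms by (auto simp: volume_preserving_def)
  show "(\<lambda>p. \<sigma> (\<tau> p)) \<in> borel_measurable borel" by measurable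
  fix f :: "'a \<Rightarrow> ennreal" assume [measurable]: "f \<in> borel_measurable borel"
  show "(\<integral>\<^sup>+p. f (\<sigma> (\<tau> p)) \<partial>lborel) = (\<integral>\<^sup>+p. f p \<partial>lborel)"
    using volume_preserving_nn_integral[OF t, of "\<lambda>p. f (\<sigma> p)"] volume_preserving_nn_integral[OF s, of f]
    by simp
qed

lemma volume_preserving_translation:
  fixes c :: "'a::euclidean_space"
  shows "volume_preserving (\<lambda>p. p + c)"
proof -
  have "(\<lambda>p. p + c) = (+) c" by (auto simp: add.commute)
  then show ?thesis unfolding volume_preserving_def by (simp add: lborel_distr_plus)
qed

lemma nn_integral_lborel_triple:
  fixes f :: "'a::euclidean_space \<times> 'b::euclidean_space \<times> 'c::euclidean_space \<Rightarrow> ennreal"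
  assumes [measurable]: "f \<in> borel_measurable borel"
  shows "(\<integral>\<^sup>+p. f p \<partial>lborel) = (\<integral>\<^sup>+x. \<integral>\<^sup>+y. \<integral>\<^sup>+t. f (x, y, t) \<partial>lborel \<partial>lborel \<partial>lborel)"
proof -
  have "(\<integral>\<^sup>+p. f p \<partial>lborel) = (\<integral>\<^sup>+x. \<integral>\<^sup>+q. f (x, q) \<partial>lborel \<partial>lborel)"
    by (subst lborel_prod[symmetric], rule lborel.nn_integral_fst[symmetric]) (simp add: lborel_prod borel_prod)
  also have "\<dots> = (\<integral>\<^sup>+x. \<integral>\<^sup>+y. \<integral>\<^sup>+t. f (x, y, t) \<partial>lborel \<partial>lborel \<partial>lborel)"
  proof (intro nn_integral_cong)
    fix x :: 'a
    have [measurable]: "(\<lambda>q. f (x, q)) \<in> borel_measurable borel"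
      by (rule measurable_compose[OF _ assms]) (auto simp: borel_prod[symmetric])
    show "(\<integral>\<^sup>+q. f (x, q) \<partial>lborel) = (\<integral>\<^sup>+y. \<integral>\<^sup>+t. f (x, y, t) \<partial>lborel \<partial>lborel)"
      by (subst lborel_prod[symmetric], rule lborel.nn_integral_fst[symmetric]) (simp add: lborel_prod borel_prod)
  qed
  finally show ?thesis .
qed

lemma volume_preserving_vertical_shear:
  fixes g :: "'a::euclidean_space \<times> 'b::euclidean_space \<Rightarrow> real"
  assumes g[measurable]: "g \<in> borel_measurable borel"
  shows "volume_preserving (\<lambda>(x, y, t). (x, y, t + g (x, y)))"
proof (rule volume_preservingI)
  let ?S = "\<lambda>(x :: 'a, y :: 'b, t). (x, y, t + g (x, y))"
  have "(\<lambda>p. (fst p, fst (snd p))) \<in> borel_measurable (borel :: ('a \<times> 'b \<times> real) measure)"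
    by (intro borel_measurable_continuous_onI continuous_intros)
  from measurable_compose[OF this g]
  have [measurable]: "(\<lambda>p. g (fst p, fst (snd p))) \<in> borel_measurable (borel :: ('a \<times> 'b \<times> real) measure)" .
  have "(\<lambda>p. (fst p, fst (snd p), snd (snd p) + g (fst p, fst (snd p)))) \<in> borel_measurable (borel :: ('a \<times> 'b \<times> real) measure)"
    by (intro borel_measurable_Pair borel_measurable_add borel_measurable_continuous_onI[of fst]
        borel_measurable_continuous_onI[of "\<lambda>p. fst (snd p)"] borel_measurable_continuous_onI[of "\<lambda>p. snd (snd p)"]
        continuous_intros) measurable
  then show S[measurable]: "?S \<in> borel_measurable borel"
    by (simp add: case_prod_beta')
  fix f :: "'a \<times> 'b \<times> real \<Rightarrow> ennreal" assume f[measurable]: "f \<in> borel_measurable borel"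
  have fibre: "(\<integral>\<^sup>+t. f (x, y, t + g (x, y)) \<partial>lborel) = (\<integral>\<^sup>+t. f (x, y, t) \<partial>lborel)" for x y
  proof -
    have "(\<lambda>t. f (x, y, t)) \<in> borel_measurable borel"
      by (rule measurable_compose[OF _ f]) (auto simp: borel_prod[symmetric])
    then show ?thesis
      using volume_preserving_nn_integral[OF volume_preserving_translation, of "\<lambda>t. f (x, y, t)" "g (x, y)"] by simp
  qed
  have "(\<integral>\<^sup>+p. f (?S p) \<partial>lborel) = (\<integral>\<^sup>+x. \<integral>\<^sup>+y. \<integral>\<^sup>+t. f (x, y, t + g (x, y)) \<partial>lborel \<partial>lborel \<partial>lborel)"
    by (subst nn_integral_lborel_triple) auto
  also have "\<dots> = (\<integral>\<^sup>+x. \<integral>\<^sup>+y. \<integral>\<^sup>+t. f (x, y, t) \<partial>lborel \<partial>lborel \<partial>lborel)"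
    by (simp only: fibre)
  also have "\<dots> = (\<integral>\<^sup>+p. f p \<partial>lborel)" by (simp add: nn_integral_lborel_triple)
  finally show "(\<integral>\<^sup>+p. f (?S p) \<partial>lborel) = (\<integral>\<^sup>+p. f p \<partial>lborel)" .
qed

lemma volume_preserving_sq_integrable:
  assumes \<tau>: "volume_preserving \<tau>" and u[measurable]: "u \<in> borel_measurable borel" and sq: "sq_integrable u"
  shows "sq_integrable (\<lambda>p. u (\<tau> p))" "norm (abs_l2 (\<lambda>p. u (\<tau> p))) = norm (abs_l2 u)"
proof -
  have [measurable]: "\<tau> \<in> borel_measurable borel" by (rule volume_preserving_measurable[OF \<tau>])
  have eq: "(\<integral>\<^sup>+p. ennreal ((u (\<tau> p))\<^sup>2) \<partial>lborel) = (\<integral>\<^sup>+p. ennreal ((u p)\<^sup>2) \<partial>lborel)"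
    by (rule volume_preserving_nn_integral[OF \<tau>, of "\<lambda>p. ennreal ((u p)\<^sup>2)"]) simp
  have m[measurable]: "(\<lambda>p. u (\<tau> p)) \<in> borel_measurable borel" by measurable
  have ml: "(\<lambda>p. u (\<tau> p)) \<in> borel_measurable lebesgue" by (intro measurable_completion) simp
  have "(\<integral>\<^sup>+p. ennreal ((u (\<tau> p))\<^sup>2) \<partial>lebesgue) < \<infinity>"
    by (simp add: nn_integral_completion eq nn_norm_abs_l2_borel[OF u sq])
  then show sq': "sq_integrable (\<lambda>p. u (\<tau> p))"
    unfolding sq_integrable_def integrable_iff_bounded using ml by simp
  show "norm (abs_l2 (\<lambda>p. u (\<tau> p))) = norm (abs_l2 u)"
    using eq by (simp add: nn_norm_abs_l2_borel[OF u sq] nn_norm_abs_l2_borel[OF m sq'])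
qed

definition displacement :: "('a::euclidean_space \<Rightarrow> real) \<Rightarrow> ('a \<Rightarrow> 'a) \<Rightarrow> real" where
  "displacement u \<tau> = norm (abs_l2 (\<lambda>p. u (\<tau> p) - u p))"

lemma displacement_sq_integrable:
  "volume_preserving \<tau> \<Longrightarrow> u \<in> borel_measurable borel \<Longrightarrow> sq_integrable u \<Longrightarrow> sq_integrable (\<lambda>p. u (\<tau> p) - u p)"
  by (rule sq_integrable_diff[OF volume_preserving_sq_integrable(1)])

text \<open>Moving first by \<open>\<tau>\<close> does not alter the norm of the change caused by \<open>\<sigma>\<close>, because \<open>\<tau>\<close> preserves volume.\<close>

lemma displacement_compose:
  assumes "volume_preserving \<sigma>" "volume_preserving \<tau>" "u \<in> borel_measurable borel" "sq_integrable u"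
  shows "displacement u (\<lambda>p. \<sigma> (\<tau> p)) \<le> displacement u \<sigma> + displacement u \<tau>"
proof -
  have m: "(\<lambda>p. u (\<sigma> p) - u p) \<in> borel_measurable borel"
    using assms(3) measurable_compose[OF volume_preserving_measurable[OF assms(1)] assms(3)] by simp
  note d = displacement_sq_integrable[OF assms(1,3,4)]
  note d' = volume_preserving_sq_integrable[OF assms(2) m d]
  have "abs_l2 (\<lambda>p. u (\<sigma> (\<tau> p)) - u p) = abs_l2 (\<lambda>p. u (\<sigma> (\<tau> p)) - u (\<tau> p)) + abs_l2 (\<lambda>p. u (\<tau> p) - u p)"
    by (subst abs_l2_add) (auto intro!: d' displacement_sq_integrable assms)
  also have "norm \<dots> \<le> norm (abs_l2 (\<lambda>p. u (\<sigma> (\<tau> p)) - u (\<tau> p))) + norm (abs_l2 (\<lambda>p. u (\<tau> p) - u p))"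
    by (rule norm_triangle_ineq)
  also have "norm (abs_l2 (\<lambda>p. u (\<sigma> (\<tau> p)) - u (\<tau> p))) = displacement u \<sigma>"
    using d'(2) by (simp add: displacement_def)
  finally show ?thesis by (simp add: displacement_def)
qed

lemma displacement_id: "displacement u (\<lambda>p. p) = 0"
  by (simp add: displacement_def abs_l2_zero)

text \<open>By \<open>invariant\<close> the field is constant along its integral lines. These are then straight, and
\<open>\<lambda>p. p + s *\<^sub>R V p\<close> is the flow of the field at time \<open>s\<close>.\<close>

locale shear_flow =
  fixes V :: "'a::euclidean_space \<Rightarrow> 'a"
  assumes affine: "affine_field V"
    and invariant: "\<And>p s. V (p + s *\<^sub>R V p) = V p"
    and preserving: "\<And>s. volume_preserving (\<lambda>p. p + s *\<^sub>R V p)"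
begin

lemma continuous_V: "continuous_on S V"
proof -
  obtain c L where "bounded_linear L" "V = (\<lambda>p. c + L p)" using affine by (auto simp: affine_field_def)
  then show ?thesis by (simp add: continuous_on_add linear_continuous_on)
qed

lemma flow_derivative:
  assumes "smooth f"
  shows "((\<lambda>r. f (p + r *\<^sub>R V p)) has_real_derivative along V f (p + r *\<^sub>R V p)) (at r)"
proof -
  let ?D = "frechet_derivative f (at (p + r *\<^sub>R V p))"
  have D: "(f has_derivative ?D) (at (p + r *\<^sub>R V p))" by (rule smooth_has_derivative[OF assms])
  have "((\<lambda>r. p + r *\<^sub>R V p) has_derivative (\<lambda>t. t *\<^sub>R V p)) (at r)"
    by (auto intro!: derivative_eq_intros)
  from has_derivative_compose[OF this D]
  have "((\<lambda>r. f (p + r *\<^sub>R V p)) has_derivative (\<lambda>t. ?D (t *\<^sub>R V p))) (at r)" .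
  moreover have "?D (t *\<^sub>R V p) = along V f (p + r *\<^sub>R V p) * t" for t
    using linear_cmul[OF has_derivative_linear[OF D]] by (simp add: along_def invariant)
  ultimately show ?thesis by (simp add: has_field_derivative_def)
qed

lemma difference_quotient_tendsto:
  assumes "smooth f"
  shows "(\<lambda>N. real (Suc N) * (f (p + (s / real (Suc N)) *\<^sub>R V p) - f p)) \<longlonglongrightarrow> s * along V f p"
proof (cases "s = 0")
  case False
  have "((\<lambda>h. (f (p + h *\<^sub>R V p) - f p) / h) \<longlongrightarrow> along V f p) (at 0)"
    using flow_derivative[OF assms, of p 0] by (simp add: DERIV_def)
  moreover have "filterlim (\<lambda>N. s / real (Suc N)) (at 0) sequentially"
  proof (rule filterlim_atI)
    show "(\<lambda>N. s / real (Suc N)) \<longlonglongrightarrow> 0"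
      using tendsto_mult[OF tendsto_const[of s] LIMSEQ_Suc[OF lim_1_over_n]] by simp
  qed (use False in auto)
  ultimately have "(\<lambda>N. (f (p + (s / real (Suc N)) *\<^sub>R V p) - f p) / (s / real (Suc N))) \<longlonglongrightarrow> along V f p"
    by (rule filterlim_compose)
  then have "(\<lambda>N. s * ((f (p + (s / real (Suc N)) *\<^sub>R V p) - f p) / (s / real (Suc N)))) \<longlonglongrightarrow> s * along V f p"
    by (rule tendsto_mult[OF tendsto_const])
  moreover have "s * (x / (s / real (Suc N))) = real (Suc N) * x" for x N
    using False by (simp del: of_nat_Suc)
  ultimately show ?thesis by (simp only:)
qed simp

lemma flow_increment_bound:
  assumes "smooth f" "\<And>p. \<bar>along V f p\<bar> \<le> C"
  shows "\<bar>f (p + s *\<^sub>R V p) - f p\<bar> \<le> C * \<bar>s\<bar>"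
  using field_differentiable_bound[of UNIV "\<lambda>r. f (p + r *\<^sub>R V p)" "\<lambda>r. along V f (p + r *\<^sub>R V p)" C s 0]
    flow_derivative[OF assms(1), of p] assms(2) by simp

text \<open>By \<open>invariant\<close> the starting point of a flow line is recovered from its end by \<open>q \<mapsto> q - r *\<^sub>R V q\<close>.\<close>

lemma flow_support_bounded:
  assumes "compact K"
  obtains a where "\<And>p r. \<bar>r\<bar> \<le> \<bar>s\<bar> \<Longrightarrow> p + r *\<^sub>R V p \<in> K \<Longrightarrow> p \<in> cbox (-a) a" 
proof -
  let ?S = "(\<lambda>(q, r). q - r *\<^sub>R V q) ` (K \<times> {- \<bar>s\<bar>..\<bar>s\<bar>})"
  have "compact ?S"
    unfolding case_prod_beta
    by (intro compact_continuous_image compact_Times assms compact_Icc continuous_intros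
        continuous_on_compose2[OF continuous_V[of UNIV]]) auto
  then obtain a where a: "?S \<subseteq> cbox (-a) a"
    using bounded_subset_cbox_symmetric compact_imp_bounded by blast
  have "p \<in> cbox (-a) a" if "\<bar>r\<bar> \<le> \<bar>s\<bar>" "p + r *\<^sub>R V p \<in> K" for p r
  proof -
    have "p = (\<lambda>(q, r). q - r *\<^sub>R V q) (p + r *\<^sub>R V p, r)" by (simp add: invariant)
    moreover have "(p + r *\<^sub>R V p, r) \<in> K \<times> {- \<bar>s\<bar>..\<bar>s\<bar>}" using that by auto
    ultimately show ?thesis using a by blast
  qed
  then show thesis by (rule that)
qed

lemma difference_quotient_dominated:
  assumes "\<phi> \<in> test_functions \<Omega>"
  obtains C a where "\<And>N p. \<bar>real (Suc N) * (\<phi> (p + (s / real (Suc N)) *\<^sub>R V p) - \<phi> p)\<bar> \<le> C * indicator (cbox (-a) a) p"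
proof -
  obtain K where K: "smooth \<phi>" "compact K" "\<And>p. p \<notin> K \<Longrightarrow> \<phi> p = 0" using assms by (metis test_functionsE)
  obtain C where C: "\<And>p. \<bar>along V \<phi> p\<bar> \<le> C"
    using test_function_bounded[OF test_function_along[OF affine assms]] by blast
  obtain a where a: "\<And>p r. \<bar>r\<bar> \<le> \<bar>s\<bar> \<Longrightarrow> p + r *\<^sub>R V p \<in> K \<Longrightarrow> p \<in> cbox (-a) a"
    using flow_support_bounded[OF K(2)] by blast
  have "\<bar>real (Suc N) * (\<phi> (p + (s / real (Suc N)) *\<^sub>R V p) - \<phi> p)\<bar> \<le> (C * \<bar>s\<bar>) * indicator (cbox (-a) a) p" for N p
  proof -
    have le: "\<bar>s / real (Suc N)\<bar> \<le> \<bar>s\<bar>"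
      by (simp add: divide_le_eq mult_le_cancel_left1 abs_div del: of_nat_Suc)
    show ?thesis
    proof (cases "p \<in> cbox (-a) a")
      case True
      have "\<bar>real (Suc N) * (\<phi> (p + (s / real (Suc N)) *\<^sub>R V p) - \<phi> p)\<bar> \<le> real (Suc N) * (C * \<bar>s / real (Suc N)\<bar>)"
        using mult_left_mono[OF flow_increment_bound[OF K(1) C, of p "s / real (Suc N)"], of "real (Suc N)"]
        by (simp only: abs_mult abs_of_nat of_nat_0_le_iff)
      also have "\<dots> = C * \<bar>s\<bar>" by (simp add: abs_div del: of_nat_Suc)
      finally show ?thesis using True by simp
    next
      case False
      then have "p + (s / real (Suc N)) *\<^sub>R V p \<notin> K" "p + 0 *\<^sub>R V p \<notin> K"
        using a[OF le] a[of 0] by auto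
      then show ?thesis using K(3) False by simp
    qed
  qed
  then show thesis by (rule that)
qed

lemma borel_flow: "f \<in> borel_measurable borel \<Longrightarrow> (\<lambda>p. f (p + s *\<^sub>R V p)) \<in> borel_measurable borel"
  using measurable_compose[OF volume_preserving_measurable[OF preserving]] .

text \<open>The flow preserves the integral, so the difference quotients have integral zero.\<close>

lemma integral_along_eq_0:
  assumes "\<phi> \<in> test_functions \<Omega>"
  shows "(\<integral>p. along V \<phi> p \<partial>lebesgue) = 0"
proof -
  obtain C a where dom: "\<And>N p. \<bar>real (Suc N) * (\<phi> (p + (1 / real (Suc N)) *\<^sub>R V p) - \<phi> p)\<bar> \<le> C * indicator (cbox (-a) a) p"
    using difference_quotient_dominated[OF assms, of 1] by blast
  have [measurable]: "\<phi> \<in> borel_measurable borel" "along V \<phi> \<in> borel_measurable borel"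
    using assms test_function_along[OF affine assms] by (auto intro!: smooth_borel_measurable test_function_smooth)
  have [measurable]: "(\<lambda>p. \<phi> (p + s *\<^sub>R V p)) \<in> borel_measurable borel" for s by (rule borel_flow) measurable
  have "(\<lambda>N. \<integral>p. real (Suc N) * (\<phi> (p + (1 / real (Suc N)) *\<^sub>R V p) - \<phi> p) \<partial>lborel) \<longlonglongrightarrow> (\<integral>p. along V \<phi> p \<partial>lborel)"
  proof (rule integral_dominated_convergence)
    show "integrable lborel (\<lambda>p. C * indicator (cbox (-a) a) p)"
      by (intro integrable_mult_right integrable_real_indicator) (auto simp: emeasure_lborel_cbox_eq)
    show "AE p in lborel. (\<lambda>N. real (Suc N) * (\<phi> (p + (1 / real (Suc N)) *\<^sub>R V p) - \<phi> p)) \<longlonglongrightarrow> along V \<phi> p"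
      using difference_quotient_tendsto[OF test_function_smooth[OF assms], of _ 1] by simp
    show "AE p in lborel. norm (real (Suc N) * (\<phi> (p + (1 / real (Suc N)) *\<^sub>R V p) - \<phi> p)) \<le> C * indicator (cbox (-a) a) p" for N
      using dom[of N] by simp
  qed measurable
  moreover have "(\<integral>p. real (Suc N) * (\<phi> (p + s *\<^sub>R V p) - \<phi> p) \<partial>lborel) = 0" for N s
  proof -
    have int: "integrable lborel \<phi>"
    proof -
      obtain K where K: "compact K" "\<And>p. p \<notin> K \<Longrightarrow> \<phi> p = 0" using assms by (metis test_functionsE)
      obtain b where b: "K \<subseteq> cbox (-b) b" using K(1) bounded_subset_cbox_symmetric compact_imp_bounded by blast
      have "integrable lebesgue (\<lambda>p. \<phi> p * indicator (cbox (-b) b) p)"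
        by (intro sq_integrable_mult test_function_sq_integrable[OF assms] sq_integrable_indicator) auto
      also have "(\<lambda>p. \<phi> p * indicator (cbox (-b) b) p) = \<phi>" using K(2) b by (intro ext) (force simp: indicator_def)
      finally show ?thesis by (simp add: integrable_completion)
    qed
    have pres: "distr lborel borel (\<lambda>p. p + s *\<^sub>R V p) = lborel" "(\<lambda>p. p + s *\<^sub>R V p) \<in> measurable lborel borel"
      using preserving[of s] by (auto simp: volume_preserving_def)
    have int': "integrable lborel (\<lambda>p. \<phi> (p + s *\<^sub>R V p))"
      using integrable_distr_eq[OF pres(2), of \<phi>] int by (simp add: pres)
    have "(\<integral>p. \<phi> (p + s *\<^sub>R V p) \<partial>lborel) = (\<integral>p. \<phi> p \<partial>lborel)"
      using integral_distr[OF pres(2), of \<phi>] by (simp add: pres)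
    then show ?thesis using int int' by simp
  qed
  ultimately have "(\<integral>p. along V \<phi> p \<partial>lborel) = 0" by (simp add: LIMSEQ_const_iff del: of_nat_Suc)
  then show ?thesis by (simp add: integral_completion)
qed

lemma integration_by_parts:
  assumes "\<phi> \<in> test_functions \<Omega>" "\<psi> \<in> test_functions \<Omega>"
  shows "(\<integral>p. \<phi> p * along V \<psi> p \<partial>lebesgue) = - (\<integral>p. along V \<phi> p * \<psi> p \<partial>lebesgue)"
proof -
  have "0 = (\<integral>p. along V (\<lambda>p. \<phi> p * \<psi> p) p \<partial>lebesgue)"
    by (rule integral_along_eq_0[symmetric, OF test_function_smooth_mult[OF test_function_smooth[OF assms(1)] assms(2)]])
  also have "\<dots> = (\<integral>p. \<phi> p * along V \<psi> p + along V \<phi> p * \<psi> p \<partial>lebesgue)"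
    by (simp add: along_mult assms[THEN test_function_smooth])
  also have "\<dots> = (\<integral>p. \<phi> p * along V \<psi> p \<partial>lebesgue) + (\<integral>p. along V \<phi> p * \<psi> p \<partial>lebesgue)"
    using assms by (intro Bochner_Integration.integral_add sq_integrable_mult test_function_sq_integrable test_function_along affine)
  finally show ?thesis by simp
qed

lemma displacement_flow_multiple:
  assumes "u \<in> borel_measurable borel" "sq_integrable u"
  shows "displacement u (\<lambda>p. p + (real N * s) *\<^sub>R V p) \<le> real N * displacement u (\<lambda>p. p + s *\<^sub>R V p)"
proof (induction N)
  case 0
  show ?case by (simp add: displacement_id)
next
  case (Suc N)
  have "(\<lambda>p. p + (real (Suc N) * s) *\<^sub>R V p) = (\<lambda>p. (p + (real N * s) *\<^sub>R V p) + s *\<^sub>R V (p + (real N * s) *\<^sub>R V p))"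
    by (auto simp: invariant algebra_simps)
  then have "displacement u (\<lambda>p. p + (real (Suc N) * s) *\<^sub>R V p)
      \<le> displacement u (\<lambda>p. p + s *\<^sub>R V p) + displacement u (\<lambda>p. p + (real N * s) *\<^sub>R V p)"
    using displacement_compose[OF preserving[of s] preserving[of "real N * s"] assms] by simp
  then show ?case using Suc by (simp add: distrib_right)
qed

text \<open>Cutting the time \<open>s\<close> into \<open>N\<close> steps bounds the displacement by \<open>N\<close> times that of one step. As \<open>N\<close> grows this bound
tends to the norm of \<open>s\<close> times the derivative.\<close>

lemma displacement_flow_le:
  assumes "\<phi> \<in> test_functions \<Omega>"
  shows "displacement \<phi> (\<lambda>p. p + s *\<^sub>R V p) \<le> \<bar>s\<bar> * norm (abs_l2 (along V \<phi>))"
proof -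
  have \<phi>[measurable]: "\<phi> \<in> borel_measurable borel" "along V \<phi> \<in> borel_measurable borel"
    using assms test_function_along[OF affine assms] by (auto intro!: smooth_borel_measurable test_function_smooth)
  have m[measurable]: "(\<lambda>p. \<phi> (p + s *\<^sub>R V p)) \<in> borel_measurable borel" for s by (rule borel_flow) measurable
  have sq: "sq_integrable \<phi>" "sq_integrable (along V \<phi>)"
    using assms by (auto intro: test_function_sq_integrable test_function_along affine)
  let ?q = "\<lambda>N p. real (Suc N) * (\<phi> (p + (s / real (Suc N)) *\<^sub>R V p) - \<phi> p)"
  obtain C a where dom: "\<And>N p. \<bar>?q N p\<bar> \<le> C * indicator (cbox (-a) a) p"
    using difference_quotient_dominated[OF assms, of s] by blast
  have "(\<lambda>N. \<integral>p. (?q N p)\<^sup>2 \<partial>lborel) \<longlonglongrightarrow> (\<integral>p. (s * along V \<phi> p)\<^sup>2 \<partial>lborel)"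
  proof (rule integral_dominated_convergence)
    show "integrable lborel (\<lambda>p. C\<^sup>2 * indicator (cbox (-a) a) p)"
      by (intro integrable_mult_right integrable_real_indicator) (auto simp: emeasure_lborel_cbox_eq)
    show "AE p in lborel. (\<lambda>N. (?q N p)\<^sup>2) \<longlonglongrightarrow> (s * along V \<phi> p)\<^sup>2"
      by (intro AE_I2 tendsto_power difference_quotient_tendsto test_function_smooth[OF assms])
    have "(?q N p)\<^sup>2 \<le> C\<^sup>2 * indicator (cbox (-a) a) p" for N p
      using power_mono[OF dom[of N p], of 2] by (cases "p \<in> cbox (-a) a") (auto simp: power_mult_distrib)
    then show "AE p in lborel. norm ((?q N p)\<^sup>2) \<le> C\<^sup>2 * indicator (cbox (-a) a) p" for N
      by simp
  qed measurable
  moreover have "(\<integral>p. (?q N p)\<^sup>2 \<partial>lborel) = (real (Suc N) * displacement \<phi> (\<lambda>p. p + (s / real (Suc N)) *\<^sub>R V p))\<^sup>2" for N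
  proof -
    have "(\<integral>p. (?q N p)\<^sup>2 \<partial>lborel) = (real (Suc N))\<^sup>2 * (\<integral>p. (\<phi> (p + (s / real (Suc N)) *\<^sub>R V p) - \<phi> p)\<^sup>2 \<partial>lebesgue)"
      by (simp add: power_mult_distrib integral_completion del: of_nat_Suc)
    also have "\<dots> = (real (Suc N))\<^sup>2 * (displacement \<phi> (\<lambda>p. p + (s / real (Suc N)) *\<^sub>R V p))\<^sup>2"
      unfolding displacement_def
      by (subst norm_abs_l2[OF displacement_sq_integrable[OF preserving \<phi>(1) sq(1)]]) simp
    finally show ?thesis by (simp add: power_mult_distrib del: of_nat_Suc)
  qed
  moreover have "(\<integral>p. (s * along V \<phi> p)\<^sup>2 \<partial>lborel) = (\<bar>s\<bar> * norm (abs_l2 (along V \<phi>)))\<^sup>2"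
    using sq(2) by (simp add: power_mult_distrib norm_abs_l2 integral_completion)
  ultimately have lim: "(\<lambda>N. (real (Suc N) * displacement \<phi> (\<lambda>p. p + (s / real (Suc N)) *\<^sub>R V p))\<^sup>2)
      \<longlonglongrightarrow> (\<bar>s\<bar> * norm (abs_l2 (along V \<phi>)))\<^sup>2"
    by simp
  have "displacement \<phi> (\<lambda>p. p + s *\<^sub>R V p) \<le> real (Suc N) * displacement \<phi> (\<lambda>p. p + (s / real (Suc N)) *\<^sub>R V p)" for N
    using displacement_flow_multiple[OF \<phi>(1) sq(1), of "Suc N" "s / real (Suc N)"] by (simp del: of_nat_Suc)
  then have "(displacement \<phi> (\<lambda>p. p + s *\<^sub>R V p))\<^sup>2 \<le> (\<bar>s\<bar> * norm (abs_l2 (along V \<phi>)))\<^sup>2"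
    by (intro LIMSEQ_le_const[OF lim] exI[of _ 0] allI impI power_mono) (auto simp: displacement_def)
  then show ?thesis by (rule power2_le_imp_le) simp
qed

end

section \<open>Horizontal flows and right translations of the Heisenberg group\<close>

text \<open>The sum type indexes the components of the horizontal gradient.\<close>

definition horizontal :: "'n::finite + 'n \<Rightarrow> 'n heisenberg \<Rightarrow> 'n heisenberg" where
  "horizontal j = (case j of Inl i \<Rightarrow> X_field i | Inr i \<Rightarrow> Y_field i)"

lemma horizontal_simps [simp]: "horizontal (Inl i) = X_field i" "horizontal (Inr i) = Y_field i"
  by (auto simp: horizontal_def)

lemma X_flow: "(x, y, t) + s *\<^sub>R X_field i (x, y, t) = (x + s *\<^sub>R axis i 1, y, t + s * y $ i / 2)"
  by (simp add: X_field_def)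

lemma Y_flow: "(x, y, t) + s *\<^sub>R Y_field i (x, y, t) = (x, y + s *\<^sub>R axis i 1, t - s * x $ i / 2)"
  by (simp add: Y_field_def)

lemma volume_preserving_shear_translation:
  fixes g :: "'a::euclidean_space \<times> 'b::euclidean_space \<Rightarrow> real"
  assumes "continuous_on UNIV g"
  shows "volume_preserving (\<lambda>(x, y, t). (x + a, y + b, t + g (x, y) + c))"
proof -
  have "volume_preserving (\<lambda>p. (case p of (x, y, t) \<Rightarrow> (x, y, t + g (x, y))) + (a, b, c))"
    by (rule volume_preserving_compose[OF volume_preserving_translation volume_preserving_vertical_shear])
      (rule borel_measurable_continuous_onI[OF assms])
  moreover have "(\<lambda>p. (case p of (x, y, t) \<Rightarrow> (x, y, t + g (x, y))) + (a, b, c))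
      = (\<lambda>(x, y, t). (x + a, y + b, t + g (x, y) + c))"
    by auto
  ultimately show ?thesis by (simp only:)
qed

lemma shear_flow_X: "shear_flow (X_field i)"
proof
  let ?L = "\<lambda>p :: 'a heisenberg. (0, 0, fst (snd p) $ i / 2) :: 'a heisenberg"
  have "linear ?L" by (auto intro!: linearI simp: add_divide_distrib)
  then have "bounded_linear ?L" by (simp add: linear_conv_bounded_linear)
  moreover have "X_field i = (\<lambda>p. (axis i 1, 0, 0) + ?L p)" by (auto simp: X_field_def)
  ultimately show "affine_field (X_field i)" unfolding affine_field_def by blast
  show "X_field i (p + s *\<^sub>R X_field i p) = X_field i p" for p s
    by (cases p) (simp add: X_flow, simp add: X_field_def)
  show "volume_preserving (\<lambda>p. p + s *\<^sub>R X_field i p)" for s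
  proof -
    have "volume_preserving (\<lambda>(x, y, t). (x + s *\<^sub>R axis i 1, y + 0, t + (\<lambda>(x :: real ^ 'a, y :: real ^ 'a). s * y $ i / 2) (x, y) + 0))"
      by (rule volume_preserving_shear_translation) (auto simp: case_prod_beta intro!: continuous_intros)
    moreover have "(\<lambda>(x, y, t). (x + s *\<^sub>R axis i 1, y + 0, t + (\<lambda>(x :: real ^ 'a, y :: real ^ 'a). s * y $ i / 2) (x, y) + 0))
        = (\<lambda>p. p + s *\<^sub>R X_field i p)"
      by (auto simp: X_flow)
    ultimately show ?thesis by (simp only:)
  qed
qed

lemma shear_flow_Y: "shear_flow (Y_field i)"
proof
  let ?L = "\<lambda>p :: 'a heisenberg. (0, 0, - (fst p $ i / 2)) :: 'a heisenberg"
  have "linear ?L" by (auto intro!: linearI simp: add_divide_distrib)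
  then have "bounded_linear ?L" by (simp add: linear_conv_bounded_linear)
  moreover have "Y_field i = (\<lambda>p. (0, axis i 1, 0) + ?L p)" by (auto simp: Y_field_def)
  ultimately show "affine_field (Y_field i)" unfolding affine_field_def by blast
  show "Y_field i (p + s *\<^sub>R Y_field i p) = Y_field i p" for p s
    by (cases p) (simp add: Y_flow, simp add: Y_field_def)
  show "volume_preserving (\<lambda>p. p + s *\<^sub>R Y_field i p)" for s
  proof -
    have "volume_preserving (\<lambda>(x, y, t). (x + 0, y + s *\<^sub>R axis i 1, t + (\<lambda>(x :: real ^ 'a, y :: real ^ 'a). - (s * x $ i / 2)) (x, y) + 0))"
      by (rule volume_preserving_shear_translation) (auto simp: case_prod_beta intro!: continuous_intros)
    moreover have "(\<lambda>(x, y, t). (x + 0, y + s *\<^sub>R axis i 1, t + (\<lambda>(x :: real ^ 'a, y :: real ^ 'a). - (s * x $ i / 2)) (x, y) + 0))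
        = (\<lambda>p. p + s *\<^sub>R Y_field i p)"
      by (auto simp: Y_flow)
    ultimately show ?thesis by (simp only:)
  qed
qed

lemma shear_flow_horizontal: "shear_flow (horizontal j)"
  by (cases j) (auto simp: shear_flow_X shear_flow_Y)

lemma affine_horizontal: "affine_field (horizontal j)"
  using shear_flow_horizontal by (rule shear_flow.affine)

text \<open>Multiplication by \<open>(a, b, c)\<close> from the right for the group law that makes \<open>X\<^sub>i\<close> and \<open>Y\<^sub>i\<close> left
invariant; the flows of these fields are right translations.\<close>

definition right_translate :: "'n::finite heisenberg \<Rightarrow> 'n heisenberg \<Rightarrow> 'n heisenberg" where
  "right_translate = (\<lambda>(a, b, c) (x, y, t). (x + a, y + b, t + (inner a y - inner b x) / 2 + c))"

text \<open>The two facts needed to estimate a composition, kept together.\<close>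

definition moves :: "('a::euclidean_space \<Rightarrow> real) \<Rightarrow> ('a \<Rightarrow> 'a) \<Rightarrow> real \<Rightarrow> bool" where
  "moves u \<tau> d \<longleftrightarrow> volume_preserving \<tau> \<and> displacement u \<tau> \<le> d"

lemma moves_compose:
  assumes "moves u \<sigma> d" "moves u \<tau> e" "u \<in> borel_measurable borel" "sq_integrable u"
    "\<And>p. \<rho> p = \<sigma> (\<tau> p)"
  shows "moves u \<rho> (d + e)"
proof -
  have "\<rho> = (\<lambda>p. \<sigma> (\<tau> p))" using assms(5) by auto
  then show ?thesis
    using assms(1,2) displacement_compose[OF _ _ assms(3,4), of \<sigma> \<tau>]
    by (auto simp: moves_def intro: volume_preserving_compose)
qed

context
  fixes \<phi> :: "'n::finite heisenberg \<Rightarrow> real" and \<Omega> :: "'n heisenberg set" and M :: real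
  assumes \<phi>: "\<phi> \<in> test_functions \<Omega>"
    and M: "\<And>j. norm (abs_l2 (along (horizontal j) \<phi>)) \<le> M"
begin

lemma phi_borel: "\<phi> \<in> borel_measurable borel"
  by (rule smooth_borel_measurable[OF test_function_smooth[OF \<phi>]])

lemma phi_sq: "sq_integrable \<phi>"
  by (rule test_function_sq_integrable[OF \<phi>])

lemma M_nonneg: "0 \<le> M"
  using M order_trans[OF norm_ge_zero] by blast

lemma moves_horizontal: "moves \<phi> (\<lambda>p. p + s *\<^sub>R horizontal j p) (\<bar>s\<bar> * M)"
  unfolding moves_def
  using shear_flow.preserving[OF shear_flow_horizontal, of s j]
    shear_flow.displacement_flow_le[OF shear_flow_horizontal \<phi>, of s j]
    mult_left_mono[OF M[of j], of "\<bar>s\<bar>"] by auto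

lemma moves_X: "moves \<phi> (\<lambda>(x, y, t). (x + s *\<^sub>R axis i 1, y, t + s * y $ i / 2)) (\<bar>s\<bar> * M)"
proof -
  have "(\<lambda>(x, y, t). (x + s *\<^sub>R axis i 1, y, t + s * y $ i / 2)) = (\<lambda>p. p + s *\<^sub>R horizontal (Inl i) p)"
    by (auto simp: X_flow)
  then show ?thesis using moves_horizontal[of s "Inl i"] by simp
qed

lemma moves_Y: "moves \<phi> (\<lambda>(x, y, t). (x, y + s *\<^sub>R axis i 1, t - s * x $ i / 2)) (\<bar>s\<bar> * M)"
proof -
  have "(\<lambda>(x, y, t). (x, y + s *\<^sub>R axis i 1, t - s * x $ i / 2)) = (\<lambda>p. p + s *\<^sub>R horizontal (Inr i) p)"
    by (auto simp: Y_flow)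
  then show ?thesis using moves_horizontal[of s "Inr i"] by simp
qed

lemma moves_X_combined:
  "finite S \<Longrightarrow> moves \<phi> (\<lambda>(x, y, t). (x + (\<Sum>i\<in>S. a $ i *\<^sub>R axis i 1), y, t + (\<Sum>i\<in>S. a $ i * y $ i) / 2)) ((\<Sum>i\<in>S. \<bar>a $ i\<bar>) * M)"
proof (induction S rule: finite_induct)
  case empty
  have "(\<lambda>(x, y, t). (x + (\<Sum>i\<in>{}. a $ i *\<^sub>R axis i 1), y, t + (\<Sum>i\<in>{}. a $ i * y $ i) / 2)) = (\<lambda>p::'n heisenberg. p)"
    by auto
  moreover have "volume_preserving (\<lambda>p::'n heisenberg. p)"
    using volume_preserving_translation[of 0] by simp
  ultimately show ?case by (simp add: moves_def displacement_id[folded id_def])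
next
  case (insert i S)
  have eq: "(\<Sum>j\<in>insert i S. \<bar>a $ j\<bar>) * M = \<bar>a $ i\<bar> * M + (\<Sum>j\<in>S. \<bar>a $ j\<bar>) * M"
    using insert by (simp add: distrib_right)
  show ?case unfolding eq
    by (rule moves_compose[OF moves_X[of "a $ i" i] insert.IH phi_borel phi_sq])
      (use insert in \<open>auto simp: add_divide_distrib algebra_simps\<close>)
qed

lemma moves_Y_combined:
  "finite S \<Longrightarrow> moves \<phi> (\<lambda>(x, y, t). (x, y + (\<Sum>i\<in>S. b $ i *\<^sub>R axis i 1), t - (\<Sum>i\<in>S. b $ i * x $ i) / 2)) ((\<Sum>i\<in>S. \<bar>b $ i\<bar>) * M)"
proof (induction S rule: finite_induct)
  case empty
  have "(\<lambda>(x, y, t). (x, y + (\<Sum>i\<in>{}. b $ i *\<^sub>R axis i 1), t - (\<Sum>i\<in>{}. b $ i * x $ i) / 2)) = (\<lambda>p::'n heisenberg. p)"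
    by auto
  moreover have "volume_preserving (\<lambda>p::'n heisenberg. p)"
    using volume_preserving_translation[of 0] by simp
  ultimately show ?case by (simp add: moves_def displacement_id[folded id_def])
next
  case (insert i S)
  have eq: "(\<Sum>j\<in>insert i S. \<bar>b $ j\<bar>) * M = \<bar>b $ i\<bar> * M + (\<Sum>j\<in>S. \<bar>b $ j\<bar>) * M"
    using insert by (simp add: distrib_right)
  show ?case unfolding eq
    by (rule moves_compose[OF moves_Y[of "b $ i" i] insert.IH phi_borel phi_sq])
      (use insert in \<open>auto simp: add_divide_distrib algebra_simps\<close>)
qed

lemma sum_axis: "(\<Sum>i\<in>UNIV. a $ i *\<^sub>R axis i 1) = (a :: real ^ 'n)"
  by (simp add: vec_eq_iff axis_def sum_component if_distrib cong: if_cong)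

text \<open>The direction \<open>t\<close> is reached by a commutator: following the flows of \<open>X\<^sub>i\<close> and \<open>Y\<^sub>i\<close> for the times \<open>s\<close>, \<open>s\<close>,
\<open>- s\<close> and \<open>- s\<close> is a vertical translation by \<open>s\<^sup>2\<close> or \<open>- s\<^sup>2\<close>, depending on which flow comes first. This
explains the square root.\<close>

lemma moves_vertical: "moves \<phi> (\<lambda>(x, y, t). (x, y, t + c)) (4 * sqrt \<bar>c\<bar> * M)"
proof -
  \<comment> \<open>any direction will do\<close>
  fix i :: 'n
  define s where "s = sqrt \<bar>c\<bar>"
  have s: "s * s = \<bar>c\<bar>" "\<bar>s\<bar> = s" by (auto simp: s_def)
  let ?X = "\<lambda>s (x :: real ^ 'n, y :: real ^ 'n, t). (x + s *\<^sub>R axis i 1, y, t + s * y $ i / 2)"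
  let ?Y = "\<lambda>s (x :: real ^ 'n, y :: real ^ 'n, t). (x, y + s *\<^sub>R axis i 1, t - s * x $ i / 2)"
  note compose = moves_compose[OF _ _ phi_borel phi_sq]
  have "moves \<phi> (\<lambda>(x, y, t). (x, y, t + c)) ((\<bar>s\<bar> * M + \<bar>s\<bar> * M) + (\<bar>s\<bar> * M + \<bar>s\<bar> * M))"
  proof (cases "c \<ge> 0")
    case True
    have 1: "moves \<phi> (\<lambda>p. ?X s (?Y s p)) (\<bar>s\<bar> * M + \<bar>s\<bar> * M)"
      by (rule compose[OF moves_X moves_Y]) simp
    have 2: "moves \<phi> (\<lambda>p. ?X (-s) (?Y (-s) p)) (\<bar>s\<bar> * M + \<bar>s\<bar> * M)"
      using compose[OF moves_X[of "-s" i] moves_Y[of "-s" i]] by simp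
    show ?thesis
      by (rule compose[OF 2 1]) (use True s in \<open>auto simp: axis_def field_simps\<close>)
  next
    case False
    have 1: "moves \<phi> (\<lambda>p. ?Y s (?X s p)) (\<bar>s\<bar> * M + \<bar>s\<bar> * M)"
      by (rule compose[OF moves_Y moves_X]) simp
    have 2: "moves \<phi> (\<lambda>p. ?Y (-s) (?X (-s) p)) (\<bar>s\<bar> * M + \<bar>s\<bar> * M)"
      using compose[OF moves_Y[of "-s" i] moves_X[of "-s" i]] by simp
    show ?thesis
      by (rule compose[OF 2 1]) (use False s in \<open>auto simp: axis_def field_simps\<close>)
  qed
  then show ?thesis using s(2) by (simp add: s_def mult.commute mult.left_commute)
qed

text \<open>A right translation is a motion along the \<open>X\<^sub>i\<close>, then along the \<open>Y\<^sub>i\<close>, then vertically. The vertical part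
also corrects the term \<open>inner a b / 2\<close>, since the fields do not commute.\<close>

lemma moves_right_translate:
  "moves \<phi> (right_translate (a, b, c))
     (4 * sqrt \<bar>c + inner a b / 2\<bar> * M + ((\<Sum>i\<in>UNIV. \<bar>b $ i\<bar>) * M + (\<Sum>i\<in>UNIV. \<bar>a $ i\<bar>) * M))"
proof -
  note compose = moves_compose[OF _ _ phi_borel phi_sq]
  have 1: "moves \<phi> (\<lambda>(x, y, t). (x + a, y, t + inner a y / 2)) ((\<Sum>i\<in>UNIV. \<bar>a $ i\<bar>) * M)"
    using moves_X_combined[of UNIV a] by (simp add: sum_axis inner_vec_def)
  have 2: "moves \<phi> (\<lambda>(x, y, t). (x, y + b, t - inner b x / 2)) ((\<Sum>i\<in>UNIV. \<bar>b $ i\<bar>) * M)"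
    using moves_Y_combined[of UNIV b] by (simp add: sum_axis inner_vec_def)
  have 3: "moves \<phi> (\<lambda>(x, y, t). (x + a, y + b, t + inner a y / 2 - inner b (x + a) / 2)) ((\<Sum>i\<in>UNIV. \<bar>b $ i\<bar>) * M + (\<Sum>i\<in>UNIV. \<bar>a $ i\<bar>) * M)"
    by (rule compose[OF 2 1]) auto
  show ?thesis
    by (rule compose[OF moves_vertical 3])
      (auto simp: right_translate_def inner_add_right inner_commute[of b a] field_simps)
qed

lemma displacement_right_translate_small:
  assumes h: "0 \<le> h" and a: "\<And>i. \<bar>a $ i\<bar> \<le> h" and b: "\<And>i. \<bar>b $ i\<bar> \<le> h" and c: "\<bar>c\<bar> \<le> h * \<kappa>"
  shows "displacement \<phi> (right_translate (a, b, c))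
      \<le> M * (4 * sqrt (h * \<kappa> + real CARD('n) * h\<^sup>2 / 2) + 2 * real CARD('n) * h)"
proof -
  have "\<bar>inner a b\<bar> \<le> (\<Sum>i\<in>(UNIV :: 'n set). h * h)"
    unfolding inner_vec_def
    by (rule order_trans[OF sum_abs]) (intro sum_mono, simp add: abs_mult mult_mono a b h)
  then have "\<bar>c + inner a b / 2\<bar> \<le> h * \<kappa> + real CARD('n) * h\<^sup>2 / 2"
    using c by (simp add: power2_eq_square)
  then have "sqrt \<bar>c + inner a b / 2\<bar> \<le> sqrt (h * \<kappa> + real CARD('n) * h\<^sup>2 / 2)"
    by (rule real_sqrt_le_mono)
  then have "4 * sqrt \<bar>c + inner a b / 2\<bar> * M \<le> 4 * sqrt (h * \<kappa> + real CARD('n) * h\<^sup>2 / 2) * M"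
    using M_nonneg by (intro mult_right_mono) auto
  moreover have "(\<Sum>i\<in>UNIV. \<bar>a $ i\<bar>) * M \<le> real CARD('n) * h * M" "(\<Sum>i\<in>UNIV. \<bar>b $ i\<bar>) * M \<le> real CARD('n) * h * M"
    using sum_bounded_above[of UNIV "\<lambda>i. \<bar>a $ i\<bar>" h] sum_bounded_above[of UNIV "\<lambda>i. \<bar>b $ i\<bar>" h] a b M_nonneg
    by (auto intro!: mult_right_mono)
  ultimately show ?thesis
    using moves_right_translate[of a b c] by (simp add: moves_def algebra_simps)
qed

end

text \<open>With \<open>p\<close> fixed this is left translation by \<open>p\<close>. It serves to replace a second point by its difference
from \<open>p\<close> in the group.\<close>

lemma volume_preserving_right_translate_swap: "volume_preserving (\<lambda>z. right_translate z p)"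
proof -
  obtain x y t where p: "p = (x, y, t)" by (cases p)
  have "volume_preserving (\<lambda>(a, b, c). (a + x, b + y, c + (\<lambda>(a, b). (inner a y - inner b x) / 2) (a, b) + t))"
    by (rule volume_preserving_shear_translation) (auto simp: case_prod_beta intro!: continuous_intros)
  moreover have "(\<lambda>(a, b, c). (a + x, b + y, c + (\<lambda>(a, b). (inner a y - inner b x) / 2) (a, b) + t)) = (\<lambda>z. right_translate z p)"
    by (auto simp: right_translate_def p)
  ultimately show ?thesis by (simp only:)
qed

lemma continuous_right_translate: "continuous_on UNIV (\<lambda>(q, z). right_translate z q)"
  unfolding right_translate_def case_prod_beta by (auto intro!: continuous_intros)

section \<open>Approximation by step functions on a grid\<close>

lemma exists_point_below_average:
  fixes F :: "'a::euclidean_space \<Rightarrow> ennreal"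
  assumes F[measurable]: "F \<in> borel_measurable borel" and Q[measurable]: "Q \<in> sets borel"
    and pos: "emeasure lborel Q \<noteq> 0" and fin: "emeasure lborel Q \<noteq> \<infinity>"
  shows "\<exists>q\<in>Q. F q * emeasure lborel Q \<le> (\<integral>\<^sup>+q. indicator Q q * F q \<partial>lborel)"
proof (rule ccontr)
  let ?I = "\<integral>\<^sup>+q. indicator Q q * F q \<partial>lborel"
  assume "\<not> ?thesis"
  then have gt: "?I < F q * emeasure lborel Q" if "q \<in> Q" for q using that by (auto simp: not_le)
  have "Q \<noteq> {}" using pos by auto
  then obtain q0 where "q0 \<in> Q" by blast
  then have I: "?I \<noteq> \<infinity>" using gt[of q0] by auto
  \<comment> \<open>the average of \<open>F\<close> over \<open>Q\<close>\<close>
  define A where "A = ?I / emeasure lborel Q"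
  have A: "A * emeasure lborel Q = ?I"
    unfolding A_def using pos fin by (simp add: ennreal_divide_times less_top)
  have AF: "A < F q" if "q \<in> Q" for q
  proof (rule ccontr)
    assume "\<not> A < F q"
    then have "F q * emeasure lborel Q \<le> A * emeasure lborel Q" by (intro mult_right_mono) auto
    then show False using gt[OF that] A by simp
  qed
  have int: "(\<integral>\<^sup>+q. A * indicator Q q \<partial>lborel) = ?I"
    by (simp add: nn_integral_cmult A)
  have "(\<integral>\<^sup>+q. A * indicator Q q \<partial>lborel) < ?I"
  proof (rule nn_integral_less)
    show "AE q in lborel. A * indicator Q q \<le> indicator Q q * F q"
      using AF by (auto simp: indicator_def intro!: AE_I2 less_imp_le)
    show "\<not> (AE q in lborel. indicator Q q * F q \<le> A * indicator Q q)"
    proof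
      assume "AE q in lborel. indicator Q q * F q \<le> A * indicator Q q"
      then have "AE q in lborel. q \<notin> Q"
        by eventually_elim (use AF in \<open>auto simp: indicator_def not_less[symmetric] split: if_splits\<close>)
      then have "emeasure lborel Q = 0"
        using AE_iff_measurable[of Q lborel "\<lambda>q. q \<notin> Q"] by simp
      then show False using pos by simp
    qed
    show "(\<integral>\<^sup>+q. A * indicator Q q \<partial>lborel) \<noteq> \<infinity>" using int I by simp
  qed measurable
  then show False using int by simp
qed

text \<open>The half-open cubes of side length \<open>h\<close>, numbered by their corners divided by \<open>h\<close>.\<close>

definition cell :: "real \<Rightarrow> ('a::euclidean_space \<Rightarrow> int) \<Rightarrow> 'a set" where
  "cell h k = {p. \<forall>b\<in>Basis. \<lfloor>(p \<bullet> b) / h\<rfloor> = k b}"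

text \<open>The restriction to \<open>Basis\<close> makes the index of a cell unique and the indices that occur in a bounded set
finite in number.\<close>

definition cell_index :: "real \<Rightarrow> 'a::euclidean_space \<Rightarrow> 'a \<Rightarrow> int" where
  "cell_index h p = restrict (\<lambda>b. \<lfloor>(p \<bullet> b) / h\<rfloor>) Basis"

lemma cell_index_eq: "p \<in> cell h (cell_index h q) \<longleftrightarrow> cell_index h p = cell_index h q"
  by (auto simp: cell_def cell_index_def restrict_def fun_eq_iff)

lemma borel_cell [measurable]: "cell h k \<in> sets borel"
proof -
  have "cell h k = (\<Inter>b\<in>Basis. {p \<in> space borel. real_of_int (k b) \<le> (p \<bullet> b) / h \<and> (p \<bullet> b) / h < real_of_int (k b) + 1})"
    by (auto simp: cell_def floor_eq_iff)
  also have "\<dots> \<in> sets borel"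
    by (intro sets.finite_INT finite_Basis nonempty_Basis) measurable
  finally show ?thesis .
qed

definition corner :: "real \<Rightarrow> ('a::euclidean_space \<Rightarrow> int) \<Rightarrow> 'a" where
  "corner h k = (\<Sum>b\<in>Basis. (h * real_of_int (k b)) *\<^sub>R b)"

lemma inner_corner [simp]: "b \<in> Basis \<Longrightarrow> corner h k \<bullet> b = h * real_of_int (k b)"
  by (simp add: corner_def)

lemma cell_bounds:
  assumes "h > 0"
  shows "cell h k \<subseteq> cbox (corner h k) (corner h (\<lambda>b. k b + 1))"
    and "box (corner h k) (corner h (\<lambda>b. k b + 1)) \<subseteq> cell h k"
  using assms by (auto simp: cell_def mem_box floor_eq_iff field_simps less_imp_le)

lemma emeasure_cell:
  fixes k :: "'a::euclidean_space \<Rightarrow> int"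
  assumes "h > 0"
  shows "ennreal (h ^ DIM('a)) \<le> emeasure lborel (cell h k)" "emeasure lborel (cell h k) < \<infinity>"
proof -
  have "emeasure lborel (box (corner h k) (corner h (\<lambda>b. k b + 1))) = ennreal (\<Prod>b\<in>(Basis :: 'a set). h)"
    using assms by (subst emeasure_lborel_box)
      (auto simp: inner_diff_left distrib_left intro!: prod.cong arg_cong[where f = ennreal])
  then show "ennreal (h ^ DIM('a)) \<le> emeasure lborel (cell h k)"
    using emeasure_mono[OF cell_bounds(2)[OF assms, of k], of lborel] by simp
  show "emeasure lborel (cell h k) < \<infinity>"
    by (rule emeasure_bounded_finite) (rule bounded_subset[OF bounded_cbox cell_bounds(1)[OF assms]])
qed

lemma finite_cell_index:
  fixes \<Omega> :: "'a::euclidean_space set"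
  assumes "bounded \<Omega>"
  shows "finite (cell_index h ` \<Omega>)"
proof -
  obtain R where R: "\<And>p. p \<in> \<Omega> \<Longrightarrow> norm p \<le> R" using assms by (auto simp: bounded_iff)
  define N where "N = \<lceil>R / \<bar>h\<bar>\<rceil> + 1"
  have "cell_index h ` \<Omega> \<subseteq> PiE Basis (\<lambda>_. {- N..N})"
  proof (rule image_subsetI)
    fix p assume p: "p \<in> \<Omega>"
    have "\<lfloor>(p \<bullet> b) / h\<rfloor> \<in> {- N..N}" if "b \<in> Basis" for b
    proof -
      have "\<bar>p \<bullet> b\<bar> \<le> R" using Basis_le_norm[OF that, of p] R[OF p] by simp
      then have "\<bar>(p \<bullet> b) / h\<bar> \<le> R / \<bar>h\<bar>" by (simp add: abs_div divide_right_mono)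
      then have "- N \<le> \<lfloor>(p \<bullet> b) / h\<rfloor>" "\<lfloor>(p \<bullet> b) / h\<rfloor> \<le> N" unfolding N_def abs_le_iff by linarith+
      then show ?thesis by simp
    qed
    then show "cell_index h p \<in> PiE Basis (\<lambda>_. {- N..N})"
      unfolding cell_index_def by (intro restrict_PiE_iff[THEN iffD2]) auto
  qed
  then show ?thesis by (rule finite_subset) (intro finite_PiE finite_Basis, auto)
qed

text \<open>The value on a cell is that of \<open>u\<close> at a point \<open>q k\<close> of it, chosen so that the squared distance of \<open>u\<close> to this
constant is at most its average over all choices of the point. Multiplied by the volume of the cell, these
averages add up to the right-hand side.\<close>

lemma step_approximation:
  fixes \<Omega> :: "'a::euclidean_space set" and u :: "'a \<Rightarrow> real"
  assumes h: "h > 0" and bdd: "bounded \<Omega>" and u[measurable]: "u \<in> borel_measurable borel"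
    and supp: "\<And>p. p \<notin> \<Omega> \<Longrightarrow> u p = 0"
  shows "\<exists>c. ennreal (h ^ DIM('a)) * (\<integral>\<^sup>+p. ennreal ((u p - (\<Sum>k\<in>cell_index h ` \<Omega>. c k * indicator (cell h k) p))\<^sup>2) \<partial>lborel)
     \<le> (\<integral>\<^sup>+q. \<integral>\<^sup>+p. (\<Sum>k\<in>cell_index h ` \<Omega>. indicator (cell h k) q * indicator (cell h k) p) * ennreal ((u p - u q)\<^sup>2) \<partial>lborel \<partial>lborel)"
proof -
  let ?K = "cell_index h ` \<Omega>"
  have fin: "finite ?K" by (rule finite_cell_index[OF bdd])
  define F where "F = (\<lambda>k q. \<integral>\<^sup>+p. indicator (cell h k) p * ennreal ((u p - u q)\<^sup>2) \<partial>lborel)"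
  have F[measurable]: "F k \<in> borel_measurable borel" for k unfolding F_def by measurable
  have "\<exists>q\<in>cell h k. F k q * emeasure lborel (cell h k) \<le> (\<integral>\<^sup>+q. indicator (cell h k) q * F k q \<partial>lborel)" for k
  proof (rule exists_point_below_average)
    have "0 < ennreal (h ^ DIM('a))" using h by simp
    then show "emeasure lborel (cell h k) \<noteq> 0" using less_le_trans[OF \<open>0 < ennreal _\<close> emeasure_cell(1)[OF h, of k]] by simp
    show "emeasure lborel (cell h k) \<noteq> \<infinity>" using emeasure_cell(2)[OF h, of k] by simp
  qed measurable
  then obtain q where q: "\<And>k. q k \<in> cell h k"
    "\<And>k. F k (q k) * emeasure lborel (cell h k) \<le> (\<integral>\<^sup>+q. indicator (cell h k) q * F k q \<partial>lborel)"
    by metis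
  define c where "c = (\<lambda>k. u (q k))"
  have pointwise: "ennreal ((u p - (\<Sum>k\<in>?K. c k * indicator (cell h k) p))\<^sup>2)
      = (\<Sum>k\<in>?K. indicator (cell h k) p * ennreal ((u p - u (q k))\<^sup>2))" for p
  proof -
    have ind: "p \<in> cell h k \<longleftrightarrow> k = cell_index h p" if k: "k \<in> ?K" for k
    proof -
      obtain r where "k = cell_index h r" using k by blast
      then show ?thesis by (simp only: cell_index_eq) (rule eq_commute)
    qed
    have 1: "(\<Sum>k\<in>?K. c k * indicator (cell h k) p) = (\<Sum>k\<in>?K. if k = cell_index h p then c k else 0)"
      by (intro sum.cong refl) (auto simp: ind indicator_def cell_index_eq)
    have 2: "(\<Sum>k\<in>?K. indicator (cell h k) p * ennreal ((u p - u (q k))\<^sup>2)) = (\<Sum>k\<in>?K. if k = cell_index h p then ennreal ((u p - c k)\<^sup>2) else 0)"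
      by (intro sum.cong refl) (auto simp: ind c_def indicator_def cell_index_eq)
    have 3: "u p = 0" if "cell_index h p \<notin> ?K" using that supp by auto
    show ?thesis unfolding 1 2 using fin 3 by (auto simp: sum.delta)
  qed
  have "ennreal (h ^ DIM('a)) * (\<integral>\<^sup>+p. ennreal ((u p - (\<Sum>k\<in>?K. c k * indicator (cell h k) p))\<^sup>2) \<partial>lborel)
      = (\<Sum>k\<in>?K. ennreal (h ^ DIM('a)) * F k (q k))"
    unfolding pointwise F_def by (subst nn_integral_sum) (auto simp: sum_distrib_left)
  also have "\<dots> \<le> (\<Sum>k\<in>?K. \<integral>\<^sup>+q. indicator (cell h k) q * F k q \<partial>lborel)"
  proof (rule sum_mono)
    fix k
    have "ennreal (h ^ DIM('a)) * F k (q k) \<le> emeasure lborel (cell h k) * F k (q k)"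
      by (intro mult_right_mono emeasure_cell(1) h) auto
    then show "ennreal (h ^ DIM('a)) * F k (q k) \<le> (\<integral>\<^sup>+q. indicator (cell h k) q * F k q \<partial>lborel)"
      using q(2)[of k] by (simp add: mult.commute)
  qed
  also have "\<dots> = (\<integral>\<^sup>+q. (\<Sum>k\<in>?K. indicator (cell h k) q * F k q) \<partial>lborel)"
    by (rule nn_integral_sum[symmetric]) measurable
  also have "\<dots> = (\<integral>\<^sup>+q. \<integral>\<^sup>+p. (\<Sum>k\<in>?K. indicator (cell h k) q * indicator (cell h k) p) * ennreal ((u p - u q)\<^sup>2) \<partial>lborel \<partial>lborel)"
  proof (rule nn_integral_cong)
    fix q
    have "(\<Sum>k\<in>?K. indicator (cell h k) q * F k q)
        = (\<Sum>k\<in>?K. \<integral>\<^sup>+p. indicator (cell h k) q * (indicator (cell h k) p * ennreal ((u p - u q)\<^sup>2)) \<partial>lborel)"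
      unfolding F_def by (intro sum.cong refl nn_integral_cmult[symmetric]) measurable
    also have "\<dots> = (\<integral>\<^sup>+p. (\<Sum>k\<in>?K. indicator (cell h k) q * (indicator (cell h k) p * ennreal ((u p - u q)\<^sup>2))) \<partial>lborel)"
      by (rule nn_integral_sum[symmetric]) measurable
    finally show "(\<Sum>k\<in>?K. indicator (cell h k) q * F k q)
        = (\<integral>\<^sup>+p. (\<Sum>k\<in>?K. indicator (cell h k) q * indicator (cell h k) p) * ennreal ((u p - u q)\<^sup>2) \<partial>lborel)"
      by (simp add: sum_distrib_right mult.assoc)
  qed
  finally show ?thesis by blast
qed

lemma compact_bounded_combinations:
  fixes e :: "'k \<Rightarrow> 'h::real_normed_vector"
  assumes "finite K"
  shows "compact {\<Sum>k\<in>K. c k *\<^sub>R e k | c. \<forall>k\<in>K. \<bar>c k\<bar> \<le> L k}"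
  using assms
proof (induction K rule: finite_induct)
  case (insert i K)
  let ?S = "{\<Sum>k\<in>K. c k *\<^sub>R e k | c. \<forall>k\<in>K. \<bar>c k\<bar> \<le> L k}" and ?T = "(\<lambda>r. r *\<^sub>R e i) ` {- L i..L i}"
  have "compact {x + y | x y. x \<in> ?T \<and> y \<in> ?S}"
    by (intro compact_sums insert.IH compact_continuous_image continuous_intros compact_Icc)
  also have "{x + y | x y. x \<in> ?T \<and> y \<in> ?S} = {\<Sum>k\<in>insert i K. c k *\<^sub>R e k | c. \<forall>k\<in>insert i K. \<bar>c k\<bar> \<le> L k}"
    (is "?A = ?B")
  proof (intro equalityI subsetI)
    fix z assume "z \<in> ?A"
    then obtain r c where z: "z = r *\<^sub>R e i + (\<Sum>k\<in>K. c k *\<^sub>R e k)" "\<bar>r\<bar> \<le> L i" "\<forall>k\<in>K. \<bar>c k\<bar> \<le> L k"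
      by (auto simp: abs_le_iff)
    have "(\<Sum>k\<in>K. (c(i := r)) k *\<^sub>R e k) = (\<Sum>k\<in>K. c k *\<^sub>R e k)"
      using insert.hyps by (intro sum.cong) auto
    then have "z = (\<Sum>k\<in>insert i K. (c(i := r)) k *\<^sub>R e k)" using insert.hyps z(1) by simp
    moreover have "\<forall>k\<in>insert i K. \<bar>(c(i := r)) k\<bar> \<le> L k" using z by auto
    ultimately show "z \<in> ?B" by blast
  next
    fix z assume "z \<in> ?B"
    then obtain c where c: "z = (\<Sum>k\<in>insert i K. c k *\<^sub>R e k)" "\<forall>k\<in>insert i K. \<bar>c k\<bar> \<le> L k" by blast
    then have "z = c i *\<^sub>R e i + (\<Sum>k\<in>K. c k *\<^sub>R e k)" "c i *\<^sub>R e i \<in> ?T" using insert.hyps by (auto simp: abs_le_iff)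
    moreover have "(\<Sum>k\<in>K. c k *\<^sub>R e k) \<in> ?S" using c(2) by blast
    ultimately show "z \<in> ?A" by blast
  qed
  finally show ?case .
qed simp

text \<open>The set is totally bounded since it stays close to compact sets.\<close>

lemma compact_closure_if_approximable:
  fixes S :: "'h::complete_space set"
  assumes approx: "\<And>e. e > 0 \<Longrightarrow> \<exists>C. compact C \<and> (\<forall>x\<in>S. \<exists>y\<in>C. dist x y < e)"
  shows "compact (closure S)"
  unfolding compact_eq_totally_bounded
proof (intro conjI allI impI)
  show "complete (closure S)" by (simp add: complete_eq_closed)
  fix e :: real assume e: "e > 0"
  then obtain C where C: "compact C" "\<And>x. x \<in> S \<Longrightarrow> \<exists>y\<in>C. dist x y < e / 3"
    using approx[of "e / 3"] by auto
  then obtain k where k: "finite k" "C \<subseteq> (\<Union>x\<in>k. ball x (e / 3))"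
    using e unfolding compact_eq_totally_bounded by (meson divide_pos_pos zero_less_numeral)
  have "closure S \<subseteq> (\<Union>x\<in>k. ball x e)"
  proof
    fix x assume "x \<in> closure S"
    then obtain s where s: "s \<in> S" "dist s x < e / 3"
      using e closure_approachable[of x S] by (meson divide_pos_pos zero_less_numeral)
    obtain y where y: "y \<in> C" "dist s y < e / 3" using C(2)[OF s(1)] by blast
    obtain z where z: "z \<in> k" "dist z y < e / 3" using k(2) y(1) by auto
    have "dist z x \<le> dist z y + dist s y + dist s x"
      using dist_triangle[of z x y] dist_triangle[of y x s] by (simp add: dist_commute)
    then have "dist z x < e" using s y z by simp
    then show "x \<in> (\<Union>x\<in>k. ball x e)" using z(1) by auto
  qed
  then show "\<exists>k. finite k \<and> closure S \<subseteq> (\<Union>x\<in>k. ball x e)" using k(1) by blast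
qed

section \<open>Compactness of the horizontal Sobolev embedding\<close>

lemma heisenberg_coordinates:
  "(axis i 1, 0, 0) \<in> (Basis :: 'n::finite heisenberg set)" "(0, axis i 1, 0) \<in> (Basis :: 'n heisenberg set)"
  "(0, 0, 1) \<in> (Basis :: 'n heisenberg set)"
  by (auto simp: Basis_prod_def axis_in_Basis_iff zero_prod_def image_iff)

lemma same_cell_close:
  assumes "h > 0" "cell_index h p = cell_index h q" "b \<in> Basis"
  shows "\<bar>p \<bullet> b - q \<bullet> b\<bar> \<le> h"
proof -
  have "\<lfloor>(p \<bullet> b) / h\<rfloor> = \<lfloor>(q \<bullet> b) / h\<rfloor>"
    using fun_cong[OF assms(2), of b] assms(3) by (simp add: cell_index_def)
  then have "\<bar>(p \<bullet> b) / h - (q \<bullet> b) / h\<bar> \<le> 1" by linarith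
  then have "\<bar>(p \<bullet> b - q \<bullet> b) / h\<bar> \<le> 1" by (simp add: diff_divide_distrib)
  then show ?thesis using assms(1) by (simp add: abs_div)
qed

text \<open>The corner of a box that contains the group elements connecting two points of one cell. Its side in
the direction \<open>t\<close> needs a factor \<open>\<kappa>\<close>, because the group law shears the grid.\<close>

definition steps_box :: "real \<Rightarrow> real \<Rightarrow> 'n::finite heisenberg" where
  "steps_box h \<kappa> = (\<chi> i. h, \<chi> i. h, h * \<kappa>)"

lemma mem_steps_box:
  "(a, b, c) \<in> cbox (- steps_box h \<kappa>) (steps_box h \<kappa>) \<longleftrightarrow>
     (\<forall>i. \<bar>a $ i\<bar> \<le> h) \<and> (\<forall>i. \<bar>b $ i\<bar> \<le> h) \<and> \<bar>c\<bar> \<le> h * \<kappa>"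
  by (simp add: steps_box_def cbox_Pair_eq mem_box_cart abs_le_iff minus_le_iff) (auto simp: minus_le_iff)

text \<open>The volume of the box is a fixed multiple of the volume of a cell.\<close>

lemma emeasure_steps_box:
  assumes "h \<ge> 0" "\<kappa> \<ge> 0"
  shows "emeasure lborel (cbox (- steps_box h \<kappa>) (steps_box h \<kappa> :: 'n::finite heisenberg))
    = ennreal (h ^ DIM('n heisenberg) * (\<Prod>b\<in>Basis. 2 * ((steps_box 1 \<kappa> :: 'n heisenberg) \<bullet> b)))"
proof -
  let ?w = "steps_box h \<kappa> :: 'n heisenberg" and ?w1 = "steps_box 1 \<kappa> :: 'n heisenberg"
  have w: "?w = h *\<^sub>R ?w1" by (simp add: steps_box_def vec_eq_iff)
  have pos: "0 \<le> ?w1 \<bullet> b" if "b \<in> Basis" for b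
    using that assms by (auto simp: steps_box_def Basis_prod_def Basis_vec_def inner_axis)
  have "emeasure lborel (cbox (- ?w) ?w) = ennreal (\<Prod>b\<in>Basis. (?w - (- ?w)) \<bullet> b)"
    using pos assms by (intro emeasure_lborel_cbox) (auto simp: w)
  also have "(\<Prod>b\<in>Basis. (?w - (- ?w)) \<bullet> b) = (\<Prod>b\<in>Basis. h * (2 * (?w1 \<bullet> b)))"
    by (intro prod.cong refl) (simp add: w inner_add_left)
  also have "\<dots> = h ^ DIM('n heisenberg) * (\<Prod>b\<in>Basis. 2 * (?w1 \<bullet> b))"
    by (simp only: prod.distrib prod_constant)
  finally show ?thesis .
qed

lemma abs_l2_lincomb:
  assumes "finite J" "\<And>k. sq_integrable (f k)"
  shows "sq_integrable (\<lambda>p. \<Sum>k\<in>J. c k * f k p)"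
    and "abs_l2 (\<lambda>p. \<Sum>k\<in>J. c k * f k p) = (\<Sum>k\<in>J. c k *\<^sub>R abs_l2 (f k))"
proof -
  have "sq_integrable (\<lambda>p. \<Sum>k\<in>J. c k * f k p) \<and>
      abs_l2 (\<lambda>p. \<Sum>k\<in>J. c k * f k p) = (\<Sum>k\<in>J. c k *\<^sub>R abs_l2 (f k))"
    using assms(1)
  proof (induction J rule: finite_induct)
    case empty
    show ?case by (simp add: abs_l2_zero sq_integrable_zero)
  next
    case (insert k J)
    let ?S = "\<lambda>p. \<Sum>k\<in>J. c k * f k p"
    have S: "sq_integrable ?S" "abs_l2 ?S = (\<Sum>k\<in>J. c k *\<^sub>R abs_l2 (f k))" using insert.IH by auto
    have "abs_l2 (\<lambda>p. c k * f k p + ?S p) = c k *\<^sub>R abs_l2 (f k) + abs_l2 ?S"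
      unfolding abs_l2_scale[OF assms(2)] by (rule abs_l2_add[OF sq_integrable_scale[OF assms(2)] S(1), symmetric])
    moreover have "sq_integrable (\<lambda>p. c k * f k p + ?S p)"
      by (rule sq_integrable_add[OF sq_integrable_scale[OF assms(2)] S(1)])
    ultimately show ?case using insert.hyps S(2) by simp
  qed
  then show "sq_integrable (\<lambda>p. \<Sum>k\<in>J. c k * f k p)"
    "abs_l2 (\<lambda>p. \<Sum>k\<in>J. c k * f k p) = (\<Sum>k\<in>J. c k *\<^sub>R abs_l2 (f k))" by auto
qed

text \<open>Bounds the displacement caused by an element of the box with corner \<open>steps_box h \<kappa>\<close>, if all components of the
horizontal gradient have norm at most 1. Only its convergence to zero with \<open>h\<close> matters.\<close>

definition modulus :: "'n::finite itself \<Rightarrow> real \<Rightarrow> real \<Rightarrow> real" where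
  "modulus _ \<kappa> h = 4 * sqrt (h * \<kappa> + real CARD('n) * h\<^sup>2 / 2) + 2 * real CARD('n) * h"

lemma modulus_tendsto_0: "(modulus TYPE('n::finite) \<kappa> \<longlongrightarrow> 0) (at_right 0)"
proof -
  have "((\<lambda>h. 4 * sqrt (h * \<kappa> + real CARD('n) * h\<^sup>2 / 2) + 2 * real CARD('n) * h) \<longlongrightarrow>
     4 * sqrt (0 * \<kappa> + real CARD('n) * 0\<^sup>2 / 2) + 2 * real CARD('n) * 0) (at_right 0)"
    by (intro tendsto_intros) auto
  then show ?thesis by (simp add: modulus_def[abs_def])
qed

text \<open>Here \<open>q\<close> lies in a cell that meets \<open>\<Omega>\<close>, so its coordinates are at most \<open>R + h \<le> R + 1\<close>. They enter through the
term \<open>(inner a y - inner b x) / 2\<close> of the group law.\<close>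

lemma step_in_box:
  fixes \<Omega> :: "'n::finite heisenberg set"
  assumes h: "0 < h" "h \<le> 1" and R: "\<And>r b. r \<in> \<Omega> \<Longrightarrow> b \<in> Basis \<Longrightarrow> \<bar>r \<bullet> b\<bar> \<le> R" 
    and r: "r \<in> \<Omega>" "cell_index h q = cell_index h r" and eq: "cell_index h (right_translate z q) = cell_index h q"
  shows "z \<in> cbox (- steps_box h (1 + real CARD('n) * (R + 1))) (steps_box h (1 + real CARD('n) * (R + 1)))"
proof -
  obtain a b c where z: "z = (a, b, c)" by (cases z)
  obtain x y t where q: "q = (x, y, t)" by (cases q)
  note close = same_cell_close[OF h(1) eq]
  have a: "\<bar>a $ i\<bar> \<le> h" for i
    using close[OF heisenberg_coordinates(1)[of i]] by (simp add: z q right_translate_def inner_axis)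
  have b: "\<bar>b $ i\<bar> \<le> h" for i
    using close[OF heisenberg_coordinates(2)[of i]] by (simp add: z q right_translate_def inner_axis)
  have t: "\<bar>(inner a y - inner b x) / 2 + c\<bar> \<le> h"
    using close[OF heisenberg_coordinates(3)] by (simp add: z q right_translate_def)
  have qb: "\<bar>q \<bullet> e\<bar> \<le> R + 1" if "e \<in> Basis" for e
    using same_cell_close[OF h(1) r(2) that] R[OF r(1) that] h(2) by linarith
  have x: "\<bar>x $ i\<bar> \<le> R + 1" for i
    using qb[OF heisenberg_coordinates(1)[of i]] by (simp add: q inner_axis)
  have y: "\<bar>y $ i\<bar> \<le> R + 1" for i
    using qb[OF heisenberg_coordinates(2)[of i]] by (simp add: q inner_axis)
  have prod: "\<bar>inner v w\<bar> \<le> real CARD('n) * (h * (R + 1))"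
    if "\<And>i. \<bar>v $ i\<bar> \<le> h" "\<And>i. \<bar>w $ i\<bar> \<le> R + 1" for v w :: "real ^ 'n"
  proof -
    have "\<bar>inner v w\<bar> \<le> (\<Sum>i\<in>(UNIV :: 'n set). h * (R + 1))"
      unfolding inner_vec_def
      by (rule order_trans[OF sum_abs]) (intro sum_mono, use that h in \<open>simp add: abs_mult mult_mono\<close>)
    then show ?thesis by simp
  qed
  have "\<bar>C\<bar> \<le> h + N" if "\<bar>(u - v) / 2 + C\<bar> \<le> h" "\<bar>u\<bar> \<le> N" "\<bar>v\<bar> \<le> N" for u v C N :: real
    using that by (simp add: abs_le_iff field_simps)
  from this[OF t prod[OF a y] prod[OF b x]]
  have "\<bar>c\<bar> \<le> h + real CARD('n) * (h * (R + 1))" .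
  then show ?thesis using a b by (simp add: z mem_steps_box algebra_simps)
qed

text \<open>In the average over pairs of points of one cell, the second point is written as a right translate of the
first by some \<open>z\<close>. All such \<open>z\<close> lie in a box whose volume is a fixed multiple of \<open>h ^ DIM('n heisenberg)\<close>. After
exchanging the integrals, the inner one is a squared displacement under the translation by \<open>z\<close>.\<close>

lemma step_approximation_error:
  fixes \<Omega> :: "'n::finite heisenberg set"
  assumes bdd: "bounded \<Omega>" and h: "0 < h" "h \<le> 1"
    and R: "R \<ge> 0" "\<And>r b. r \<in> \<Omega> \<Longrightarrow> b \<in> Basis \<Longrightarrow> \<bar>r \<bullet> b\<bar> \<le> R"
    and \<phi>: "\<phi> \<in> test_functions \<Omega>" and M: "\<And>j. norm (abs_l2 (along (horizontal j) \<phi>)) \<le> M"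
    and \<kappa>_def: "\<kappa> = 1 + real CARD('n) * (R + 1)"
  shows "\<exists>c. (norm (abs_l2 \<phi> - (\<Sum>k\<in>cell_index h ` \<Omega>. c k *\<^sub>R abs_l2 (indicator (cell h k)))))\<^sup>2
     \<le> (\<Prod>b\<in>Basis. 2 * ((steps_box 1 \<kappa> :: 'n heisenberg) \<bullet> b)) * (M * modulus TYPE('n) \<kappa> h)\<^sup>2"
proof -
  let ?K = "cell_index h ` \<Omega>" and ?B = "cbox (- steps_box h \<kappa>) (steps_box h \<kappa> :: 'n heisenberg)"
  let ?d = "DIM('n heisenberg)" and ?P = "\<Prod>b\<in>Basis. 2 * ((steps_box 1 \<kappa> :: 'n heisenberg) \<bullet> b)"
  let ?same = "\<lambda>q p. \<Sum>k\<in>?K. indicator (cell h k) q * indicator (cell h k) p :: ennreal"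
  let ?D = "\<lambda>z q. ennreal ((\<phi> (right_translate z q) - \<phi> q)\<^sup>2)" and ?M = "(M * modulus TYPE('n) \<kappa> h)\<^sup>2"
  have \<kappa>: "\<kappa> \<ge> 0" using R(1) by (simp add: \<kappa>_def)
  have fin: "finite ?K" by (rule finite_cell_index[OF bdd])
  have \<phi>m[measurable]: "\<phi> \<in> borel_measurable borel"
    by (rule smooth_borel_measurable[OF test_function_smooth[OF \<phi>]])
  have sq: "sq_integrable \<phi>" by (rule test_function_sq_integrable[OF \<phi>])
  obtain c where c: "ennreal (h ^ ?d) * (\<integral>\<^sup>+p. ennreal ((\<phi> p - (\<Sum>k\<in>?K. c k * indicator (cell h k) p))\<^sup>2) \<partial>lborel)
     \<le> (\<integral>\<^sup>+q. \<integral>\<^sup>+p. ?same q p * ennreal ((\<phi> p - \<phi> q)\<^sup>2) \<partial>lborel \<partial>lborel)"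
    using step_approximation[OF h(1) bdd \<phi>m test_function_outside[OF \<phi>]] by blast
  let ?S = "\<Sum>k\<in>?K. c k *\<^sub>R abs_l2 (indicator (cell h k))"
  \<comment> \<open>at most one cell contains both points, and then \<open>z\<close> lies in the box\<close>
  have same: "?same q (right_translate z q) \<le> (indicator ?B z :: ennreal)" for q z
  proof (cases "cell_index h q \<in> ?K \<and> cell_index h (right_translate z q) = cell_index h q")
    case True
    then obtain r where r: "r \<in> \<Omega>" "cell_index h q = cell_index h r" by auto
    have "z \<in> ?B" unfolding \<kappa>_def using True by (intro step_in_box[OF h R(2) r]) auto
    moreover have "?same q (right_translate z q) \<le> (\<Sum>k\<in>?K. if k = cell_index h q then 1 else (0 :: ennreal))"
      by (intro sum_mono) (auto simp: indicator_def cell_index_eq)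
    ultimately show ?thesis using fin True by simp
  next
    case False
    then have "?same q (right_translate z q) = (0 :: ennreal)"
      by (intro sum.neutral) (auto simp: indicator_def cell_index_eq)
    then show ?thesis by simp
  qed
  have rtm[measurable]: "(\<lambda>q. \<phi> (right_translate z q)) \<in> borel_measurable borel" for z
  proof -
    have "right_translate z \<in> borel_measurable borel"
      by (intro borel_measurable_continuous_onI, cases z)
        (auto simp: right_translate_def case_prod_beta intro!: continuous_intros)
    then show ?thesis by (rule measurable_compose) measurable
  qed
  have joint: "(\<lambda>(q, z). indicator ?B z * ?D z q) \<in> borel_measurable (lborel \<Otimes>\<^sub>M lborel)"
  proof -
    have "(\<lambda>(q, z). right_translate z q) \<in> borel_measurable (borel :: ('n heisenberg \<times> 'n heisenberg) measure)"
      by (rule borel_measurable_continuous_onI[OF continuous_right_translate])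
    from measurable_compose[OF this \<phi>m]
    have 1: "(\<lambda>qz. \<phi> (right_translate (snd qz) (fst qz))) \<in> borel_measurable (borel :: ('n heisenberg \<times> 'n heisenberg) measure)"
      by (simp add: case_prod_beta)
    have 2: "(\<lambda>qz. \<phi> (fst qz)) \<in> borel_measurable (borel :: ('n heisenberg \<times> 'n heisenberg) measure)"
      by (rule measurable_compose[OF borel_measurable_continuous_onI[OF continuous_on_fst[OF continuous_on_id]] \<phi>m])
    have 3: "(\<lambda>qz. indicator ?B (snd qz) :: ennreal) \<in> borel_measurable (borel :: ('n heisenberg \<times> 'n heisenberg) measure)"
      by (rule measurable_compose[OF borel_measurable_continuous_onI[OF continuous_on_snd[OF continuous_on_id]]]) simp
    show ?thesis
      using 1 2 3 by (simp add: case_prod_beta lborel_prod)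
  qed
  have "(\<integral>\<^sup>+q. \<integral>\<^sup>+p. ?same q p * ennreal ((\<phi> p - \<phi> q)\<^sup>2) \<partial>lborel \<partial>lborel)
      \<le> (\<integral>\<^sup>+q. \<integral>\<^sup>+z. indicator ?B z * ?D z q \<partial>lborel \<partial>lborel)"
  proof (rule nn_integral_mono)
    fix q
    have "(\<integral>\<^sup>+p. ?same q p * ennreal ((\<phi> p - \<phi> q)\<^sup>2) \<partial>lborel)
       = (\<integral>\<^sup>+z. ?same q (right_translate z q) * ?D z q \<partial>lborel)"
      by (rule volume_preserving_nn_integral[OF volume_preserving_right_translate_swap, symmetric]) measurable
    also have "\<dots> \<le> (\<integral>\<^sup>+z. indicator ?B z * ?D z q \<partial>lborel)"
      by (intro nn_integral_mono mult_right_mono same) auto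
    finally show "(\<integral>\<^sup>+p. ?same q p * ennreal ((\<phi> p - \<phi> q)\<^sup>2) \<partial>lborel)
       \<le> (\<integral>\<^sup>+z. indicator ?B z * ?D z q \<partial>lborel)" .
  qed
  also have "\<dots> = (\<integral>\<^sup>+z. \<integral>\<^sup>+q. indicator ?B z * ?D z q \<partial>lborel \<partial>lborel)"
    by (rule lborel_pair.Fubini'[OF joint, symmetric])
  also have "\<dots> \<le> (\<integral>\<^sup>+z. ennreal (?M) * indicator ?B z \<partial>lborel)"
  proof (rule nn_integral_mono)
    fix z :: "'n heisenberg"
    show "(\<integral>\<^sup>+q. indicator ?B z * ?D z q \<partial>lborel)
        \<le> ennreal (?M) * indicator ?B z"
    proof (cases "z \<in> ?B")
      case True
      obtain a b t where z: "z = (a, b, t)" by (cases z)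
      have vp: "volume_preserving (right_translate z)"
        using moves_right_translate[OF \<phi> M, of a b t] by (simp add: moves_def z)
      have "displacement \<phi> (right_translate z) \<le> M * modulus TYPE('n) \<kappa> h"
        unfolding z modulus_def using True h
        by (intro displacement_right_translate_small[OF \<phi> M]) (auto simp: z mem_steps_box)
      then have "(displacement \<phi> (right_translate z))\<^sup>2 \<le> ?M"
        by (intro power_mono) (auto simp: displacement_def)
      moreover have "(\<integral>\<^sup>+q. ?D z q \<partial>lborel) = ennreal ((displacement \<phi> (right_translate z))\<^sup>2)"
        unfolding displacement_def
        by (rule nn_norm_abs_l2_borel[OF _ displacement_sq_integrable[OF vp \<phi>m sq]]) measurable
      ultimately show ?thesis using True by (simp add: ennreal_leI)
    qed simp
  qed
  also have "\<dots> = ennreal (?M) * ennreal (h ^ ?d * ?P)"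
    using h \<kappa> by (subst nn_integral_cmult_indicator) (auto simp: emeasure_steps_box)
  finally have le: "ennreal (h ^ ?d) * (\<integral>\<^sup>+p. ennreal ((\<phi> p - (\<Sum>k\<in>?K. c k * indicator (cell h k) p))\<^sup>2) \<partial>lborel)
      \<le> ennreal (?M) * ennreal (h ^ ?d * ?P)"
    using c by (rule order_trans[rotated])
  have sqe: "sq_integrable (indicator (cell h k) :: _ \<Rightarrow> real)" for k :: "'n heisenberg \<Rightarrow> int"
    by (rule sq_integrable_indicator[OF _ cell_bounds(1)[OF h(1)]]) (simp add: sets_completionI_sets)
  note sums = abs_l2_lincomb[OF _ sqe]
  let ?s = "\<lambda>p. \<Sum>k\<in>?K. c k * indicator (cell h k) p"
  have "(\<integral>\<^sup>+p. ennreal ((\<phi> p - ?s p)\<^sup>2) \<partial>lborel) = ennreal ((norm (abs_l2 (\<lambda>p. \<phi> p - ?s p)))\<^sup>2)"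
    by (rule nn_norm_abs_l2_borel) (measurable, rule sq_integrable_diff[OF sq sums(1)[OF fin]])
  also have "abs_l2 (\<lambda>p. \<phi> p - ?s p) = abs_l2 \<phi> - ?S"
    unfolding sums(2)[OF fin, symmetric] by (rule abs_l2_diff[OF sq sums(1)[OF fin], symmetric])
  finally have eq: "(\<integral>\<^sup>+p. ennreal ((\<phi> p - ?s p)\<^sup>2) \<partial>lborel)
      = ennreal ((norm (abs_l2 \<phi> - ?S))\<^sup>2)" .
  have "h ^ ?d * (norm (abs_l2 \<phi> - ?S))\<^sup>2
      \<le> ?M * (h ^ ?d * ?P)"
  proof -
    have P0: "0 \<le> ?P"
      using \<kappa> by (intro prod_nonneg) (auto simp: steps_box_def Basis_prod_def Basis_vec_def inner_axis)
    show ?thesis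
      using le h P0 unfolding eq
      by (subst (asm) (1 2) ennreal_mult[symmetric]) (auto simp: ennreal_le_iff)
  qed
  then have "(norm (abs_l2 \<phi> - ?S))\<^sup>2
      \<le> ?P * ?M"
    using h by (simp add: mult.left_commute mult.commute[of _ ?P])
  then show ?thesis by blast
qed

text \<open>Up to \<open>e\<close>, the functions lie in the span of finitely many indicator functions of cells. The coefficients are bounded
because indicator functions of different cells are orthogonal.\<close>

theorem horizontal_Rellich:
  fixes \<Omega> :: "'n::finite heisenberg set"
  assumes bdd: "bounded \<Omega>"
  shows "compact (closure {abs_l2 \<phi> | \<phi>. \<phi> \<in> test_functions \<Omega> \<and> norm (abs_l2 \<phi>) \<le> M \<and>
     (\<forall>j. norm (abs_l2 (along (horizontal j) \<phi>)) \<le> M)})" (is "compact (closure ?S)")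
proof (rule compact_closure_if_approximable)
  fix e :: real assume e: "e > 0"
  obtain R where R: "\<And>r. r \<in> \<Omega> \<Longrightarrow> norm r \<le> R" using bdd by (auto simp: bounded_iff)
  define R' where "R' = max R 0"
  have R'0: "R' \<ge> 0" by (simp add: R'_def)
  have R': "\<bar>r \<bullet> b\<bar> \<le> R'" if "r \<in> \<Omega>" "b \<in> Basis" for r b
    using Basis_le_norm[OF that(2), of r] R[OF that(1)] by (simp add: R'_def)
  define \<kappa> where "\<kappa> = 1 + real CARD('n) * (R' + 1)"
  let ?P = "\<Prod>b\<in>Basis. 2 * ((steps_box 1 \<kappa> :: 'n heisenberg) \<bullet> b)"
  have "((\<lambda>h. ?P * (M * modulus TYPE('n) \<kappa> h)\<^sup>2) \<longlongrightarrow> ?P * (M * 0)\<^sup>2) (at_right 0)"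
    by (intro tendsto_intros modulus_tendsto_0)
  then have "((\<lambda>h. ?P * (M * modulus TYPE('n) \<kappa> h)\<^sup>2) \<longlongrightarrow> 0) (at_right 0)" by simp
  then have "eventually (\<lambda>h. ?P * (M * modulus TYPE('n) \<kappa> h)\<^sup>2 < e\<^sup>2) (at_right 0)"
    using e by (intro order_tendstoD(2)) auto
  moreover have "eventually (\<lambda>h. h \<in> {0<..<1}) (at_right (0::real))"
    by (rule eventually_at_right_real) simp
  ultimately have "eventually (\<lambda>h. ?P * (M * modulus TYPE('n) \<kappa> h)\<^sup>2 < e\<^sup>2 \<and> h \<in> {0<..<1}) (at_right 0)"
    by (rule eventually_conj)
  then obtain h where h: "?P * (M * modulus TYPE('n) \<kappa> h)\<^sup>2 < e\<^sup>2" "0 < h" "h < 1"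
    using eventually_happens[of _ "at_right (0::real)"] by auto
  let ?K = "cell_index h ` \<Omega>"
  have fin: "finite ?K" by (rule finite_cell_index[OF bdd])
  define E where "E = (\<lambda>k. abs_l2 (indicator (cell h k) :: 'n heisenberg \<Rightarrow> real))"
  have sqe: "sq_integrable (indicator (cell h k) :: _ \<Rightarrow> real)" for k :: "'n heisenberg \<Rightarrow> int"
    by (rule sq_integrable_indicator[OF _ cell_bounds(1)[OF h(2)]]) (simp add: sets_completionI_sets)
  have orth: "inner (E k) (E l) = 0" if "k \<in> ?K" "l \<in> ?K" "k \<noteq> l" for k l
  proof -
    have 0: "indicator (cell h k) p * indicator (cell h l) p = (0 :: real)" for p
      using that by (auto simp: indicator_def cell_index_eq)
    show ?thesis unfolding E_def inner_abs_l2[OF sqe sqe] 0 by simp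
  qed
  have Epos: "norm (E k) > 0" for k
  proof -
    have "0 < ennreal (h ^ DIM('n heisenberg))" using h by simp
    also have "\<dots> \<le> (\<integral>\<^sup>+p. ennreal ((indicator (cell h k) p)\<^sup>2) \<partial>lborel)"
    proof -
      have "ennreal ((indicator (cell h k) p)\<^sup>2) = indicator (cell h k) p" for p
        by (simp add: indicator_def)
      then show ?thesis using emeasure_cell(1)[OF h(2), of k] by (simp only:) simp
    qed
    also have "\<dots> = ennreal ((norm (E k))\<^sup>2)" unfolding E_def by (rule nn_norm_abs_l2_borel) (auto simp: sqe)
    finally show ?thesis by auto
  qed
  let ?C = "{\<Sum>k\<in>?K. c k *\<^sub>R E k | c. \<forall>k\<in>?K. \<bar>c k\<bar> \<le> (M + e) / norm (E k)}"
  have "\<exists>y\<in>?C. dist x y < e" if x: "x \<in> ?S" for x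
  proof -
    obtain \<phi> where \<phi>: "x = abs_l2 \<phi>" "\<phi> \<in> test_functions \<Omega>" "norm (abs_l2 \<phi>) \<le> M"
      "\<And>j. norm (abs_l2 (along (horizontal j) \<phi>)) \<le> M" using x by blast
    obtain c where c: "(norm (abs_l2 \<phi> - (\<Sum>k\<in>?K. c k *\<^sub>R E k)))\<^sup>2 \<le> ?P * (M * modulus TYPE('n) \<kappa> h)\<^sup>2"
      using step_approximation_error[OF bdd h(2) less_imp_le[OF h(3)] R'0 R' \<phi>(2,4) \<kappa>_def] unfolding E_def by blast
    let ?s = "\<Sum>k\<in>?K. c k *\<^sub>R E k"
    have "(norm (x - ?s))\<^sup>2 < e\<^sup>2" using c h(1) by (simp add: \<phi>(1))
    then have close: "norm (x - ?s) < e" by (rule power2_less_imp_less) (use e in simp)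
    have "\<bar>c k\<bar> \<le> (M + e) / norm (E k)" if k: "k \<in> ?K" for k
    proof -
      have "inner ?s (E k) = (\<Sum>l\<in>?K. if l = k then c k * (norm (E k))\<^sup>2 else 0)"
        unfolding inner_sum_left using orth k by (intro sum.cong) (auto simp: power2_norm_eq_inner)
      then have eq: "c k * (norm (E k))\<^sup>2 = inner ?s (E k)" using fin k by simp
      have "\<bar>c k * (norm (E k))\<^sup>2\<bar> \<le> norm ?s * norm (E k)"
        unfolding eq by (rule Cauchy_Schwarz_ineq2)
      then have "\<bar>c k\<bar> * (norm (E k))\<^sup>2 \<le> norm ?s * norm (E k)" by (simp add: abs_mult)
      then have "\<bar>c k\<bar> * norm (E k) \<le> norm ?s"
        using Epos[of k] by (simp add: power2_eq_square)
      also have "norm ?s \<le> norm x + norm (x - ?s)" using norm_triangle_sub[of ?s x] by (simp add: norm_minus_commute)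
      also have "\<dots> \<le> M + e" using \<phi>(1,3) close by simp
      finally show ?thesis using Epos[of k] by (simp add: field_simps)
    qed
    then have "?s \<in> ?C" by (intro CollectI exI[of _ c] conjI refl ballI)
    then show ?thesis by (rule bexI[rotated]) (simp add: dist_norm close)
  qed
  then show "\<exists>C. compact C \<and> (\<forall>x\<in>?S. \<exists>y\<in>C. dist x y < e)"
    by (intro exI[of _ ?C] conjI ballI compact_bounded_combinations[OF fin])
qed

section \<open>The Dirichlet form of the Kohn Laplacian\<close>

definition extend :: "'a::euclidean_space set \<Rightarrow> ('a \<Rightarrow> real) \<Rightarrow> 'a \<Rightarrow> real" where
  "extend \<Omega> u p = (if p \<in> \<Omega> then u p else 0)"

text \<open>Zero extension embeds the square integrable functions on \<open>\<Omega>\<close> in those on the whole space, so that one type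
serves all \<open>\<Omega>\<close>.\<close>

definition l2_class :: "'a::euclidean_space set \<Rightarrow> ('a \<Rightarrow> real) \<Rightarrow> 'a l2" where
  "l2_class \<Omega> u = abs_l2 (extend \<Omega> u)"

lemma L2_iff_sq_integrable:
  assumes "\<Omega> \<in> sets lebesgue"
  shows "u \<in> L2 \<Omega> \<longleftrightarrow> sq_integrable (extend \<Omega> u)"
proof -
  have "(\<lambda>p. (extend \<Omega> u p)\<^sup>2) = (\<lambda>p. if p \<in> \<Omega> then (u p)\<^sup>2 else 0)" by (auto simp: extend_def)
  then show ?thesis
    using borel_measurable_if[OF assms, of u] Lebesgue_Measure.integrable_restrict_UNIV[OF assms, of "\<lambda>p. (u p)\<^sup>2"]
    by (simp add: L2_def sq_integrable_def extend_def[abs_def])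
qed

lemma inner_l2_class:
  assumes "\<Omega> \<in> sets lebesgue" "u \<in> L2 \<Omega>" "v \<in> L2 \<Omega>"
  shows "inner (l2_class \<Omega> u) (l2_class \<Omega> v) = (\<integral>p. u p * v p \<partial>lebesgue_on \<Omega>)"
proof -
  have "(\<lambda>p. extend \<Omega> u p * extend \<Omega> v p) = (\<lambda>p. if p \<in> \<Omega> then u p * v p else 0)" by (auto simp: extend_def)
  then show ?thesis
    using assms by (simp add: l2_class_def inner_abs_l2 L2_iff_sq_integrable Lebesgue_Measure.integral_restrict_UNIV)
qed

lemma l2_class_eq_iff:
  assumes "\<Omega> \<in> sets lebesgue" "u \<in> L2 \<Omega>" "v \<in> L2 \<Omega>"
  shows "l2_class \<Omega> u = l2_class \<Omega> v \<longleftrightarrow> (AE p in lebesgue_on \<Omega>. u p = v p)"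
proof -
  have "l2_class \<Omega> u = l2_class \<Omega> v \<longleftrightarrow> (AE p in lebesgue. extend \<Omega> u p = extend \<Omega> v p)"
    using assms by (simp add: l2_class_def abs_l2_eq_iff L2_iff_sq_integrable)
  also have "\<dots> \<longleftrightarrow> (AE p in lebesgue. p \<in> \<Omega> \<longrightarrow> u p = v p)"
    by (intro AE_cong) (auto simp: extend_def)
  finally show ?thesis using assms(1) by (simp add: AE_restrict_space_iff)
qed

lemma L2_lincomb:
  assumes "\<Omega> \<in> sets lebesgue" "finite J" "\<And>j. j \<in> J \<Longrightarrow> u j \<in> L2 \<Omega>"
  shows "(\<lambda>p. \<Sum>j\<in>J. c j * u j p) \<in> L2 \<Omega> \<and>
     l2_class \<Omega> (\<lambda>p. \<Sum>j\<in>J. c j * u j p) = (\<Sum>j\<in>J. c j *\<^sub>R l2_class \<Omega> (u j))"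
  using assms(2,3)
proof (induction J rule: finite_induct)
  case empty
  have "extend \<Omega> (\<lambda>p. 0) = (\<lambda>p. 0)" by (auto simp: extend_def)
  then show ?case using assms(1) by (simp add: L2_iff_sq_integrable l2_class_def abs_l2_zero sq_integrable_zero)
next
  case (insert j J)
  let ?S = "\<lambda>p. \<Sum>j\<in>J. c j * u j p"
  have S: "sq_integrable (extend \<Omega> ?S)" "l2_class \<Omega> ?S = (\<Sum>j\<in>J. c j *\<^sub>R l2_class \<Omega> (u j))"
    using insert assms(1) by (auto simp: L2_iff_sq_integrable)
  have j: "sq_integrable (extend \<Omega> (u j))" using insert.prems assms(1) by (simp add: L2_iff_sq_integrable)
  have eq: "extend \<Omega> (\<lambda>p. c j * u j p + ?S p) = (\<lambda>p. c j * extend \<Omega> (u j) p + extend \<Omega> ?S p)"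
    by (auto simp: extend_def)
  have "sq_integrable (extend \<Omega> (\<lambda>p. c j * u j p + ?S p))"
    unfolding eq by (rule sq_integrable_add[OF sq_integrable_scale[OF j] S(1)])
  moreover have "l2_class \<Omega> (\<lambda>p. c j * u j p + ?S p) = c j *\<^sub>R l2_class \<Omega> (u j) + l2_class \<Omega> ?S"
    unfolding l2_class_def eq abs_l2_scale[OF j]
    by (rule abs_l2_add[OF sq_integrable_scale[OF j] S(1), symmetric])
  ultimately show ?case using insert.hyps S(2) assms(1) by (simp add: L2_iff_sq_integrable)
qed

lemma L2_diff:
  assumes "\<Omega> \<in> sets lebesgue" "u \<in> L2 \<Omega>" "v \<in> L2 \<Omega>"
  shows "(\<lambda>p. u p - v p) \<in> L2 \<Omega>" "l2_class \<Omega> (\<lambda>p. u p - v p) = l2_class \<Omega> u - l2_class \<Omega> v"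
proof -
  have sq: "sq_integrable (extend \<Omega> u)" "sq_integrable (extend \<Omega> v)"
    using assms by (auto simp: L2_iff_sq_integrable)
  have eq: "extend \<Omega> (\<lambda>p. u p - v p) = (\<lambda>p. extend \<Omega> u p - extend \<Omega> v p)" by (auto simp: extend_def)
  show "(\<lambda>p. u p - v p) \<in> L2 \<Omega>"
    unfolding L2_iff_sq_integrable[OF assms(1)] eq by (rule sq_integrable_diff[OF sq])
  show "l2_class \<Omega> (\<lambda>p. u p - v p) = l2_class \<Omega> u - l2_class \<Omega> v"
    unfolding l2_class_def eq by (rule abs_l2_diff[OF sq, symmetric])
qed

lemma test_function_L2:
  assumes "\<Omega> \<in> sets lebesgue" "\<phi> \<in> test_functions \<Omega>"
  shows "\<phi> \<in> L2 \<Omega>" "l2_class \<Omega> \<phi> = abs_l2 \<phi>"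
proof -
  have "extend \<Omega> \<phi> = \<phi>" using test_function_outside[OF assms(2)] by (auto simp: extend_def)
  then show "\<phi> \<in> L2 \<Omega>" "l2_class \<Omega> \<phi> = abs_l2 \<phi>"
    using test_function_sq_integrable[OF assms(2)] by (auto simp: L2_iff_sq_integrable[OF assms(1)] l2_class_def)
qed

lemma multiplier_indicator: "\<Omega> \<in> sets lebesgue \<Longrightarrow> multiplier (indicator \<Omega>)"
  by (auto simp: multiplier_def indicator_def intro!: exI[of _ 1])

lemma l2_class_surj:
  assumes "\<Omega> \<in> sets lebesgue" "mult_op (indicator \<Omega>) x = x"
  shows "\<exists>u\<in>L2 \<Omega>. l2_class \<Omega> u = x"
proof -
  obtain u where u: "sq_integrable u" "x = abs_l2 u" by (rule l2_cases)
  have eq: "extend \<Omega> u = (\<lambda>p. indicator \<Omega> p * u p)" by (auto simp: extend_def indicator_def)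
  have "sq_integrable (extend \<Omega> u)"
    unfolding eq by (rule sq_integrable_multiplier[OF multiplier_indicator[OF assms(1)] u(1)])
  moreover have "l2_class \<Omega> u = x"
    unfolding l2_class_def eq using assms(2) mult_op_abs[OF multiplier_indicator[OF assms(1)] u(1)] u(2) by simp
  ultimately show ?thesis using L2_iff_sq_integrable[OF assms(1)] by blast
qed

lemma l2_class_eqI_test_functions:
  assumes "open \<Omega>" "u \<in> L2 \<Omega>" "v \<in> L2 \<Omega>"
    and eq: "\<And>\<phi>. \<phi> \<in> test_functions \<Omega> \<Longrightarrow> inner (l2_class \<Omega> u) (abs_l2 \<phi>) = inner (l2_class \<Omega> v) (abs_l2 \<phi>)"
  shows "l2_class \<Omega> u = l2_class \<Omega> v"
proof -
  have \<Omega>: "\<Omega> \<in> sets lebesgue" using assms(1) by simp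
  have sq: "sq_integrable (extend \<Omega> u)" "sq_integrable (extend \<Omega> v)"
    using assms(2,3) by (auto simp: L2_iff_sq_integrable[OF \<Omega>])
  have "AE p in lebesgue. p \<in> \<Omega> \<longrightarrow> extend \<Omega> u p - extend \<Omega> v p = 0"
  proof (rule test_functions_dense[OF assms(1) sq_integrable_diff[OF sq]])
    fix \<phi> assume \<phi>: "\<phi> \<in> test_functions \<Omega>"
    have "inner (abs_l2 (extend \<Omega> u) - abs_l2 (extend \<Omega> v)) (abs_l2 \<phi>) = 0"
      using eq[OF \<phi>] by (simp add: l2_class_def inner_diff_left)
    then show "(\<integral>p. (extend \<Omega> u p - extend \<Omega> v p) * \<phi> p \<partial>lebesgue) = 0"
      by (simp add: abs_l2_diff sq inner_abs_l2 sq_integrable_diff test_function_sq_integrable[OF \<phi>])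
  qed
  then have "AE p in lebesgue. extend \<Omega> u p = extend \<Omega> v p"
    by eventually_elim (auto simp: extend_def)
  then show ?thesis by (simp add: l2_class_def abs_l2_eq_iff sq)
qed

definition gradient_graph :: "('n::finite heisenberg \<Rightarrow> real) \<Rightarrow> 'n heisenberg l2 \<times> ('n heisenberg l2 ^ ('n + 'n))" where
  "gradient_graph \<phi> = (abs_l2 \<phi>, \<chi> j. abs_l2 (along (horizontal j) \<phi>))"

definition form_domain :: "'n::finite heisenberg set \<Rightarrow> ('n heisenberg l2 \<times> ('n heisenberg l2 ^ ('n + 'n))) set" where
  "form_domain \<Omega> = closure (gradient_graph ` test_functions \<Omega>)"

lemma gradient_graph_in: "\<phi> \<in> test_functions \<Omega> \<Longrightarrow> gradient_graph \<phi> \<in> form_domain \<Omega>"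
  unfolding form_domain_def by (rule subsetD[OF closure_subset imageI])

text \<open>The form of closure used throughout: a closed property is checked on test functions.\<close>

lemma form_domain_induct:
  assumes "closed S" "\<And>\<phi>. \<phi> \<in> test_functions \<Omega> \<Longrightarrow> gradient_graph \<phi> \<in> S" "x \<in> form_domain \<Omega>"
  shows "x \<in> S"
proof -
  have "gradient_graph ` test_functions \<Omega> \<subseteq> S" using assms(2) by (rule image_subsetI)
  then have "form_domain \<Omega> \<subseteq> S" unfolding form_domain_def using assms(1) by (rule closure_minimal)
  then show ?thesis using assms(3) by (rule subsetD)
qed

lemma along_horizontal_sq_integrable:
  "\<phi> \<in> test_functions \<Omega> \<Longrightarrow> sq_integrable (along (horizontal j) \<phi>)"
  by (rule test_function_sq_integrable[OF test_function_along[OF affine_horizontal]])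

lemma gradient_graph_add:
  assumes "\<phi> \<in> test_functions \<Omega>" "\<psi> \<in> test_functions \<Omega>"
  shows "gradient_graph \<phi> + gradient_graph \<psi> = gradient_graph (\<lambda>p. \<phi> p + \<psi> p)"
  unfolding gradient_graph_def
  by (simp add: vec_eq_iff along_add[OF assms[THEN test_function_smooth]]
      abs_l2_add[OF assms[THEN test_function_sq_integrable]]
      abs_l2_add[OF assms[THEN along_horizontal_sq_integrable]])

lemma gradient_graph_scale:
  assumes "\<phi> \<in> test_functions \<Omega>"
  shows "c *\<^sub>R gradient_graph \<phi> = gradient_graph (\<lambda>p. c * \<phi> p)"
  unfolding gradient_graph_def
  by (simp add: vec_eq_iff along_scale[OF test_function_smooth[OF assms]]
      abs_l2_scale[OF test_function_sq_integrable[OF assms]]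
      abs_l2_scale[OF along_horizontal_sq_integrable[OF assms]])

lemma gradient_graph_zero: "gradient_graph (\<lambda>p. 0) = 0"
  by (simp add: gradient_graph_def along_const abs_l2_zero vec_eq_iff zero_prod_def)

lemma subspace_closure:
  fixes S :: "'a::real_normed_vector set"
  assumes "subspace S"
  shows "subspace (closure S)"
proof (rule subspaceI)
  show "0 \<in> closure S" using subspace_0[OF assms] closure_subset by blast
  show "x + y \<in> closure S" if xy: "x \<in> closure S" "y \<in> closure S" for x y
  proof -
    obtain f g where "\<And>n. f n \<in> S" "f \<longlonglongrightarrow> x" "\<And>n. g n \<in> S" "g \<longlonglongrightarrow> y"
      using xy unfolding closure_sequential by metis
    then have "\<forall>n. f n + g n \<in> S" "(\<lambda>n. f n + g n) \<longlonglongrightarrow> x + y"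
      by (auto intro: subspace_add[OF assms] tendsto_add)
    then show ?thesis unfolding closure_sequential by (intro exI conjI)
  qed
  show "c *\<^sub>R x \<in> closure S" if x: "x \<in> closure S" for c x
  proof -
    obtain f where "\<And>n. f n \<in> S" "f \<longlonglongrightarrow> x"
      using x unfolding closure_sequential by metis
    then have "\<forall>n. c *\<^sub>R f n \<in> S" "(\<lambda>n. c *\<^sub>R f n) \<longlonglongrightarrow> c *\<^sub>R x"
      by (auto intro: subspace_scale[OF assms] tendsto_intros)
    then show ?thesis unfolding closure_sequential by (intro exI conjI)
  qed
qed

lemma subspace_form_domain: "subspace (form_domain \<Omega>)"
  unfolding form_domain_def
proof (rule subspace_closure, rule subspaceI)
  show "0 \<in> gradient_graph ` test_functions \<Omega>"
    using test_function_zero gradient_graph_zero by (metis imageI)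
  show "x + y \<in> gradient_graph ` test_functions \<Omega>"
    if "x \<in> gradient_graph ` test_functions \<Omega>" "y \<in> gradient_graph ` test_functions \<Omega>" for x y
    using that by (auto simp: gradient_graph_add intro: test_function_add)
  show "c *\<^sub>R x \<in> gradient_graph ` test_functions \<Omega>" if "x \<in> gradient_graph ` test_functions \<Omega>" for c x
    using that by (auto simp: gradient_graph_scale intro: test_function_scale)
qed

lemma norm_le_gradient_graph:
  "norm (abs_l2 \<phi>) \<le> norm (gradient_graph \<phi>)"
  "norm (abs_l2 (along (horizontal j) \<phi>)) \<le> norm (gradient_graph \<phi>)"
proof -
  show "norm (abs_l2 \<phi>) \<le> norm (gradient_graph \<phi>)"
    unfolding gradient_graph_def by (rule norm_fst_le)
  have "norm (abs_l2 (along (horizontal j) \<phi>)) \<le> norm (\<chi> j. abs_l2 (along (horizontal j) \<phi>))"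
    using Finite_Cartesian_Product.norm_nth_le[of "\<chi> j. abs_l2 (along (horizontal j) \<phi>)" j] by simp
  also have "\<dots> \<le> norm (gradient_graph \<phi>)"
    unfolding gradient_graph_def by (rule norm_snd_le)
  finally show "norm (abs_l2 (along (horizontal j) \<phi>)) \<le> norm (gradient_graph \<phi>)" .
qed

text \<open>A bounded sequence in the closure is replaced by test functions that differ less and less from it; these
have a convergent subsequence by \<open>horizontal_Rellich\<close>.\<close>

lemma form_graph_form_domain:
  fixes \<Omega> :: "'n::finite heisenberg set"
  assumes "bounded \<Omega>"
  shows "form_graph (form_domain \<Omega>)"
proof
  show "subspace (form_domain \<Omega>)" by (rule subspace_form_domain)
  show "closed (form_domain \<Omega>)" by (simp add: form_domain_def)
  fix f :: "nat \<Rightarrow> 'n heisenberg l2 \<times> ('n heisenberg l2 ^ ('n + 'n))" and C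
  assume f: "\<And>j. f j \<in> form_domain \<Omega>" and C: "\<And>j. norm (f j) \<le> C"
  have "\<exists>\<phi>\<in>test_functions \<Omega>. dist (gradient_graph \<phi>) (f j) < 1 / real (Suc j)" for j
    using f[of j] unfolding form_domain_def closure_approachable by simp
  then obtain \<phi> where \<phi>: "\<And>j. \<phi> j \<in> test_functions \<Omega>" "\<And>j. dist (gradient_graph (\<phi> j)) (f j) < 1 / real (Suc j)"
    by metis
  let ?S = "{abs_l2 \<phi> | \<phi>. \<phi> \<in> test_functions \<Omega> \<and> norm (abs_l2 \<phi>) \<le> C + 1 \<and>
     (\<forall>j. norm (abs_l2 (along (horizontal j) \<phi>)) \<le> C + 1)}"
  have bound: "norm (gradient_graph (\<phi> j)) \<le> C + 1" for j
  proof -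
    have "norm (gradient_graph (\<phi> j)) \<le> norm (f j) + dist (gradient_graph (\<phi> j)) (f j)"
      using norm_triangle_sub[of "gradient_graph (\<phi> j)" "f j"] by (simp add: dist_norm)
    also have "dist (gradient_graph (\<phi> j)) (f j) \<le> 1"
      using \<phi>(2)[of j] by (rule order.strict_implies_order[OF order.strict_trans2]) simp
    finally show ?thesis using C[of j] by simp
  qed
  have "abs_l2 (\<phi> j) \<in> closure ?S" for j
    using \<phi>(1) norm_le_gradient_graph order_trans[OF _ bound] closure_subset[of ?S] by blast
  then obtain l r where r: "strict_mono r" "((\<lambda>j. abs_l2 (\<phi> j)) \<circ> r) \<longlonglongrightarrow> l"
    using horizontal_Rellich[OF assms, of "C + 1"] unfolding compact_def by meson
  have "(\<lambda>j. fst (f j) - abs_l2 (\<phi> j)) \<longlonglongrightarrow> 0"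
  proof (rule Lim_null_comparison)
    have "norm (fst (f j) - abs_l2 (\<phi> j)) \<le> 1 / real (Suc j)" for j
    proof -
      have "norm (fst (f j) - abs_l2 (\<phi> j)) = norm (fst (f j - gradient_graph (\<phi> j)))"
        by (simp add: gradient_graph_def)
      also have "\<dots> \<le> norm (f j - gradient_graph (\<phi> j))" by (metis norm_fst_le prod.collapse)
      finally show ?thesis using \<phi>(2)[of j] by (simp add: dist_norm norm_minus_commute)
    qed
    then show "\<forall>\<^sub>F j in sequentially. norm (fst (f j) - abs_l2 (\<phi> j)) \<le> 1 / real (Suc j)" by simp
    show "(\<lambda>j. 1 / real (Suc j)) \<longlonglongrightarrow> 0" by (rule LIMSEQ_Suc[OF lim_1_over_n])
  qed
  then have "((\<lambda>j. fst (f j) - abs_l2 (\<phi> j)) \<circ> r) \<longlonglongrightarrow> 0" by (rule LIMSEQ_subseq_LIMSEQ[OF _ r(1)])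
  from tendsto_add[OF this r(2)] have "(\<lambda>j. fst (f (r j))) \<longlonglongrightarrow> l" by (simp add: o_def)
  then show "\<exists>r v. strict_mono r \<and> (\<lambda>j. fst (f (r j))) \<longlonglongrightarrow> v" using r(1) by blast
qed

lemma form_domain_support:
  assumes \<Omega>: "\<Omega> \<in> sets lebesgue" and vg: "(v, g) \<in> form_domain \<Omega>"
  shows "mult_op (indicator \<Omega>) v = v" "mult_op (indicator \<Omega>) (g $ j) = g $ j"
proof -
  have test: "mult_op (indicator \<Omega>) (abs_l2 \<phi>) = abs_l2 \<phi>" if "\<phi> \<in> test_functions \<Omega>" for \<phi>
  proof -
    have "indicator \<Omega> p * \<phi> p = \<phi> p" for p
      using test_function_outside[OF that, of p] by (cases "p \<in> \<Omega>") auto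
    then show ?thesis
      unfolding mult_op_abs[OF multiplier_indicator[OF \<Omega>] test_function_sq_integrable[OF that]] by (simp only:)
  qed
  have cont: "continuous_on UNIV (\<lambda>x. mult_op (indicator \<Omega>) (F x))" if "continuous_on UNIV F"
    for F :: "'b::topological_space \<Rightarrow> _"
    using bounded_linear.continuous_on[OF bounded_linear_mult_op that] .
  have "(v, g) \<in> {x. mult_op (indicator \<Omega>) (fst x) = fst x}"
    by (rule form_domain_induct[OF closed_Collect_eq[OF cont] _ vg])
      (auto intro!: continuous_intros simp: gradient_graph_def test)
  then show "mult_op (indicator \<Omega>) v = v" by simp
  have "(v, g) \<in> {x. mult_op (indicator \<Omega>) (snd x $ j) = snd x $ j}"
    by (rule form_domain_induct[OF closed_Collect_eq[OF cont] _ vg])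
      (auto intro!: continuous_intros simp: gradient_graph_def test test_function_along[OF affine_horizontal])
  then show "mult_op (indicator \<Omega>) (g $ j) = g $ j" by simp
qed

lemma integration_by_parts_l2:
  assumes "\<phi> \<in> test_functions \<Omega>" "\<psi> \<in> test_functions \<Omega>"
  shows "inner (abs_l2 (along (horizontal j) \<phi>)) (abs_l2 \<psi>) = - inner (abs_l2 \<phi>) (abs_l2 (along (horizontal j) \<psi>))"
  using shear_flow.integration_by_parts[OF shear_flow_horizontal assms, of j]
  by (simp add: inner_abs_l2 assms[THEN test_function_sq_integrable] assms[THEN along_horizontal_sq_integrable])

lemma form_domain_antisym_test:
  assumes "(v, g) \<in> form_domain \<Omega>" "\<phi> \<in> test_functions \<Omega>"
  shows "inner (g $ j) (abs_l2 \<phi>) = - inner v (abs_l2 (along (horizontal j) \<phi>))"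
proof -
  have "(v, g) \<in> {x. inner (snd x $ j) (abs_l2 \<phi>) = - inner (fst x) (abs_l2 (along (horizontal j) \<phi>))}"
    by (rule form_domain_induct[OF _ _ assms(1)], intro closed_Collect_eq continuous_intros)
      (simp add: gradient_graph_def integration_by_parts_l2[OF _ assms(2)])
  then show ?thesis by simp
qed

lemma form_domain_antisym:
  assumes "(v, g) \<in> form_domain \<Omega>" "(w, h) \<in> form_domain \<Omega>"
  shows "inner (g $ j) w = - inner v (h $ j)"
proof -
  have "(w, h) \<in> {x. inner (g $ j) (fst x) = - inner v (snd x $ j)}"
    by (rule form_domain_induct[OF _ _ assms(2)], intro closed_Collect_eq continuous_intros)
      (simp add: gradient_graph_def form_domain_antisym_test[OF assms(1)])
  then show ?thesis by simp
qed

definition coordinate :: "'n::finite + 'n \<Rightarrow> 'n heisenberg \<Rightarrow> real" where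
  "coordinate j = (\<lambda>(x, y, t). case j of Inl i \<Rightarrow> x $ i | Inr i \<Rightarrow> y $ i)"

lemma bounded_linear_coordinate: "bounded_linear (coordinate j)"
proof -
  have "linear (coordinate j)"
    by (rule linearI) (auto simp: coordinate_def split: sum.splits)
  then show ?thesis by (simp add: linear_conv_bounded_linear)
qed

lemma along_coordinate: "along (horizontal i) (coordinate j) = (\<lambda>p. if i = j then 1 else 0)"
  unfolding along_bounded_linear[OF bounded_linear_coordinate]
  by (rule ext) (auto simp: coordinate_def horizontal_def X_field_def Y_field_def axis_def split: sum.splits)

text \<open>Cutting off outside the bounded set \<open>\<Omega>\<close> makes the coordinate a bounded multiplier and is invisible for
functions supported in \<open>\<Omega>\<close>.\<close>

definition coordinate_op :: "'n::finite heisenberg set \<Rightarrow> 'n + 'n \<Rightarrow> 'n heisenberg l2 \<Rightarrow> 'n heisenberg l2" where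
  "coordinate_op \<Omega> j = mult_op (\<lambda>p. indicator \<Omega> p * coordinate j p)"

lemma multiplier_coordinate:
  assumes "\<Omega> \<in> sets lebesgue" "bounded \<Omega>"
  shows "multiplier (\<lambda>p. indicator \<Omega> p * coordinate j p)"
proof -
  obtain R where R: "\<And>p. p \<in> \<Omega> \<Longrightarrow> norm p \<le> R" using assms(2) by (auto simp: bounded_iff)
  obtain K where K: "\<And>p. norm (coordinate j p) \<le> norm p * K" "K \<ge> 0"
    using bounded_linear.nonneg_bounded[OF bounded_linear_coordinate] by blast
  have "\<bar>indicator \<Omega> p * coordinate j p\<bar> \<le> \<bar>R\<bar> * K" for p
  proof (cases "p \<in> \<Omega>")
    case True
    then have "norm p * K \<le> \<bar>R\<bar> * K" using R[OF True] K(2) by (intro mult_right_mono) auto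
    then show ?thesis using True K(1)[of p] by simp
  qed (use K(2) in simp)
  moreover have "coordinate j \<in> borel_measurable lebesgue"
    by (rule smooth_measurable[OF smooth_bounded_linear[OF bounded_linear_coordinate]])
  ultimately show ?thesis using assms(1) unfolding multiplier_def by (auto intro: borel_measurable_indicator)
qed

lemma coordinate_op_test:
  assumes "\<Omega> \<in> sets lebesgue" "bounded \<Omega>" "\<phi> \<in> test_functions \<Omega>"
  shows "coordinate_op \<Omega> j (abs_l2 \<phi>) = abs_l2 (\<lambda>p. coordinate j p * \<phi> p)"
proof -
  have "indicator \<Omega> p * coordinate j p * \<phi> p = coordinate j p * \<phi> p" for p
    using test_function_outside[OF assms(3), of p] by (cases "p \<in> \<Omega>") auto
  then show ?thesis
    unfolding coordinate_op_def
      mult_op_abs[OF multiplier_coordinate[OF assms(1,2)] test_function_sq_integrable[OF assms(3)]] by (simp only:)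
qed

text \<open>The product rule, passed to the closure.\<close>

lemma form_domain_coordinate_op:
  fixes \<Omega> :: "'n::finite heisenberg set"
  assumes \<Omega>: "\<Omega> \<in> sets lebesgue" "bounded \<Omega>" and vg: "(v, g) \<in> form_domain \<Omega>"
  shows "(coordinate_op \<Omega> j v, \<chi> q. coordinate_op \<Omega> j (g $ q) + (if q = j then v else 0)) \<in> form_domain \<Omega>"
proof -
  let ?F = "\<lambda>x. (coordinate_op \<Omega> j (fst x), \<chi> q. coordinate_op \<Omega> j (snd x $ q) + (if q = j then fst x else 0))"
  have cont: "continuous_on UNIV (\<lambda>x. coordinate_op \<Omega> j (f x))" if "continuous_on UNIV f"
    for f :: "'b::topological_space \<Rightarrow> _"
    unfolding coordinate_op_def using bounded_linear.continuous_on[OF bounded_linear_mult_op that] .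
  have "continuous_on UNIV (\<lambda>x :: 'n heisenberg l2 \<times> ('n heisenberg l2 ^ ('n + 'n)). if q = j then fst x else 0)" for q
    by (cases "q = j") (auto intro!: continuous_intros)
  then have F: "continuous_on UNIV ?F"
    by (intro continuous_on_Pair cont continuous_on_vec_lambda continuous_on_add continuous_on_fst continuous_on_snd
        continuous_on_id continuous_on_component)
  have test: "?F (gradient_graph \<phi>) \<in> form_domain \<Omega>" if \<phi>: "\<phi> \<in> test_functions \<Omega>" for \<phi>
  proof -
    have sm: "smooth (coordinate j)" by (rule smooth_bounded_linear[OF bounded_linear_coordinate])
    have \<psi>: "(\<lambda>p. coordinate j p * \<phi> p) \<in> test_functions \<Omega>" by (rule test_function_smooth_mult[OF sm \<phi>])
    have "coordinate_op \<Omega> j (abs_l2 (along (horizontal q) \<phi>)) + (if q = j then abs_l2 \<phi> else 0)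
        = abs_l2 (along (horizontal q) (\<lambda>p. coordinate j p * \<phi> p))" for q
    proof -
      have dq: "along (horizontal q) \<phi> \<in> test_functions \<Omega>" by (rule test_function_along[OF affine_horizontal \<phi>])
      have sq: "sq_integrable (\<lambda>p. coordinate j p * along (horizontal q) \<phi> p)"
        by (rule test_function_sq_integrable[OF test_function_smooth_mult[OF sm dq]])
      have "along (horizontal q) (\<lambda>p. coordinate j p * \<phi> p)
          = (\<lambda>p. coordinate j p * along (horizontal q) \<phi> p + (if q = j then \<phi> p else 0))"
        unfolding along_mult[OF sm test_function_smooth[OF \<phi>]] along_coordinate by auto
      then show ?thesis
        unfolding coordinate_op_test[OF \<Omega> dq] using abs_l2_add[OF sq test_function_sq_integrable[OF \<phi>]]
        by (cases "q = j") simp_all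
    qed
    then have "?F (gradient_graph \<phi>) = gradient_graph (\<lambda>p. coordinate j p * \<phi> p)"
      unfolding gradient_graph_def fst_conv snd_conv by (simp add: coordinate_op_test[OF \<Omega> \<phi>])
    then show ?thesis using gradient_graph_in[OF \<psi>] by simp
  qed
  have "(v, g) \<in> ?F -` form_domain \<Omega>"
  proof (rule form_domain_induct[OF _ _ vg])
    show "closed (?F -` form_domain \<Omega>)"
      using F by (intro closed_vimage) (auto simp: form_domain_def)
  qed (use test in auto)
  then show ?thesis unfolding vimage_eq fst_conv snd_conv .
qed

section \<open>The Dirichlet spectrum\<close>

lemma S12_horizontal: "S12 \<Omega> = {u \<in> L2 \<Omega>. \<forall>j. \<exists>g\<in>L2 \<Omega>. is_weak_along \<Omega> (horizontal j) u g}"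
proof -
  have "(\<forall>j. \<exists>g\<in>L2 \<Omega>. is_weak_along \<Omega> (horizontal j) u g) \<longleftrightarrow>
     (\<forall>i. (\<exists>g\<in>L2 \<Omega>. is_weak_along \<Omega> (X_field i) u g) \<and> (\<exists>g\<in>L2 \<Omega>. is_weak_along \<Omega> (Y_field i) u g))" for u
    by (auto simp: split_sum_all)
  then show ?thesis unfolding S12_def by simp
qed

lemma is_weak_along_iff:
  assumes \<Omega>: "\<Omega> \<in> sets lebesgue" and u: "u \<in> L2 \<Omega>" and g: "g \<in> L2 \<Omega>"
  shows "is_weak_along \<Omega> (horizontal j) u g \<longleftrightarrow>
    (\<forall>\<phi>\<in>test_functions \<Omega>. inner (l2_class \<Omega> u) (abs_l2 (along (horizontal j) \<phi>)) = - inner (l2_class \<Omega> g) (abs_l2 \<phi>))"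
proof -
  have "inner (l2_class \<Omega> u) (abs_l2 (along (horizontal j) \<phi>)) = (\<integral>p. u p * along (horizontal j) \<phi> p \<partial>lebesgue_on \<Omega>)"
    "inner (l2_class \<Omega> g) (abs_l2 \<phi>) = (\<integral>p. g p * \<phi> p \<partial>lebesgue_on \<Omega>)" if \<phi>: "\<phi> \<in> test_functions \<Omega>" for \<phi>
  proof -
    have d: "along (horizontal j) \<phi> \<in> test_functions \<Omega>" by (rule test_function_along[OF affine_horizontal \<phi>])
    show "inner (l2_class \<Omega> u) (abs_l2 (along (horizontal j) \<phi>)) = (\<integral>p. u p * along (horizontal j) \<phi> p \<partial>lebesgue_on \<Omega>)"
      unfolding test_function_L2(2)[OF \<Omega> d, symmetric] by (rule inner_l2_class[OF \<Omega> u test_function_L2(1)[OF \<Omega> d]])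
    show "inner (l2_class \<Omega> g) (abs_l2 \<phi>) = (\<integral>p. g p * \<phi> p \<partial>lebesgue_on \<Omega>)"
      unfolding test_function_L2(2)[OF \<Omega> \<phi>, symmetric] by (rule inner_l2_class[OF \<Omega> g test_function_L2(1)[OF \<Omega> \<phi>]])
  qed
  then show ?thesis unfolding is_weak_along_def by simp
qed

definition weak_gradient :: "'n::finite heisenberg set \<Rightarrow> ('n heisenberg \<Rightarrow> real) \<Rightarrow> 'n heisenberg l2 ^ ('n + 'n)" where
  "weak_gradient \<Omega> u = (\<chi> j. l2_class \<Omega> (weak_along \<Omega> (horizontal j) u))"

lemma weak_along_horizontal:
  assumes "u \<in> S12 \<Omega>"
  shows "weak_along \<Omega> (horizontal j) u \<in> L2 \<Omega>" "is_weak_along \<Omega> (horizontal j) u (weak_along \<Omega> (horizontal j) u)"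
proof -
  have "\<exists>g. g \<in> L2 \<Omega> \<and> is_weak_along \<Omega> (horizontal j) u g" using assms by (auto simp: S12_horizontal)
  from someI_ex[OF this] show "weak_along \<Omega> (horizontal j) u \<in> L2 \<Omega>"
    "is_weak_along \<Omega> (horizontal j) u (weak_along \<Omega> (horizontal j) u)"
    unfolding weak_along_def by auto
qed

text \<open>Weak derivatives are unique: this removes the arbitrary choice made by \<open>weak_along\<close>.\<close>

lemma weak_gradient_eqI:
  assumes \<Omega>: "open \<Omega>" and u: "u \<in> S12 \<Omega>"
    and g: "\<And>j. g j \<in> L2 \<Omega>" "\<And>j. is_weak_along \<Omega> (horizontal j) u (g j)"
  shows "weak_gradient \<Omega> u = (\<chi> j. l2_class \<Omega> (g j))"
proof -
  have m: "\<Omega> \<in> sets lebesgue" using \<Omega> by simp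
  have uL: "u \<in> L2 \<Omega>" using u by (simp add: S12_def)
  have "l2_class \<Omega> (weak_along \<Omega> (horizontal j) u) = l2_class \<Omega> (g j)" for j
  proof (rule l2_class_eqI_test_functions[OF \<Omega> weak_along_horizontal(1)[OF u] g(1)])
    fix \<phi> assume "\<phi> \<in> test_functions \<Omega>"
    then show "inner (l2_class \<Omega> (weak_along \<Omega> (horizontal j) u)) (abs_l2 \<phi>) = inner (l2_class \<Omega> (g j)) (abs_l2 \<phi>)"
      using g(2)[of j] weak_along_horizontal(2)[OF u, of j]
      unfolding is_weak_along_iff[OF m uL g(1)] is_weak_along_iff[OF m uL weak_along_horizontal(1)[OF u]]
      by force
  qed
  then show ?thesis by (simp add: weak_gradient_def)
qed

lemma S12_norm_eq:
  fixes \<Omega> :: "'n::finite heisenberg set"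
  assumes \<Omega>: "open \<Omega>" and u: "u \<in> S12 \<Omega>"
  shows "S12_norm \<Omega> u = norm (l2_class \<Omega> u, weak_gradient \<Omega> u)"
proof -
  have m: "\<Omega> \<in> sets lebesgue" using \<Omega> by simp
  have uL: "u \<in> L2 \<Omega>" using u by (simp add: S12_def)
  let ?w = "\<lambda>j. weak_along \<Omega> (horizontal j) u"
  have w: "?w j \<in> L2 \<Omega>" for j by (rule weak_along_horizontal(1)[OF u])
  have int: "integrable (lebesgue_on \<Omega>) (\<lambda>p. (v p)\<^sup>2)" if "v \<in> L2 \<Omega>" for v using that by (simp add: L2_def)
  have norm2: "(\<integral>p. (v p)\<^sup>2 \<partial>lebesgue_on \<Omega>) = (norm (l2_class \<Omega> v))\<^sup>2" if "v \<in> L2 \<Omega>" for v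
    unfolding power2_norm_eq_inner inner_l2_class[OF m that that] by (simp add: power2_eq_square)
  have sum_split: "(\<Sum>i\<in>UNIV. (weak_along \<Omega> (X_field i) u p)\<^sup>2 + (weak_along \<Omega> (Y_field i) u p)\<^sup>2) = (\<Sum>j\<in>(UNIV :: ('n + 'n) set). (?w j p)\<^sup>2)" for p
    by (simp add: sum.distrib UNIV_Plus_UNIV[symmetric] sum.Plus del: UNIV_Plus_UNIV)
  have "(S12_norm \<Omega> u)\<^sup>2 = (\<integral>p. (\<Sum>j\<in>(UNIV :: ('n + 'n) set). (?w j p)\<^sup>2) + (u p)\<^sup>2 \<partial>lebesgue_on \<Omega>)"
    unfolding S12_norm_def sum_split by (subst real_sqrt_pow2) (auto intro!: integral_nonneg_AE AE_I2 add_nonneg_nonneg sum_nonneg)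
  also have "\<dots> = (\<Sum>j\<in>(UNIV :: ('n + 'n) set). (norm (l2_class \<Omega> (?w j)))\<^sup>2) + (norm (l2_class \<Omega> u))\<^sup>2"
    by (simp add: int w uL norm2 Bochner_Integration.integral_add Bochner_Integration.integral_sum)
  also have "\<dots> = (norm (l2_class \<Omega> u, weak_gradient \<Omega> u))\<^sup>2"
    by (simp add: power2_norm_eq_inner inner_vec_def weak_gradient_def)
  finally show ?thesis
    by (rule power2_eq_imp_eq) (auto simp: S12_norm_def intro!: integral_nonneg_AE sum_nonneg add_nonneg_nonneg)
qed

lemma S12_diff_test_function:
  assumes \<Omega>: "open \<Omega>" and u: "u \<in> S12 \<Omega>" and \<phi>: "\<phi> \<in> test_functions \<Omega>"
  shows "(\<lambda>p. u p - \<phi> p) \<in> S12 \<Omega>"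
    and "(l2_class \<Omega> (\<lambda>p. u p - \<phi> p), weak_gradient \<Omega> (\<lambda>p. u p - \<phi> p)) = (l2_class \<Omega> u, weak_gradient \<Omega> u) - gradient_graph \<phi>"
proof -
  have m: "\<Omega> \<in> sets lebesgue" using \<Omega> by simp
  have uL: "u \<in> L2 \<Omega>" using u by (simp add: S12_def)
  have d: "along (horizontal j) \<phi> \<in> test_functions \<Omega>" for j by (rule test_function_along[OF affine_horizontal \<phi>])
  note w = weak_along_horizontal[OF u]
  let ?g = "\<lambda>j p. weak_along \<Omega> (horizontal j) u p - along (horizontal j) \<phi> p"
  note diff = L2_diff[OF m uL test_function_L2(1)[OF m \<phi>]]
  note gdiff = L2_diff[OF m w(1) test_function_L2(1)[OF m d]]
  have weak: "is_weak_along \<Omega> (horizontal j) (\<lambda>p. u p - \<phi> p) (?g j)" for j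
    unfolding is_weak_along_iff[OF m diff(1) gdiff(1)]
  proof
    fix \<psi> assume \<psi>: "\<psi> \<in> test_functions \<Omega>"
    have "inner (l2_class \<Omega> u) (abs_l2 (along (horizontal j) \<psi>)) = - inner (l2_class \<Omega> (weak_along \<Omega> (horizontal j) u)) (abs_l2 \<psi>)"
      using w(2)[of j] \<psi> unfolding is_weak_along_iff[OF m uL w(1)] by blast
    then show "inner (l2_class \<Omega> (\<lambda>p. u p - \<phi> p)) (abs_l2 (along (horizontal j) \<psi>)) = - inner (l2_class \<Omega> (?g j)) (abs_l2 \<psi>)"
      by (simp add: diff(2) gdiff(2) test_function_L2(2)[OF m] \<phi> d inner_diff_left integration_by_parts_l2[OF \<phi> \<psi>])
  qed
  then show S: "(\<lambda>p. u p - \<phi> p) \<in> S12 \<Omega>"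
    unfolding S12_horizontal using diff(1) gdiff(1) by blast
  show "(l2_class \<Omega> (\<lambda>p. u p - \<phi> p), weak_gradient \<Omega> (\<lambda>p. u p - \<phi> p)) = (l2_class \<Omega> u, weak_gradient \<Omega> u) - gradient_graph \<phi>"
    unfolding weak_gradient_eqI[OF \<Omega> S gdiff(1) weak]
    by (simp add: gradient_graph_def weak_gradient_def diff(2) gdiff(2) test_function_L2(2)[OF m] \<phi> d vec_eq_iff)
qed

text \<open>The membership of \<open>S12_0 \<Omega>\<close> is membership in a closure for \<open>S12_norm\<close>. By uniqueness of weak derivatives
this norm is the norm of the pair of function and gradient. Conversely, pairs in the closure do
consist of a function and its weak gradient, because integration by parts is a closed condition.\<close>

lemma S12_0_iff:
  assumes \<Omega>: "open \<Omega>"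
  shows "u \<in> S12_0 \<Omega> \<longleftrightarrow> u \<in> L2 \<Omega> \<and> (\<exists>g. (l2_class \<Omega> u, g) \<in> form_domain \<Omega>)"
proof -
  have m: "\<Omega> \<in> sets lebesgue" using \<Omega> by simp
  have approx: "(\<exists>\<phi>\<in>test_functions \<Omega>. S12_norm \<Omega> (\<lambda>p. u p - \<phi> p) < e) \<longleftrightarrow>
      (\<exists>x\<in>gradient_graph ` test_functions \<Omega>. dist x (l2_class \<Omega> u, weak_gradient \<Omega> u) < e)" if u: "u \<in> S12 \<Omega>" for e
  proof -
    have "S12_norm \<Omega> (\<lambda>p. u p - \<phi> p) = dist (gradient_graph \<phi>) (l2_class \<Omega> u, weak_gradient \<Omega> u)"
      if "\<phi> \<in> test_functions \<Omega>" for \<phi>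
      unfolding S12_norm_eq[OF \<Omega> S12_diff_test_function(1)[OF \<Omega> u that]] S12_diff_test_function(2)[OF \<Omega> u that]
      by (simp only: dist_norm norm_minus_commute)
    then show ?thesis by simp
  qed
  have closure_iff: "u \<in> S12_0 \<Omega> \<longleftrightarrow> (l2_class \<Omega> u, weak_gradient \<Omega> u) \<in> form_domain \<Omega>" if u: "u \<in> S12 \<Omega>"
    unfolding S12_0_def form_domain_def closure_approachable mem_Collect_eq approx[OF u] using u by simp
  show ?thesis
  proof
    assume u0: "u \<in> S12_0 \<Omega>"
    then have "u \<in> S12 \<Omega>" by (simp add: S12_0_def)
    then show "u \<in> L2 \<Omega> \<and> (\<exists>g. (l2_class \<Omega> u, g) \<in> form_domain \<Omega>)"
      using closure_iff u0 by (auto simp: S12_def)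
  next
    assume "u \<in> L2 \<Omega> \<and> (\<exists>g. (l2_class \<Omega> u, g) \<in> form_domain \<Omega>)"
    then obtain g where uL: "u \<in> L2 \<Omega>" and g: "(l2_class \<Omega> u, g) \<in> form_domain \<Omega>" by blast
    have "\<exists>\<gamma>\<in>L2 \<Omega>. l2_class \<Omega> \<gamma> = g $ j" for j
      by (rule l2_class_surj[OF m form_domain_support(2)[OF m g]])
    then obtain \<gamma> where \<gamma>: "\<And>j. \<gamma> j \<in> L2 \<Omega>" "\<And>j. l2_class \<Omega> (\<gamma> j) = g $ j" by metis
    have weak: "is_weak_along \<Omega> (horizontal j) u (\<gamma> j)" for j
      unfolding is_weak_along_iff[OF m uL \<gamma>(1)] using form_domain_antisym_test[OF g] by (simp add: \<gamma>(2))
    have u: "u \<in> S12 \<Omega>" unfolding S12_horizontal using uL \<gamma>(1) weak by blast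
    have "weak_gradient \<Omega> u = g"
      unfolding weak_gradient_eqI[OF \<Omega> u \<gamma>(1) weak] by (simp add: \<gamma>(2) vec_eq_iff)
    then show "u \<in> S12_0 \<Omega>" using closure_iff[OF u] g by simp
  qed
qed

lemma kohn_laplacian_horizontal:
  fixes \<phi> :: "'n::finite heisenberg \<Rightarrow> real"
  shows "kohn_laplacian \<phi> p = (\<Sum>j\<in>(UNIV :: ('n + 'n) set). along (horizontal j) (along (horizontal j) \<phi>) p)"
  by (simp add: kohn_laplacian_def sum.distrib UNIV_Plus_UNIV[symmetric] sum.Plus del: UNIV_Plus_UNIV)

text \<open>One of the two derivatives in each term of the Laplacian is moved to \<open>u\<close>. This is possible because the derivative of a test
function along \<open>horizontal j\<close> is again a test function.\<close>

lemma weak_laplacian_eq: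
  fixes \<Omega> :: "'n::finite heisenberg set"
  assumes \<Omega>: "open \<Omega>" and u: "u \<in> L2 \<Omega>" and g: "(l2_class \<Omega> u, g) \<in> form_domain \<Omega>" and \<phi>: "\<phi> \<in> test_functions \<Omega>"
  shows "(\<integral>p. u p * (- kohn_laplacian \<phi> p) \<partial>lebesgue_on \<Omega>) = inner g (snd (gradient_graph \<phi>))"
proof -
  have m: "\<Omega> \<in> sets lebesgue" using \<Omega> by simp
  have d: "along (horizontal j) \<phi> \<in> test_functions \<Omega>" for j by (rule test_function_along[OF affine_horizontal \<phi>])
  have dd: "along (horizontal j) (along (horizontal j) \<phi>) \<in> test_functions \<Omega>" for j by (rule test_function_along[OF affine_horizontal d])
  let ?L = "\<lambda>p. \<Sum>j\<in>(UNIV :: ('n + 'n) set). (-1) * along (horizontal j) (along (horizontal j) \<phi>) p"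
  have L: "?L \<in> L2 \<Omega>" "l2_class \<Omega> ?L = (\<Sum>j\<in>UNIV. (-1) *\<^sub>R l2_class \<Omega> (along (horizontal j) (along (horizontal j) \<phi>)))"
    using L2_lincomb[OF m finite, of UNIV "\<lambda>j. along (horizontal j) (along (horizontal j) \<phi>)" "\<lambda>_. -1"]
      test_function_L2(1)[OF m dd] by blast+
  have "(\<integral>p. u p * (- kohn_laplacian \<phi> p) \<partial>lebesgue_on \<Omega>) = (\<integral>p. u p * ?L p \<partial>lebesgue_on \<Omega>)"
    by (simp add: kohn_laplacian_horizontal sum_negf)
  also have "\<dots> = inner (l2_class \<Omega> u) (l2_class \<Omega> ?L)" by (rule inner_l2_class[OF m u L(1), symmetric])
  also have "\<dots> = (\<Sum>j\<in>UNIV. - inner (l2_class \<Omega> u) (abs_l2 (along (horizontal j) (along (horizontal j) \<phi>))))"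
    unfolding L(2) inner_sum_right by (simp add: test_function_L2(2)[OF m dd])
  also have "\<dots> = (\<Sum>j\<in>UNIV. inner (g $ j) (abs_l2 (along (horizontal j) \<phi>)))"
    using form_domain_antisym_test[OF g d] by simp
  finally show ?thesis by (simp add: gradient_graph_def inner_vec_def)
qed

text \<open>The equation in the sense of distributions is the weak eigenvalue equation tested with
\<open>gradient_graph \<phi>\<close>; by continuity it extends to the closure \<open>form_domain \<Omega>\<close>.\<close>

lemma eigenspace_form_domain:
  fixes \<Omega> :: "'n::finite heisenberg set"
  assumes \<Omega>: "open \<Omega>" "bounded \<Omega>"
  shows "form_graph.eigenspace (form_domain \<Omega>) \<mu> = l2_class \<Omega> ` dirichlet_eigenspace \<Omega> \<mu>"
proof -
  have m: "\<Omega> \<in> sets lebesgue" using \<Omega> by simp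
  have key: "(\<forall>\<phi>\<in>test_functions \<Omega>. (\<integral>p. u p * (- kohn_laplacian \<phi> p) \<partial>lebesgue_on \<Omega>) = \<mu> * (\<integral>p. u p * \<phi> p \<partial>lebesgue_on \<Omega>))
      \<longleftrightarrow> (\<forall>w h. (w, h) \<in> form_domain \<Omega> \<longrightarrow> inner g h = \<mu> * inner (l2_class \<Omega> u) w)"
    if u: "u \<in> L2 \<Omega>" and g: "(l2_class \<Omega> u, g) \<in> form_domain \<Omega>" for u g
  proof -
    have ip: "(\<integral>p. u p * \<phi> p \<partial>lebesgue_on \<Omega>) = inner (l2_class \<Omega> u) (fst (gradient_graph \<phi>))"
      if "\<phi> \<in> test_functions \<Omega>" for \<phi>
      using inner_l2_class[OF m u test_function_L2(1)[OF m that]] by (simp add: gradient_graph_def test_function_L2(2)[OF m that])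
    show ?thesis
    proof (intro iffI allI impI ballI)
      fix w h assume t: "\<forall>\<phi>\<in>test_functions \<Omega>. (\<integral>p. u p * (- kohn_laplacian \<phi> p) \<partial>lebesgue_on \<Omega>) = \<mu> * (\<integral>p. u p * \<phi> p \<partial>lebesgue_on \<Omega>)"
        and wh: "(w, h) \<in> form_domain \<Omega>"
      have "(w, h) \<in> {x. inner g (snd x) = \<mu> * inner (l2_class \<Omega> u) (fst x)}"
      proof (rule form_domain_induct[OF _ _ wh])
        show "closed {x. inner g (snd x) = \<mu> * inner (l2_class \<Omega> u) (fst x)}"
          by (intro closed_Collect_eq continuous_intros)
        show "gradient_graph \<phi> \<in> {x. inner g (snd x) = \<mu> * inner (l2_class \<Omega> u) (fst x)}" if "\<phi> \<in> test_functions \<Omega>" for \<phi>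
          using t that weak_laplacian_eq[OF \<Omega>(1) u g that] ip[OF that] by simp
      qed
      then show "inner g h = \<mu> * inner (l2_class \<Omega> u) w" by simp
    next
      fix \<phi> assume t: "\<forall>w h. (w, h) \<in> form_domain \<Omega> \<longrightarrow> inner g h = \<mu> * inner (l2_class \<Omega> u) w" and \<phi>: "\<phi> \<in> test_functions \<Omega>"
      have "(fst (gradient_graph \<phi>), snd (gradient_graph \<phi>)) \<in> form_domain \<Omega>" using gradient_graph_in[OF \<phi>] by simp
      then have "inner g (snd (gradient_graph \<phi>)) = \<mu> * inner (l2_class \<Omega> u) (fst (gradient_graph \<phi>))" using t by blast
      then show "(\<integral>p. u p * (- kohn_laplacian \<phi> p) \<partial>lebesgue_on \<Omega>) = \<mu> * (\<integral>p. u p * \<phi> p \<partial>lebesgue_on \<Omega>)"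
        by (simp only: weak_laplacian_eq[OF \<Omega>(1) u g \<phi>] ip[OF \<phi>])
    qed
  qed
  show ?thesis
    unfolding form_graph.eigenspace_def[OF form_graph_form_domain[OF \<Omega>(2)]]
  proof (intro equalityI subsetI)
    fix v assume "v \<in> {v. \<exists>g. (v, g) \<in> form_domain \<Omega> \<and> (\<forall>w h. (w, h) \<in> form_domain \<Omega> \<longrightarrow> inner g h = \<mu> * inner v w)}"
    then obtain g where g: "(v, g) \<in> form_domain \<Omega>" "\<forall>w h. (w, h) \<in> form_domain \<Omega> \<longrightarrow> inner g h = \<mu> * inner v w" by blast
    obtain u where u: "u \<in> L2 \<Omega>" "l2_class \<Omega> u = v" using l2_class_surj[OF m form_domain_support(1)[OF m g(1)]] by blast
    have g': "(l2_class \<Omega> u, g) \<in> form_domain \<Omega>" using g(1) u(2) by simp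
    have "u \<in> dirichlet_eigenspace \<Omega> \<mu>"
      unfolding dirichlet_eigenspace_def mem_Collect_eq key[OF u(1) g'] S12_0_iff[OF \<Omega>(1)] using u g g' by blast
    then show "v \<in> l2_class \<Omega> ` dirichlet_eigenspace \<Omega> \<mu>" using u(2) by blast
  next
    fix v assume "v \<in> l2_class \<Omega> ` dirichlet_eigenspace \<Omega> \<mu>"
    then obtain u where u: "u \<in> dirichlet_eigenspace \<Omega> \<mu>" "v = l2_class \<Omega> u" by blast
    then have uL: "u \<in> L2 \<Omega>" and "\<exists>g. (l2_class \<Omega> u, g) \<in> form_domain \<Omega>"
      unfolding dirichlet_eigenspace_def S12_0_iff[OF \<Omega>(1)] by blast+
    then obtain g where g: "(l2_class \<Omega> u, g) \<in> form_domain \<Omega>" by blast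
    then have "\<forall>w h. (w, h) \<in> form_domain \<Omega> \<longrightarrow> inner g h = \<mu> * inner (l2_class \<Omega> u) w"
      using u(1) key[OF uL g] unfolding dirichlet_eigenspace_def by blast
    then show "v \<in> {v. \<exists>g. (v, g) \<in> form_domain \<Omega> \<and> (\<forall>w h. (w, h) \<in> form_domain \<Omega> \<longrightarrow> inner g h = \<mu> * inner v w)}"
      using g u(2) by blast
  qed
qed

lemma eigenspace_basis:
  fixes \<Omega> :: "'n::finite heisenberg set"
  assumes \<Omega>: "open \<Omega>" "bounded \<Omega>" and mult: "has_multiplicity \<Omega> \<mu> k"
  shows "\<exists>B. finite B \<and> independent B \<and> span B = form_graph.eigenspace (form_domain \<Omega>) \<mu> \<and> card B = k"
proof -
  have m: "\<Omega> \<in> sets lebesgue" using \<Omega> by simp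
  let ?V = "form_graph.eigenspace (form_domain \<Omega>) \<mu>"
  obtain b where b: "\<And>j. j < k \<Longrightarrow> b j \<in> dirichlet_eigenspace \<Omega> \<mu>"
    "\<And>c :: nat \<Rightarrow> real. (AE p in lebesgue_on \<Omega>. (\<Sum>j<k. c j * b j p) = 0) \<Longrightarrow> \<forall>j<k. c j = 0"
    "\<And>u. u \<in> dirichlet_eigenspace \<Omega> \<mu> \<Longrightarrow> \<exists>c :: nat \<Rightarrow> real. AE p in lebesgue_on \<Omega>. u p = (\<Sum>j<k. c j * b j p)"
    using mult unfolding has_multiplicity_def by blast
  have L2: "u \<in> L2 \<Omega>" if "u \<in> dirichlet_eigenspace \<Omega> \<mu>" for u
    using that unfolding dirichlet_eigenspace_def S12_0_iff[OF \<Omega>(1)] by blast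
  have zero: "(\<lambda>p. 0) \<in> L2 \<Omega>" "l2_class \<Omega> (\<lambda>p. 0) = 0"
    using L2_lincomb[OF m finite.emptyI, of "\<lambda>_ _. 0"] by auto
  have comb: "(\<lambda>p. \<Sum>j<k. c j * b j p) \<in> L2 \<Omega>" "l2_class \<Omega> (\<lambda>p. \<Sum>j<k. c j * b j p) = (\<Sum>j<k. c j *\<^sub>R l2_class \<Omega> (b j))" for c
    using L2_lincomb[OF m finite_lessThan, of k b c] b(1) L2 by auto
  have indep: "c j = 0" if "(\<Sum>j<k. c j *\<^sub>R l2_class \<Omega> (b j)) = 0" "j < k" for c j
    using b(2)[of c] l2_class_eq_iff[OF m comb(1)[of c] zero(1)] comb(2)[of c] zero(2) that by simp
  have inj: "inj_on (\<lambda>j. l2_class \<Omega> (b j)) {..<k}"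
  proof (rule inj_onI, rule ccontr)
    fix i j assume ij: "i \<in> {..<k}" "j \<in> {..<k}" "l2_class \<Omega> (b i) = l2_class \<Omega> (b j)" "i \<noteq> j"
    let ?c = "\<lambda>l. (if l = i then 1 else 0) - (if l = j then 1 else (0 :: real))"
    have "(\<Sum>l<k. ?c l *\<^sub>R l2_class \<Omega> (b l)) = 0"
      using ij by (simp add: scaleR_left_diff_distrib sum_subtractf if_distrib[of "\<lambda>r. r *\<^sub>R _"] cong: if_cong)
    from indep[OF this, of i] show False using ij by simp
  qed
  let ?B = "(\<lambda>j. l2_class \<Omega> (b j)) ` {..<k}"
  have "independent ?B"
  proof (rule independent_if_scalars_zero)
    fix f x assume "(\<Sum>x\<in>?B. f x *\<^sub>R x) = 0" and x: "x \<in> ?B"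
    then have "(\<Sum>j<k. f (l2_class \<Omega> (b j)) *\<^sub>R l2_class \<Omega> (b j)) = 0" by (simp add: sum.reindex[OF inj])
    then show "f x = 0" using indep[of "\<lambda>j. f (l2_class \<Omega> (b j))"] x by auto
  qed simp
  moreover have "span ?B = ?V"
  proof
    have "?B \<subseteq> ?V" unfolding eigenspace_form_domain[OF \<Omega>] using b(1) by auto
    then show "span ?B \<subseteq> ?V"
      by (intro span_minimal form_graph.subspace_eigenspace[OF form_graph_form_domain[OF \<Omega>(2)]])
    show "?V \<subseteq> span ?B"
    proof
      fix v assume "v \<in> ?V"
      then obtain u where u: "u \<in> dirichlet_eigenspace \<Omega> \<mu>" "v = l2_class \<Omega> u"
        unfolding eigenspace_form_domain[OF \<Omega>] by blast
      obtain c where "AE p in lebesgue_on \<Omega>. u p = (\<Sum>j<k. c j * b j p)" using b(3)[OF u(1)] by blast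
      then have "v = (\<Sum>j<k. c j *\<^sub>R l2_class \<Omega> (b j))"
        using l2_class_eq_iff[OF m L2[OF u(1)] comb(1)[of c]] u(2) comb(2) by simp
      also have "\<dots> \<in> span ?B" by (intro span_sum span_scale span_base) auto
      finally show "v \<in> span ?B" .
    qed
  qed
  moreover have "card ?B = k" using card_image[OF inj] by simp
  ultimately show ?thesis by (intro exI[of _ ?B]) auto
qed

theorem theorem5p1:
  fixes \<Omega> :: "'n::finite heisenberg set" and lam :: "nat \<Rightarrow> real" and n k :: nat
  assumes "n = CARD('n)"
    and "open \<Omega>" and "connected \<Omega>" and "\<Omega> \<noteq> {}"
    and "bounded \<Omega>" and "smooth_boundary \<Omega>"
    and "dirichlet_eigenvalues \<Omega> lam"
    and "k \<ge> 1"
  shows "real n * (\<Sum>i=1..k. (lam (k + 1) - lam i)\<^sup>2) \<le> 2 * (\<Sum>i=1..k. (lam (k + 1) - lam i) * lam i) \<and>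
     (real n + 1) / (real n * real k) * (\<Sum>i=1..k. lam i) - sqrt (D_tilde n k lam) \<le> lam (k + 1) \<and>
     lam (k + 1) \<le> (real n + 1) / (real n * real k) * (\<Sum>i=1..k. lam i) + sqrt (D_tilde n k lam) \<and>
     D_tilde n k lam \<ge> 0"
proof -
  have m: "\<Omega> \<in> sets lebesgue" using \<open>open \<Omega>\<close> by simp
  interpret form_graph "form_domain \<Omega>" by (rule form_graph_form_domain[OF \<open>bounded \<Omega>\<close>])
  have lam: "\<And>i. 1 \<le> i \<Longrightarrow> lam i \<le> lam (i + 1)" "\<And>\<mu>. finite {i. 1 \<le> i \<and> lam i = \<mu>}"
    "\<And>\<mu>. has_multiplicity \<Omega> \<mu> (card {i. 1 \<le> i \<and> lam i = \<mu>})"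
    using \<open>dirichlet_eigenvalues \<Omega> lam\<close> unfolding dirichlet_eigenvalues_def by auto
  have "real CARD('n + 'n) * (\<Sum>i=1..k. (lam (k + 1) - lam i)\<^sup>2) \<le> 4 * (\<Sum>i=1..k. (lam (k + 1) - lam i) * lam i)"
  proof (rule yang_inequality[where G = "coordinate_op \<Omega>"])
    show "inner (coordinate_op \<Omega> p v) w = inner v (coordinate_op \<Omega> p w)" for p v w
      unfolding coordinate_op_def by (rule inner_mult_op)
  qed (use lam eigenspace_basis[OF \<open>open \<Omega>\<close> \<open>bounded \<Omega>\<close>] form_domain_antisym
      form_domain_coordinate_op[OF m \<open>bounded \<Omega>\<close>] in auto)
  then have I: "real n * (\<Sum>i=1..k. (lam (k + 1) - lam i)\<^sup>2) \<le> 2 * (\<Sum>i=1..k. (lam (k + 1) - lam i) * lam i)"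
    by (simp add: \<open>n = CARD('n)\<close>)
  have "n > 0" "k > 0" using assms(1,8) by auto
  from yang_quadratic_consequence[OF this I]
  have sq: "(lam (k + 1) - (real n + 1) / (real n * real k) * (\<Sum>i=1..k. lam i))\<^sup>2 \<le> D_tilde n k lam" .
  then have "\<bar>lam (k + 1) - (real n + 1) / (real n * real k) * (\<Sum>i=1..k. lam i)\<bar> \<le> sqrt (D_tilde n k lam)"
    by (rule real_le_rsqrt[of "\<bar>_\<bar>", unfolded power2_abs])
  moreover have "0 \<le> D_tilde n k lam" using sq by (rule order_trans[OF zero_le_power2])
  ultimately show ?thesis using I by (auto simp: abs_le_iff)
qed

end
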